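(* Let $E$ and $F$ be arbitrary directed graphs and $K$ any field. If there is a $\Gamma$-monoid isomorphism $M_E^\Gamma\to M_F^\Gamma$, then the following hold. (1) The graph $E$ satisfies Condition (L) if and only if $F$ satisfies Condition (L). (2) The graph $E$ satisfies Condition (K) if and only if $F$ satisfies Condition (K). (3) The lattices of graded ideals of $L_K(E)$ and $L_K(F)$ are isomorphic. (4) $E$ is acyclic if and only if $F$ is acyclic. (5) There is a cycle without an exit in $E$ if and only if there is a cycle without an exit in $F$. (6) There is a cycle with an exit in $E$ if and only if there is a cycle with an exit in $F$. (7) None of the cycles of $E$ have exits if and only if none of the cycles of $F$ have an exit. (8) $E$ satisfies the following condition if and only if $F$ does: the graph is row-finite, no-exit, has no sinks and is such that every infinite path ends in a cycle.
   Context: Setup. $\Gamma=\{x^n\mid n\in\mathbb Z\}$ is the infinite cyclic group generated by $x$. For an arbitrary directed graph $E$ with vertex set $E^0$, edge set $E^1$, source map $\mathbf s$ and range map $\mathbf r$: a vertex $v$ is a sink if $\mathbf s^{-1}(v)=\emptyset$, regular if $\mathbf s^{-1}(v)$ is finite and nonempty, and an infinite emitter if $\mathbf s^{-1}(v)$ is infinite. $E$ is row-finite if it has no infinite emitters. For every infinite emitter $v$ and every finite nonempty $Z\subseteq \mathbf s^{-1}(v)$ introduce a symbol $q_Z=q_Z^v$, called an improper vertex; elements of $E^0$ are called proper vertices. $F_E^\Gamma$ is the free commutative $\Gamma$-monoid on all proper and improper vertices: its elements are finite formal sums of monomials $x^m g$ ($m\in\mathbb Z$, $g$ a proper or improper vertex),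 and $x^n$ acts by $x^n(x^m g)=x^{n+m}g$. The relation $\to_1$ on $F_E^\Gamma-\{0\}$ is given, for all $a\in F_E^\Gamma$ and $m\in\mathbb Z$, by: (A1) $a+x^m v\to_1 a+\sum_{e\in \mathbf s^{-1}(v)}x^{m+1}\mathbf r(e)$ for $v$ regular; (A2) $a+x^m v\to_1 a+x^m q_Z+\sum_{e\in Z}x^{m+1}\mathbf r(e)$ for $v$ an infinite emitter and $Z\subseteq \mathbf s^{-1}(v)$ finite and nonempty; (A3) $a+x^m q_Z\to_1 a+x^m q_W+\sum_{e\in W-Z}x^{m+1}\mathbf r(e)$ for $v$ an infinite emitter and finite nonempty $Z\subsetneq W\subseteq \mathbf s^{-1}(v)$. $\sim$ is the congruence on $F_E^\Gamma$ generated by $\to_1$, and $M_E^\Gamma=F_E^\Gamma/\sim$ is the graph $\Gamma$-monoid. A $\Gamma$-monoid isomorphism is a monoid isomorphism commuting with the action of $\Gamma$. A cycle is a closed path $e_1\cdots e_n$, $n\geq 1$, with $\mathbf s(e_i)\neq \mathbf s(e_j)$ for $i\ne j$; it has an exit if some vertex on it emits an edge which is not on the cycle. A graph is acyclic if it has no cycles and no-exit if no cycle has an exit. An infinite path is a sequence $e_1e_2\ldots$ of edges with $\mathbf r(e_i)=\mathbf s(e_{i+1})$; it ends in a cycle $c$ if $e_ne_{n+1}\ldots=cc\ldots$ for some $n$ (with $c$ based at a suitable vertex). Condition (L): every cycle has an exit. A closed simple path based at $v$ is a path $e_1\cdots e_n$, $n\ge1$, with $\mathbf s(e_1)=v=\mathbf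 r(e_n)$ and $\mathbf s(e_i)\neq v$ for $i>1$. Condition (K): for each vertex $v$ which lies on a closed simple path, there are at least two different closed simple paths based at $v$. $L_K(E)$, the Leavitt path algebra, is the $K$-algebra generated by $E^0\cup E^1\cup\{e^*\mid e\in E^1\}$ subject to: $vw=0$ for distinct vertices and $vv=v$; $\mathbf s(e)e=e\mathbf r(e)=e$; $\mathbf r(e)e^*=e^*\mathbf s(e)=e^*$; $e^*f=0$ for $e\neq f$ and $e^*e=\mathbf r(e)$; $v=\sum_{e\in\mathbf s^{-1}(v)}ee^*$ for $v$ regular. It is $\mathbb Z$-graded by letting $pq^*$ ($p,q$ paths) have degree $|p|-|q|$; graded ideals are two-sided ideals generated by homogeneous elements. *)

theory Defs
  imports
    "Graph_Theory.Arc_Walk"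
    "HOL-Library.Multiset"
    "HOL-Library.Poly_Mapping"
    "HOL-Algebra.Group"
    "HOL-Algebra.Lattice"
begin

section \<open>Graphs\<close>

text \<open>A directed graph is a \<^locale>\<open>wf_digraph\<close>; both \<^const>\<open>verts\<close> and
  \<^const>\<open>arcs\<close> may be empty or infinite, and parallel edges and loops are allowed.
  The source map is \<^const>\<open>tail\<close> and the range map is \<^const>\<open>head\<close>.\<close>

definition is_sink :: "('v, 'e) pre_digraph \<Rightarrow> 'v \<Rightarrow> bool" where
  "is_sink E v \<longleftrightarrow> v \<in> verts E \<and> out_arcs E v = {}"

definition is_regular :: "('v, 'e) pre_digraph \<Rightarrow> 'v \<Rightarrow> bool" where
  "is_regular E v \<longleftrightarrow> v \<in> verts E \<and> finite (out_arcs E v) \<and> out_arcs E v \<noteq> {}"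

definition is_inf_emitter :: "('v, 'e) pre_digraph \<Rightarrow> 'v \<Rightarrow> bool" where
  "is_inf_emitter E v \<longleftrightarrow> v \<in> verts E \<and> infinite (out_arcs E v)"

definition row_finite :: "('v, 'e) pre_digraph \<Rightarrow> bool" where
  "row_finite E \<longleftrightarrow> (\<forall>v \<in> verts E. \<not> is_inf_emitter E v)"

text \<open>A cycle is an edge list with a marked starting vertex: its rotations count as different
  lists. The vertices on it are the sources of its edges.\<close>

definition is_cycle :: "('v, 'e) pre_digraph \<Rightarrow> 'e list \<Rightarrow> bool" where
  "is_cycle E c \<longleftrightarrow> c \<noteq> [] \<and> (\<exists>v. pre_digraph.awalk E v c v) \<and> distinct (map (tail E) c)"

definition has_exit :: "('v, 'e) pre_digraph \<Rightarrow> 'e list \<Rightarrow> bool" where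
  "has_exit E c \<longleftrightarrow> (\<exists>v \<in> tail E ` set c. \<exists>e \<in> out_arcs E v. e \<notin> set c)"

definition acyclic_graph :: "('v, 'e) pre_digraph \<Rightarrow> bool" where
  "acyclic_graph E \<longleftrightarrow> \<not> (\<exists>c. is_cycle E c)"

definition no_exit_graph :: "('v, 'e) pre_digraph \<Rightarrow> bool" where
  "no_exit_graph E \<longleftrightarrow> \<not> (\<exists>c. is_cycle E c \<and> has_exit E c)"

definition condition_L :: "('v, 'e) pre_digraph \<Rightarrow> bool" where
  "condition_L E \<longleftrightarrow> (\<forall>c. is_cycle E c \<longrightarrow> has_exit E c)"

definition closed_simple_path :: "('v, 'e) pre_digraph \<Rightarrow> 'v \<Rightarrow> 'e list \<Rightarrow> bool" where
  "closed_simple_path E v p \<longleftrightarrow>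
     p \<noteq> [] \<and> pre_digraph.awalk E v p v \<and> (\<forall>e \<in> set (tl p). tail E e \<noteq> v)"

definition condition_K :: "('v, 'e) pre_digraph \<Rightarrow> bool" where
  "condition_K E \<longleftrightarrow>
     (\<forall>v \<in> verts E.
        (\<exists>u p. closed_simple_path E u p \<and> v \<in> tail E ` set p) \<longrightarrow>
        (\<exists>p q. p \<noteq> q \<and> closed_simple_path E v p \<and> closed_simple_path E v q))"

definition infinite_path :: "('v, 'e) pre_digraph \<Rightarrow> (nat \<Rightarrow> 'e) \<Rightarrow> bool" where
  "infinite_path E p \<longleftrightarrow> (\<forall>i. p i \<in> arcs E \<and> head E (p i) = tail E (p (Suc i)))"

definition ends_in_cycle :: "('v, 'e) pre_digraph \<Rightarrow> (nat \<Rightarrow> 'e) \<Rightarrow> bool" where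
  "ends_in_cycle E p \<longleftrightarrow>
     (\<exists>c n. is_cycle E c \<and> (\<forall>i. p (n + i) = c ! (i mod length c)))"


section \<open>The graph monoid with its action of the infinite cyclic group\<close>

datatype ('v, 'e) gvertex = Proper 'v | Improper 'v "'e set"

definition gvertices :: "('v, 'e) pre_digraph \<Rightarrow> ('v, 'e) gvertex set" where
  "gvertices E =
     Proper ` verts E \<union>
     {Improper v Z | v Z. is_inf_emitter E v \<and> finite Z \<and> Z \<noteq> {} \<and> Z \<subseteq> out_arcs E v}"

text \<open>The pair \<open>(m, g)\<close> stands for the monomial \<open>x\<^sup>m g\<close>, and a multiset for the
  formal sum of its elements. The group element \<open>x\<^sup>n\<close> is represented by the integer \<open>n\<close>.\<close>

type_synonym ('v, 'e) gsum = "(int \<times> ('v, 'e) gvertex) multiset"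

definition monomial :: "int \<Rightarrow> ('v, 'e) gvertex \<Rightarrow> ('v, 'e) gsum" where
  "monomial m g = {#(m, g)#}"

definition free_gmonoid :: "('v, 'e) pre_digraph \<Rightarrow> ('v, 'e) gsum set" where
  "free_gmonoid E = {a. snd ` set_mset a \<subseteq> gvertices E}"

definition shift :: "int \<Rightarrow> ('v, 'e) gsum \<Rightarrow> ('v, 'e) gsum" where
  "shift n a = image_mset (\<lambda>(m, g). (n + m, g)) a"

definition range_sum :: "('v, 'e) pre_digraph \<Rightarrow> int \<Rightarrow> 'e set \<Rightarrow> ('v, 'e) gsum" where
  "range_sum E m Z = (\<Sum>e\<in>Z. monomial m (Proper (head E e)))"

inductive arrow1 :: "('v, 'e) pre_digraph \<Rightarrow> ('v, 'e) gsum \<Rightarrow> ('v, 'e) gsum \<Rightarrow> bool"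
  for E where
  A1: "\<lbrakk>a \<in> free_gmonoid E; is_regular E v\<rbrakk> \<Longrightarrow>
    arrow1 E (a + monomial m (Proper v)) (a + range_sum E (m + 1) (out_arcs E v))"
| A2: "\<lbrakk>a \<in> free_gmonoid E; is_inf_emitter E v; finite Z; Z \<noteq> {}; Z \<subseteq> out_arcs E v\<rbrakk> \<Longrightarrow>
    arrow1 E (a + monomial m (Proper v))
             (a + monomial m (Improper v Z) + range_sum E (m + 1) Z)"
| A3: "\<lbrakk>a \<in> free_gmonoid E; is_inf_emitter E v; finite W; Z \<noteq> {}; Z \<subset> W; W \<subseteq> out_arcs E v\<rbrakk> \<Longrightarrow>
    arrow1 E (a + monomial m (Improper v Z))
             (a + monomial m (Improper v W) + range_sum E (m + 1) (W - Z))"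

inductive gcong :: "('v, 'e) pre_digraph \<Rightarrow> ('v, 'e) gsum \<Rightarrow> ('v, 'e) gsum \<Rightarrow> bool"
  for E where
  base: "arrow1 E a b \<Longrightarrow> gcong E a b"
| refl: "a \<in> free_gmonoid E \<Longrightarrow> gcong E a a"
| sym: "gcong E a b \<Longrightarrow> gcong E b a"
| trans: "\<lbrakk>gcong E a b; gcong E b c\<rbrakk> \<Longrightarrow> gcong E a c"
| add: "\<lbrakk>gcong E a b; gcong E c d\<rbrakk> \<Longrightarrow> gcong E (a + c) (b + d)"
| shift: "gcong E a b \<Longrightarrow> gcong E (shift n a) (shift n b)"

definition gcong_rel :: "('v, 'e) pre_digraph \<Rightarrow> (('v, 'e) gsum \<times> ('v, 'e) gsum) set" where
  "gcong_rel E = {(a, b). gcong E a b}"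

definition graph_monoid :: "('v, 'e) pre_digraph \<Rightarrow> ('v, 'e) gsum set monoid" where
  "graph_monoid E =
     \<lparr>carrier = free_gmonoid E // gcong_rel E,
      mult = (\<lambda>A B. \<Union>a\<in>A. \<Union>b\<in>B. gcong_rel E `` {a + b}),
      one = gcong_rel E `` {{#}}\<rparr>"

definition gact :: "('v, 'e) pre_digraph \<Rightarrow> int \<Rightarrow> ('v, 'e) gsum set \<Rightarrow> ('v, 'e) gsum set" where
  "gact E n A = (\<Union>a\<in>A. gcong_rel E `` {shift n a})"

definition gamma_monoid_iso ::
  "('v, 'e) pre_digraph \<Rightarrow> ('w, 'f) pre_digraph \<Rightarrow> (('v, 'e) gsum set \<Rightarrow> ('w, 'f) gsum set) \<Rightarrow> bool"
where
  "gamma_monoid_iso E F h \<longleftrightarrow>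
     h \<in> iso (graph_monoid E) (graph_monoid F) \<and>
     h \<one>\<^bsub>graph_monoid E\<^esub> = \<one>\<^bsub>graph_monoid F\<^esub> \<and>
     (\<forall>n. \<forall>A \<in> carrier (graph_monoid E). h (gact E n A) = gact F n (h A))"


section \<open>Algebras that need not have a unit\<close>

text \<open>The algebra of a graph with infinitely many vertices has no unit, so it is not a ring
  in the sense of \<open>HOL-Algebra\<close>.\<close>

record ('k, 'a) nonunital_algebra = "'a partial_object" +
  azero :: 'a
  aadd :: "'a \<Rightarrow> 'a \<Rightarrow> 'a"
  amult :: "'a \<Rightarrow> 'a \<Rightarrow> 'a"
  asmult :: "'k \<Rightarrow> 'a \<Rightarrow> 'a"

definition alg_subspace :: "('k, 'a) nonunital_algebra \<Rightarrow> 'a set \<Rightarrow> bool" where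
  "alg_subspace L U \<longleftrightarrow>
     U \<subseteq> carrier L \<and> azero L \<in> U \<and>
     (\<forall>x \<in> U. \<forall>y \<in> U. aadd L x y \<in> U) \<and> (\<forall>k. \<forall>x \<in> U. asmult L k x \<in> U)"

definition alg_span :: "('k, 'a) nonunital_algebra \<Rightarrow> 'a set \<Rightarrow> 'a set" where
  "alg_span L S = \<Inter>{U. alg_subspace L U \<and> S \<subseteq> U}"

definition alg_ideal :: "('k, 'a) nonunital_algebra \<Rightarrow> 'a set \<Rightarrow> bool" where
  "alg_ideal L I \<longleftrightarrow>
     alg_subspace L I \<and> (\<forall>x \<in> I. \<forall>y \<in> carrier L. amult L x y \<in> I \<and> amult L y x \<in> I)"

definition alg_genideal :: "('k, 'a) nonunital_algebra \<Rightarrow> 'a set \<Rightarrow> 'a set" where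
  "alg_genideal L S = \<Inter>{I. alg_ideal L I \<and> S \<subseteq> I}"


section \<open>Leavitt path algebras\<close>

text \<open>Words over the generators, with concatenation written additively so that
  \<^type>\<open>poly_mapping\<close> provides the monoid algebra of the free monoid.\<close>

datatype 'x free_word = Word (letters: "'x list")

instantiation free_word :: (type) monoid_add
begin

definition "0 = Word []"
definition "u + w = Word (letters u @ letters w)"

instance
  by standard (auto simp: zero_free_word_def plus_free_word_def)

end

text \<open>\<open>Ghost e\<close> is the generator \<open>e\<^sup>*\<close>.\<close>

datatype ('v, 'e) lgen = Vertex 'v | Edge 'e | Ghost 'e

definition lgens :: "('v, 'e) pre_digraph \<Rightarrow> ('v, 'e) lgen set" where
  "lgens E = Vertex ` verts E \<union> Edge ` arcs E \<union> Ghost ` arcs E"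

type_synonym ('v, 'e, 'k) lpoly = "('v, 'e) lgen free_word \<Rightarrow>\<^sub>0 'k"

definition wd :: "('v, 'e) lgen list \<Rightarrow> ('v, 'e, 'k::field) lpoly" where
  "wd xs = Poly_Mapping.single (Word xs) 1"

text \<open>The free algebra without unit: the empty word does not occur.\<close>

definition free_lalg :: "('v, 'e) pre_digraph \<Rightarrow> ('k::field, ('v, 'e, 'k) lpoly) nonunital_algebra"
where
  "free_lalg E =
     \<lparr>carrier = {f. \<forall>w \<in> Poly_Mapping.keys f. letters w \<noteq> [] \<and> set (letters w) \<subseteq> lgens E},
      azero = 0,
      aadd = (+),
      amult = (*),
      asmult = (\<lambda>k. Poly_Mapping.map ((*) k))\<rparr>"

inductive_set lrels :: "('v, 'e) pre_digraph \<Rightarrow> ('v, 'e, 'k::field) lpoly set"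
  for E where
  orth: "\<lbrakk>v \<in> verts E; w \<in> verts E; v \<noteq> w\<rbrakk> \<Longrightarrow> wd [Vertex v, Vertex w] \<in> lrels E"
| idem: "v \<in> verts E \<Longrightarrow> wd [Vertex v, Vertex v] - wd [Vertex v] \<in> lrels E"
| src_edge: "e \<in> arcs E \<Longrightarrow> wd [Vertex (tail E e), Edge e] - wd [Edge e] \<in> lrels E"
| edge_rng: "e \<in> arcs E \<Longrightarrow> wd [Edge e, Vertex (head E e)] - wd [Edge e] \<in> lrels E"
| rng_ghost: "e \<in> arcs E \<Longrightarrow> wd [Vertex (head E e), Ghost e] - wd [Ghost e] \<in> lrels E"
| ghost_src: "e \<in> arcs E \<Longrightarrow> wd [Ghost e, Vertex (tail E e)] - wd [Ghost e] \<in> lrels E"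
| CK1_orth: "\<lbrakk>e \<in> arcs E; f \<in> arcs E; e \<noteq> f\<rbrakk> \<Longrightarrow> wd [Ghost e, Edge f] \<in> lrels E"
| CK1: "e \<in> arcs E \<Longrightarrow> wd [Ghost e, Edge e] - wd [Vertex (head E e)] \<in> lrels E"
| CK2: "is_regular E v \<Longrightarrow>
    wd [Vertex v] - (\<Sum>e\<in>out_arcs E v. wd [Edge e, Ghost e]) \<in> lrels E"

definition lcong :: "('v, 'e) pre_digraph \<Rightarrow> (('v, 'e, 'k::field) lpoly \<times> ('v, 'e, 'k) lpoly) set"
where
  "lcong E =
     {(f, g). f \<in> carrier (free_lalg E) \<and> g \<in> carrier (free_lalg E) \<and>
              f - g \<in> alg_genideal (free_lalg E) (lrels E)}"

text \<open>The argument of type \<^typ>\<open>'k itself\<close> only carries the coefficient field.\<close>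

definition leavitt_algebra ::
  "'k itself \<Rightarrow> ('v, 'e) pre_digraph \<Rightarrow> ('k::field, ('v, 'e, 'k) lpoly set) nonunital_algebra"
where
  "leavitt_algebra K E =
     \<lparr>carrier = carrier (free_lalg E) // lcong E,
      azero = lcong E `` {0},
      aadd = (\<lambda>A B. \<Union>f\<in>A. \<Union>g\<in>B. lcong E `` {f + g}),
      amult = (\<lambda>A B. \<Union>f\<in>A. \<Union>g\<in>B. lcong E `` {f * g}),
      asmult = (\<lambda>k A. \<Union>f\<in>A. lcong E `` {asmult (free_lalg E) k f})\<rparr>"

text \<open>The words of \<open>p\<close> and \<open>p\<^sup>*\<close> for a path \<open>p\<close> with source \<open>u\<close>; a path of length \<open>0\<close>
  is its vertex.\<close>

definition path_word :: "'v \<Rightarrow> 'e list \<Rightarrow> ('v, 'e) lgen list" where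
  "path_word u p = (if p = [] then [Vertex u] else map Edge p)"

definition ghost_word :: "'v \<Rightarrow> 'e list \<Rightarrow> ('v, 'e) lgen list" where
  "ghost_word u p = (if p = [] then [Vertex u] else rev (map Ghost p))"

text \<open>Only \<open>p\<close> and \<open>q\<close> with a common range are considered; otherwise \<open>p q\<^sup>* = 0\<close>.\<close>

definition lcomponent ::
  "'k itself \<Rightarrow> ('v, 'e) pre_digraph \<Rightarrow> int \<Rightarrow> ('v, 'e, 'k::field) lpoly set set" where
  "lcomponent K E n =
     alg_span (leavitt_algebra K E)
       {lcong E `` {wd (path_word u p @ ghost_word u' q)} | u p u' q w.
          pre_digraph.awalk E u p w \<and> pre_digraph.awalk E u' q w \<and>
          int (length p) - int (length q) = n}"

definition graded_ideals ::
  "'k itself \<Rightarrow> ('v, 'e) pre_digraph \<Rightarrow> ('v, 'e, 'k::field) lpoly set set set" where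
  "graded_ideals K E =
     {I. \<exists>H \<subseteq> (\<Union>n. lcomponent K E n). I = alg_genideal (leavitt_algebra K E) H}"

definition graded_ideal_lattice ::
  "'k itself \<Rightarrow> ('v, 'e) pre_digraph \<Rightarrow> ('v, 'e, 'k::field) lpoly set set gorder" where
  "graded_ideal_lattice K E = \<lparr>carrier = graded_ideals K E, eq = (=), le = (\<subseteq>)\<rparr>"

definition lattice_isomorphic :: "'a gorder \<Rightarrow> 'b gorder \<Rightarrow> bool" where
  "lattice_isomorphic L M \<longleftrightarrow>
     Lattice.lattice L \<and> Lattice.lattice M \<and>
     (\<exists>h. bij_betw h (carrier L) (carrier M) \<and>
        (\<forall>x \<in> carrier L. \<forall>y \<in> carrier L.
           h (x \<sqinter>\<^bsub>L\<^esub> y) = h x \<sqinter>\<^bsub>M\<^esub> h y \<and> h (x \<squnion>\<^bsub>L\<^esub> y) = h x \<squnion>\<^bsub>M\<^esub> h y))"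

end

theory Submission
  imports Defs
begin

text \<open>Everything is read off the set of generators \<open>x\<^sup>m v\<close>, \<open>x\<^sup>m q\<^sub>Z\<close> and the defining relations; no
  confluence or cancellation is needed. Call a set \<open>H\<close> of proper and improper vertices closed if it
  satisfies the equivalences that the relations (A1)--(A3) suggest. Closed sets correspond to the
  \<open>\<Gamma>\<close>-order-ideals of the graph monoid, and also to the graded ideals of the Leavitt path algebra,
  where \<open>q\<^sub>Z\<close> stands for \<open>v - \<Sum> e e\<^sup>*\<close> with \<open>e\<close> ranging over \<open>Z\<close>: a homogeneous element of an ideal is
  reduced to such elements by multiplying with edges and ghost edges, and the generators outside \<open>H\<close>
  survive in the representation on boundary paths outside \<open>H\<close>.

  Cycles are detected by elements \<open>a = x\<^sup>n a + b\<close> with \<open>n > 0\<close>. If \<open>b\<close> lies in the order-ideal of \<open>H\<close>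
  and \<open>a\<close> does not, comparing the multisets of ends of all paths of length \<open>k\<close> from \<open>a\<close> outside \<open>H\<close>, for
  large \<open>k\<close>, yields a cycle all of whose exits lead into \<open>H\<close>. For \<open>H = {}\<close> this is a cycle without an
  exit, and for general \<open>H\<close> a failure of Condition (K). If no cycle has an exit, the relations used
  to prove \<open>a = x\<^sup>n a + b\<close> involve a finite set of edges, and counting paths in it gives a
  positive additive \<open>x\<close>-invariant function, so that \<open>b = 0\<close>. Acyclicity, Condition (L) and the no-exit
  property follow, and (8) means that there is no such \<open>b \<noteq> 0\<close> and that all elements are periodic.\<close>

section \<open>The graph monoid and its order ideals\<close>

text \<open>Counting the ends of paths is a safe invariant of the relations only where finitely many
  edges leave each vertex that is met, since (A2) and (A3) may split an infinite sum. The remedy is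
  a cruder invariant, the set of levels at which a terminal vertex is met, which needs no
  finiteness. For \<open>a = x^n a + b\<close> a single terminal vertex would be met at ever lower
  levels, while the exponents in \<open>a\<close> are bounded below. Hence none is met and counting
  becomes legitimate, though only from some level on, because an arrow applied at exponent
  \<open>m\<close> changes what is seen at level \<open>m\<close> itself.

  Improper vertices enter closed sets on the same footing as proper ones. One notion then serves for
  order-ideals, graded ideals and quotients, in place of pairs of a hereditary saturated set and a
  set of breaking vertices.

  The positive function for no-exit graphs meets the same obstacle: its edge set \<open>U\<close> is
  chosen after the derivation of \<open>a = x^n a + b\<close>, so that all edges named in the
  derivation lie in \<open>U\<close>.\<close>

lemma set_range_sum:
  "finite Z \<Longrightarrow> set_mset (range_sum E m Z) = (\<lambda>e. (m, Proper (head E e))) ` Z"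
  by (induction Z rule: finite_induct) (auto simp: range_sum_def monomial_def)

lemma set_monomial [simp]: "set_mset (monomial m g) = {(m, g)}"
  by (simp add: monomial_def)

lemma monomial_ne [simp]: "monomial m g \<noteq> {#}"
  by (simp add: monomial_def)

lemma range_sum_eq_empty: "finite Z \<Longrightarrow> range_sum E m Z = {#} \<longleftrightarrow> Z = {}"
  using set_range_sum[of Z E m] by (auto simp flip: set_mset_eq_empty_iff)

lemma shift_empty [simp]: "shift n {#} = {#}"
  by (simp add: shift_def)

lemma shift_monomial [simp]: "shift n (monomial m g) = monomial (n + m) g"
  by (simp add: shift_def monomial_def)

lemma shift_add [simp]: "shift n (a + b) = shift n a + shift n b"
  by (simp add: shift_def)

lemma shift_shift: "shift n (shift m a) = shift (n + m) a"
  unfolding shift_def multiset.map_comp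
  by (rule image_mset_cong) (auto simp: add.assoc)

lemma shift_0: "shift 0 a = a"
  by (simp add: shift_def)

lemma supp_shift [simp]: "snd ` set_mset (shift n a) = snd ` set_mset a"
  by (simp add: shift_def image_image case_prod_beta)

lemma shift_eq_empty [simp]: "shift n a = {#} \<longleftrightarrow> a = {#}"
  by (simp add: shift_def)

lemma free_empty [simp]: "{#} \<in> free_gmonoid E"
  by (simp add: free_gmonoid_def)

lemma free_add [simp]: "a + b \<in> free_gmonoid E \<longleftrightarrow> a \<in> free_gmonoid E \<and> b \<in> free_gmonoid E"
  by (auto simp: free_gmonoid_def)

lemma free_monomial [simp]: "monomial m g \<in> free_gmonoid E \<longleftrightarrow> g \<in> gvertices E"
  by (auto simp: free_gmonoid_def)

lemma free_shift [simp]: "shift n a \<in> free_gmonoid E \<longleftrightarrow> a \<in> free_gmonoid E"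
  by (simp add: free_gmonoid_def)

lemma Proper_in_gvertices [simp]: "Proper v \<in> gvertices E \<longleftrightarrow> v \<in> verts E"
  by (auto simp: gvertices_def)

lemma Improper_in_gvertices [simp]:
  "Improper v Z \<in> gvertices E \<longleftrightarrow>
     is_inf_emitter E v \<and> finite Z \<and> Z \<noteq> {} \<and> Z \<subseteq> out_arcs E v"
  by (auto simp: gvertices_def)

lemma (in wf_digraph) free_range_sum:
  assumes "finite Z" "Z \<subseteq> out_arcs G v"
  shows "range_sum G m Z \<in> free_gmonoid G"
  using assms by (auto simp: free_gmonoid_def set_range_sum gvertices_def)

lemma (in wf_digraph) arrow1_free:
  assumes "arrow1 G a b"
  shows "a \<in> free_gmonoid G" "b \<in> free_gmonoid G"
proof -
  have "a \<in> free_gmonoid G \<and> b \<in> free_gmonoid G"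
    using assms
  proof (cases rule: arrow1.cases)
    case (A1 a v m)
    then show ?thesis by (auto simp: is_regular_def intro!: free_range_sum)
  next
    case (A2 a v Z m)
    then show ?thesis by (auto simp: is_inf_emitter_def intro!: free_range_sum)
  next
    case (A3 a v W Z m)
    moreover have "finite Z" "W - Z \<subseteq> out_arcs G v" "Z \<subseteq> out_arcs G v" "W \<noteq> {}"
      using A3 by (auto intro: finite_subset)
    ultimately show ?thesis by (auto intro!: free_range_sum)
  qed
  then show "a \<in> free_gmonoid G" "b \<in> free_gmonoid G" by auto
qed

lemma (in wf_digraph) gcong_free:
  assumes "gcong G a b"
  shows "a \<in> free_gmonoid G" "b \<in> free_gmonoid G"
  using assms by (induction rule: gcong.induct) (auto dest: arrow1_free)

lemma arrow1_ne: "arrow1 E a b \<Longrightarrow> a \<noteq> {#} \<and> b \<noteq> {#}"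
  by (cases rule: arrow1.cases) (auto simp: is_regular_def range_sum_eq_empty simp del: in_out_arcs_conv)

text \<open>Both sides of every arrow are nonzero, so the class of 0 is a singleton. This turns
  \<open>b \<noteq> {#}\<close> into a statement about the quotient monoid.\<close>

lemma gcong_empty_iff:
  assumes "gcong E a b" shows "a = {#} \<longleftrightarrow> b = {#}"
  using assms by (induction rule: gcong.induct) (auto dest: arrow1_ne)

section \<open>Congruence classes and the operations on them\<close>

definition gclass :: "('v, 'e) pre_digraph \<Rightarrow> ('v, 'e) gsum \<Rightarrow> ('v, 'e) gsum set" where
  "gclass E a = gcong_rel E `` {a}"

lemma gclass_eq_iff:
  assumes "a \<in> free_gmonoid E"
  shows "gclass E a = gclass E b \<longleftrightarrow> gcong E a b"
proof
  assume "gclass E a = gclass E b"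
  then have "a \<in> gclass E b"
    using gcong.refl[OF assms] by (auto simp: gclass_def gcong_rel_def)
  then show "gcong E a b" by (auto simp: gclass_def gcong_rel_def intro: gcong.sym)
next
  assume "gcong E a b"
  then have "gcong E a c \<longleftrightarrow> gcong E b c" for c
    by (meson gcong.sym gcong.trans)
  then show "gclass E a = gclass E b" by (auto simp: gclass_def gcong_rel_def)
qed

context wf_digraph
begin

lemma carrier_graph_monoid: "carrier (graph_monoid G) = gclass G ` free_gmonoid G"
  by (auto simp: graph_monoid_def gclass_def quotient_def)

lemma mult_graph_monoid:
  assumes "a \<in> free_gmonoid G" "b \<in> free_gmonoid G"
  shows "gclass G a \<otimes>\<^bsub>graph_monoid G\<^esub> gclass G b = gclass G (a + b)"
proof -
  have "gclass G (a' + b') = gclass G (a + b)" if "gcong G a a'" "gcong G b b'" for a' b'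
    using that gcong.add[of G a a' b b'] assms by (metis free_add gclass_eq_iff)
  then have eq: "gclass G (a' + b') = gclass G (a + b)" if "a' \<in> gclass G a" "b' \<in> gclass G b"
    for a' b'
    using that by (simp add: gclass_def gcong_rel_def)
  \<comment> \<open>The union of a constant family is that constant only over nonempty index
    sets.\<close>
  have ne: "a \<in> gclass G a" "b \<in> gclass G b"
    using assms by (auto simp: gclass_def gcong_rel_def intro: gcong.refl)
  have "gclass G a \<otimes>\<^bsub>graph_monoid G\<^esub> gclass G b =
      (\<Union>a'\<in>gclass G a. \<Union>b'\<in>gclass G b. gclass G (a' + b'))"
    by (simp add: graph_monoid_def gclass_def)
  also have "\<dots> = (\<Union>a'\<in>gclass G a. \<Union>b'\<in>gclass G b. gclass G (a + b))"
    by (intro SUP_cong HOL.refl eq)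
  also have "\<dots> = gclass G (a + b)" using ne by blast
  finally show ?thesis .
qed

lemma one_graph_monoid: "\<one>\<^bsub>graph_monoid G\<^esub> = gclass G {#}"
  by (simp add: graph_monoid_def gclass_def)

lemma gact_gclass:
  assumes "a \<in> free_gmonoid G"
  shows "gact G n (gclass G a) = gclass G (shift n a)"
proof -
  have "gclass G (shift n a') = gclass G (shift n a)" if "gcong G a a'" for a'
    using that gcong.shift[of G a a' n] assms by (metis free_shift gclass_eq_iff)
  then have eq: "gclass G (shift n a') = gclass G (shift n a)" if "a' \<in> gclass G a" for a'
    using that by (simp add: gclass_def gcong_rel_def)
  have ne: "a \<in> gclass G a"
    using assms by (auto simp: gclass_def gcong_rel_def intro: gcong.refl)
  have "gact G n (gclass G a) = (\<Union>a'\<in>gclass G a. gclass G (shift n a'))"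
    by (simp add: gact_def gclass_def)
  also have "\<dots> = (\<Union>a'\<in>gclass G a. gclass G (shift n a))"
    by (intro SUP_cong HOL.refl eq)
  also have "\<dots> = gclass G (shift n a)" using ne by blast
  finally show ?thesis .
qed

lemma gclass_eq_one_iff:
  assumes "a \<in> free_gmonoid G"
  shows "gclass G a = \<one>\<^bsub>graph_monoid G\<^esub> \<longleftrightarrow> a = {#}"
  using assms gcong_empty_iff gclass_eq_iff[of a G "{#}"]
  by (auto simp: one_graph_monoid)

end

text \<open>A breaking vertex that belongs to the admissible pair of a graded ideal is a vertex \<open>v\<close> outside
  \<open>H\<close> with some \<open>q\<^sub>Z\<close> in \<open>H\<close>.\<close>

definition closed_set :: "('v, 'e) pre_digraph \<Rightarrow> ('v, 'e) gvertex set \<Rightarrow> bool" where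
  "closed_set E H \<longleftrightarrow> H \<subseteq> gvertices E \<and>
     (\<forall>v. is_regular E v \<longrightarrow>
        (Proper v \<in> H \<longleftrightarrow> (\<forall>e\<in>out_arcs E v. Proper (head E e) \<in> H))) \<and>
     (\<forall>v Z. is_inf_emitter E v \<and> finite Z \<and> Z \<noteq> {} \<and> Z \<subseteq> out_arcs E v \<longrightarrow>
        (Proper v \<in> H \<longleftrightarrow> Improper v Z \<in> H \<and> (\<forall>e\<in>Z. Proper (head E e) \<in> H))) \<and>
     (\<forall>v Z W. is_inf_emitter E v \<and> finite W \<and> Z \<noteq> {} \<and> Z \<subset> W \<and> W \<subseteq> out_arcs E v \<longrightarrow>
        (Improper v Z \<in> H \<longleftrightarrow> Improper v W \<in> H \<and> (\<forall>e\<in>W - Z. Proper (head E e) \<in> H)))"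

lemma closed_setI:
  assumes "H \<subseteq> gvertices E"
    and "\<And>v. is_regular E v \<Longrightarrow>
      Proper v \<in> H \<longleftrightarrow> (\<forall>e\<in>out_arcs E v. Proper (head E e) \<in> H)"
    and "\<And>v Z. \<lbrakk>is_inf_emitter E v; finite Z; Z \<noteq> {}; Z \<subseteq> out_arcs E v\<rbrakk> \<Longrightarrow>
      Proper v \<in> H \<longleftrightarrow> Improper v Z \<in> H \<and> (\<forall>e\<in>Z. Proper (head E e) \<in> H)"
    and "\<And>v Z W. \<lbrakk>is_inf_emitter E v; finite W; Z \<noteq> {}; Z \<subset> W; W \<subseteq> out_arcs E v\<rbrakk> \<Longrightarrow>
      Improper v Z \<in> H \<longleftrightarrow> Improper v W \<in> H \<and> (\<forall>e\<in>W - Z. Proper (head E e) \<in> H)"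
  shows "closed_set E H"
  unfolding closed_set_def
  by (intro conjI allI impI assms(1); (elim conjE)?; rule assms(2-4); assumption)

lemma closed_set_subset: "closed_set E H \<Longrightarrow> H \<subseteq> gvertices E"
  by (simp add: closed_set_def)

lemma closed_set_regular:
  "closed_set E H \<Longrightarrow> is_regular E v \<Longrightarrow>
     Proper v \<in> H \<longleftrightarrow> (\<forall>e\<in>out_arcs E v. Proper (head E e) \<in> H)"
  by (simp add: closed_set_def)

lemma closed_set_inf_emitter:
  "\<lbrakk>closed_set E H; is_inf_emitter E v; finite Z; Z \<noteq> {}; Z \<subseteq> out_arcs E v\<rbrakk> \<Longrightarrow>
     Proper v \<in> H \<longleftrightarrow> Improper v Z \<in> H \<and> (\<forall>e\<in>Z. Proper (head E e) \<in> H)"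
  by (simp add: closed_set_def)

lemma closed_set_improper:
  assumes "closed_set E H" "is_inf_emitter E v" "finite W" "Z \<noteq> {}" "Z \<subseteq> W" "W \<subseteq> out_arcs E v"
  shows "Improper v Z \<in> H \<longleftrightarrow> Improper v W \<in> H \<and> (\<forall>e\<in>W - Z. Proper (head E e) \<in> H)"
  using assms by (cases "Z = W") (auto simp: closed_set_def)

text \<open>Each clause equates one membership with a conjunction of memberships, and such
  equivalences pass to intersections. Joins of closed sets are obtained from this.\<close>

lemma closed_set_Inter:
  assumes "\<And>H. H \<in> C \<Longrightarrow> closed_set E H" "C \<noteq> {}"
  shows "closed_set E (\<Inter>C)"
proof -
  have "Proper v \<in> \<Inter>C \<longleftrightarrow> (\<forall>e\<in>out_arcs E v. Proper (head E e) \<in> \<Inter>C)" if "is_regular E v" for v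
    using closed_set_regular[OF assms(1) that] by auto
  moreover have "Proper v \<in> \<Inter>C \<longleftrightarrow> Improper v Z \<in> \<Inter>C \<and> (\<forall>e\<in>Z. Proper (head E e) \<in> \<Inter>C)"
    if "is_inf_emitter E v" "finite Z" "Z \<noteq> {}" "Z \<subseteq> out_arcs E v" for v Z
    using closed_set_inf_emitter[OF assms(1) that] by auto
  moreover have "Improper v Z \<in> \<Inter>C \<longleftrightarrow> Improper v W \<in> \<Inter>C \<and> (\<forall>e\<in>W - Z. Proper (head E e) \<in> \<Inter>C)"
    if "is_inf_emitter E v" "finite W" "Z \<noteq> {}" "Z \<subset> W" "W \<subseteq> out_arcs E v" for v Z W
    using closed_set_improper[OF assms(1) that(1,2,3) _ that(5)] that(4) by auto
  moreover have "\<Inter>C \<subseteq> gvertices E"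
    using assms closed_set_subset by fastforce
  ultimately show ?thesis by (intro closed_setI)
qed

lemma (in wf_digraph) closed_set_gvertices: "closed_set G (gvertices G)"
proof -
  have "Improper v Z \<in> gvertices G \<longleftrightarrow>
      Improper v W \<in> gvertices G \<and> (\<forall>e\<in>W - Z. Proper (head G e) \<in> gvertices G)"
    if "is_inf_emitter G v" "finite W" "Z \<noteq> {}" "Z \<subset> W" "W \<subseteq> out_arcs G v" for v Z W
    using that finite_subset[of Z W] by auto
  moreover have "Proper v \<in> gvertices G \<longleftrightarrow>
      Improper v Z \<in> gvertices G \<and> (\<forall>e\<in>Z. Proper (head G e) \<in> gvertices G)"
    if "is_inf_emitter G v" "finite Z" "Z \<noteq> {}" "Z \<subseteq> out_arcs G v" for v Z
    using that by (auto simp: is_inf_emitter_def)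
  moreover have "Proper v \<in> gvertices G \<longleftrightarrow> (\<forall>e\<in>out_arcs G v. Proper (head G e) \<in> gvertices G)"
    if "is_regular G v" for v
    using that by (auto simp: is_regular_def)
  ultimately show ?thesis by (intro closed_setI subset_refl)
qed

lemma closed_set_empty: "closed_set E {}"
  unfolding closed_set_def
  by (auto simp: is_regular_def)

text \<open>The clauses of \<open>closed_set\<close> say precisely that an arrow cannot move the
  support into or out of \<open>H\<close>; sums and shifts respect this.\<close>

lemma gcong_closed_set:
  assumes "gcong E a b" "closed_set E H"
  shows "snd ` set_mset a \<subseteq> H \<longleftrightarrow> snd ` set_mset b \<subseteq> H"
  using assms
proof (induction rule: gcong.induct)
  case (base a b)
  then show ?case
  proof (cases rule: arrow1.cases)
    case (A1 a v m)
    then show ?thesis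
      using closed_set_regular[OF base(2) A1(4)]
      by (auto simp: is_regular_def set_range_sum image_subset_iff ball_Un simp del: in_out_arcs_conv)
  next
    case (A2 a v Z m)
    then show ?thesis
      using closed_set_inf_emitter[OF base(2) A2(4-7)]
      by (auto simp: is_regular_def set_range_sum image_subset_iff ball_Un simp del: in_out_arcs_conv)
  next
    case (A3 a v W Z m)
    then show ?thesis
      using closed_set_improper[OF base(2) A3(4-6) _ A3(8)]
      by (auto simp: is_regular_def set_range_sum image_subset_iff ball_Un simp del: in_out_arcs_conv)
  qed
qed auto

text \<open>The last clause is downward closure for the algebraic preorder, in which a summand lies
  below the sum.\<close>

definition gamma_order_ideal :: "('a, 'b) monoid_scheme \<Rightarrow> (int \<Rightarrow> 'a \<Rightarrow> 'a) \<Rightarrow> 'a set \<Rightarrow> bool" where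
  "gamma_order_ideal M act I \<longleftrightarrow> I \<subseteq> carrier M \<and> \<one>\<^bsub>M\<^esub> \<in> I \<and>
     (\<forall>x\<in>I. \<forall>y\<in>I. x \<otimes>\<^bsub>M\<^esub> y \<in> I) \<and> (\<forall>n. \<forall>x\<in>I. act n x \<in> I) \<and>
     (\<forall>x\<in>carrier M. \<forall>y\<in>carrier M. x \<otimes>\<^bsub>M\<^esub> y \<in> I \<longrightarrow> x \<in> I \<and> y \<in> I)"

definition order_ideal_of :: "('v, 'e) pre_digraph \<Rightarrow> ('v, 'e) gvertex set \<Rightarrow> ('v, 'e) gsum set set"
  where "order_ideal_of E H = gclass E ` {a \<in> free_gmonoid E. snd ` set_mset a \<subseteq> H}"

text \<open>Exponent 0 is enough, since the ideals in question are invariant under the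
  action.\<close>

definition closed_set_of :: "('v, 'e) pre_digraph \<Rightarrow> ('v, 'e) gsum set set \<Rightarrow> ('v, 'e) gvertex set"
  where "closed_set_of E I = {g \<in> gvertices E. gclass E (monomial 0 g) \<in> I}"

section \<open>Order-ideals correspond to closed sets\<close>

context wf_digraph
begin

lemma gclass_in_order_ideal_of:
  assumes "closed_set G H" "a \<in> free_gmonoid G"
  shows "gclass G a \<in> order_ideal_of G H \<longleftrightarrow> snd ` set_mset a \<subseteq> H"
proof
  assume "gclass G a \<in> order_ideal_of G H"
  then obtain b where "gclass G a = gclass G b" "snd ` set_mset b \<subseteq> H"
    by (auto simp: order_ideal_of_def)
  then show "snd ` set_mset a \<subseteq> H"
    using gcong_closed_set[OF _ assms(1)] gclass_eq_iff[OF assms(2)] by blast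
qed (use assms in \<open>auto simp: order_ideal_of_def\<close>)

lemma order_ideal_of_ideal:
  assumes "closed_set G H"
  shows "gamma_order_ideal (graph_monoid G) (gact G) (order_ideal_of G H)"
  unfolding gamma_order_ideal_def
proof (intro conjI ballI allI impI)
  show "order_ideal_of G H \<subseteq> carrier (graph_monoid G)"
    by (auto simp: order_ideal_of_def carrier_graph_monoid)
  show "\<one>\<^bsub>graph_monoid G\<^esub> \<in> order_ideal_of G H"
    using gclass_in_order_ideal_of[OF assms free_empty] by (simp add: one_graph_monoid)
next
  fix x y assume "x \<in> order_ideal_of G H" "y \<in> order_ideal_of G H"
  then obtain a b where ab: "x = gclass G a" "y = gclass G b" "a \<in> free_gmonoid G"
     "b \<in> free_gmonoid G" "snd ` set_mset a \<subseteq> H" "snd ` set_mset b \<subseteq> H"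
    by (auto simp: order_ideal_of_def)
  then show "x \<otimes>\<^bsub>graph_monoid G\<^esub> y \<in> order_ideal_of G H"
    by (auto simp: mult_graph_monoid gclass_in_order_ideal_of assms)
next
  fix n x assume "x \<in> order_ideal_of G H"
  then obtain a where a: "x = gclass G a" "a \<in> free_gmonoid G" "snd ` set_mset a \<subseteq> H"
    by (auto simp: order_ideal_of_def)
  then show "gact G n x \<in> order_ideal_of G H"
    by (simp add: gact_gclass gclass_in_order_ideal_of assms)
next
  fix x y assume *: "x \<in> carrier (graph_monoid G)" "y \<in> carrier (graph_monoid G)"
    "x \<otimes>\<^bsub>graph_monoid G\<^esub> y \<in> order_ideal_of G H"
  then obtain a b where ab: "x = gclass G a" "y = gclass G b" "a \<in> free_gmonoid G"
     "b \<in> free_gmonoid G"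
    by (auto simp: carrier_graph_monoid)
  with *(3) have "snd ` set_mset (a + b) \<subseteq> H"
    using gclass_in_order_ideal_of[OF assms, of "a + b"] by (simp add: mult_graph_monoid)
  with ab show "x \<in> order_ideal_of G H" "y \<in> order_ideal_of G H"
    by (auto simp: gclass_in_order_ideal_of[OF assms])
qed

text \<open>An order-ideal contains a sum exactly when it contains both summands, and contains
  \<open>x^m g\<close> exactly when it contains \<open>g\<close>. So membership depends on the
  support alone.\<close>

lemma gclass_in_order_ideal_iff:
  assumes I: "gamma_order_ideal (graph_monoid G) (gact G) I"
  shows "a \<in> free_gmonoid G \<Longrightarrow> gclass G a \<in> I \<longleftrightarrow> snd ` set_mset a \<subseteq> closed_set_of G I"
proof (induction a)
  case empty
  then show ?case using I by (simp add: gamma_order_ideal_def one_graph_monoid)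
next
  case (add p a)
  obtain m g where p: "p = (m, g)" by (cases p)
  have eq: "add_mset p a = monomial m g + a" by (simp add: p monomial_def)
  have free: "monomial m g \<in> free_gmonoid G" "a \<in> free_gmonoid G" "g \<in> gvertices G"
    using add.prems unfolding eq by auto
  have "gclass G (add_mset p a) \<in> I \<longleftrightarrow> gclass G (monomial m g) \<in> I \<and> gclass G a \<in> I"
    using I free unfolding eq mult_graph_monoid[OF free(1,2), symmetric] gamma_order_ideal_def
      carrier_graph_monoid by blast
  moreover have "gclass G (monomial m g) \<in> I \<longleftrightarrow> gclass G (monomial 0 g) \<in> I"
  proof -
    have "gact G m (gclass G (monomial 0 g)) = gclass G (monomial m g)"
      "gact G (-m) (gclass G (monomial m g)) = gclass G (monomial 0 g)"
      using free by (simp_all add: gact_gclass)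
    then show ?thesis using I unfolding gamma_order_ideal_def by metis
  qed
  ultimately show ?case
    using add.IH free by (auto simp: closed_set_of_def p)
qed

text \<open>Each clause is the membership criterion applied to the two sides of an arrow with
  \<open>a = {#}\<close>.\<close>

lemma closed_set_of_closed:
  assumes I: "gamma_order_ideal (graph_monoid G) (gact G) I"
  shows "closed_set G (closed_set_of G I)"
proof -
  let ?H = "closed_set_of G I"
  have key: "snd ` set_mset a \<subseteq> ?H \<longleftrightarrow> snd ` set_mset b \<subseteq> ?H" if "arrow1 G a b" for a b
    using gclass_in_order_ideal_iff[OF I] arrow1_free[OF that] gcong.base[OF that]
    by (metis gclass_eq_iff)
  have 1: "Proper v \<in> ?H \<longleftrightarrow> (\<forall>e\<in>out_arcs G v. Proper (head G e) \<in> ?H)" if "is_regular G v" for v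
    using key[OF A1[OF free_empty that, of 0]] that by (auto simp: set_range_sum is_regular_def image_subset_iff simp del: in_out_arcs_conv)
  have 2: "Proper v \<in> ?H \<longleftrightarrow> Improper v Z \<in> ?H \<and> (\<forall>e\<in>Z. Proper (head G e) \<in> ?H)"
    if "is_inf_emitter G v" "finite Z" "Z \<noteq> {}" "Z \<subseteq> out_arcs G v" for v Z
    using key[OF A2[OF free_empty that, of 0]] that by (auto simp: set_range_sum image_subset_iff)
  have 3: "Improper v Z \<in> ?H \<longleftrightarrow> Improper v W \<in> ?H \<and> (\<forall>e\<in>W - Z. Proper (head G e) \<in> ?H)"
    if "is_inf_emitter G v" "finite W" "Z \<noteq> {}" "Z \<subset> W" "W \<subseteq> out_arcs G v" for v Z W
    using key[OF A3[OF free_empty that, of 0]] that by (auto simp: set_range_sum image_subset_iff)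
  have "?H \<subseteq> gvertices G" by (auto simp: closed_set_of_def)
  from closed_setI[OF this 1 2 3] show ?thesis .
qed

lemma closed_set_of_order_ideal_of:
  assumes "closed_set G H"
  shows "closed_set_of G (order_ideal_of G H) = H"
  using assms closed_set_subset[OF assms]
  by (auto simp: closed_set_of_def gclass_in_order_ideal_of[OF assms])

lemma order_ideal_of_closed_set_of:
  assumes I: "gamma_order_ideal (graph_monoid G) (gact G) I"
  shows "order_ideal_of G (closed_set_of G I) = I"
proof -
  have "I \<subseteq> gclass G ` free_gmonoid G"
    using I by (simp add: gamma_order_ideal_def carrier_graph_monoid)
  then show ?thesis
    using gclass_in_order_ideal_iff[OF I] by (auto simp: order_ideal_of_def)
qed

lemma order_ideal_of_mono: "H \<subseteq> H' \<Longrightarrow> order_ideal_of G H \<subseteq> order_ideal_of G H'"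
  by (auto simp: order_ideal_of_def)

lemma closed_set_of_mono: "I \<subseteq> J \<Longrightarrow> closed_set_of G I \<subseteq> closed_set_of G J"
  by (auto simp: closed_set_of_def)

end

section \<open>Periodic elements modulo an order ideal\<close>

primrec gbase :: "('v, 'e) gvertex \<Rightarrow> 'v" where
  "gbase (Proper v) = v"
| "gbase (Improper v Z) = v"

text \<open>Once the edges in \<open>Z\<close> are split off, \<open>q_Z\<close> stands for the
  remaining edges of \<open>v\<close>, so paths from it start with those.\<close>

primrec out_mod :: "('v, 'e) pre_digraph \<Rightarrow> ('v, 'e) gvertex set \<Rightarrow> ('v, 'e) gvertex \<Rightarrow> 'e set"
where
  "out_mod E H (Proper v) = {e \<in> out_arcs E v. Proper (head E e) \<notin> H}"
| "out_mod E H (Improper v Z) = {e \<in> out_arcs E v - Z. Proper (head E e) \<notin> H}"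

text \<open>The places where a path outside \<open>H\<close> may stop: sinks and infinite emitters.
  An infinite emitter with some \<open>q_Z\<close> in \<open>H\<close> is excepted, because only
  finitely many of its edges avoid \<open>H\<close> and it behaves like a regular vertex.\<close>

definition terminal :: "('v, 'e) pre_digraph \<Rightarrow> ('v, 'e) gvertex set \<Rightarrow> 'v \<Rightarrow> bool" where
  "terminal E H w \<longleftrightarrow>
     w \<in> verts E \<and> Proper w \<notin> H \<and> \<not> is_regular E w \<and> (\<forall>Z. Improper w Z \<notin> H)"

text \<open>A qualitative version of \<open>unf\<close> that stays meaningful when infinitely many
  edges leave a vertex.\<close>

primrec reach :: "('v, 'e) pre_digraph \<Rightarrow> ('v, 'e) gvertex set \<Rightarrow> 'v \<Rightarrow> nat \<Rightarrow> ('v, 'e) gvertex \<Rightarrow> bool"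
where
  "reach E H w 0 g \<longleftrightarrow> gbase g = w"
| "reach E H w (Suc j) g \<longleftrightarrow> (\<exists>e\<in>out_mod E H g. reach E H w j (Proper (head E e)))"

text \<open>The level of an end is the exponent of the monomial plus the length of the path. It is
  the right grading because the relations raise the exponent by one along each edge.\<close>

definition lev :: "('v, 'e) pre_digraph \<Rightarrow> ('v, 'e) gvertex set \<Rightarrow> 'v \<Rightarrow> ('v, 'e) gsum \<Rightarrow> int \<Rightarrow> bool"
where
  "lev E H w a k \<longleftrightarrow>
     (\<exists>m g. (m, g) \<in># a \<and> g \<notin> H \<and> m \<le> k \<and> reach E H w (nat (k - m)) g)"

text \<open>The multiset of ends of the paths of length \<open>j\<close> from \<open>g\<close> outside \<open>H\<close>. If infinitely many
  edges are involved, the sum has the junk value \<open>{#}\<close>.\<close>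

primrec unf :: "('v, 'e) pre_digraph \<Rightarrow> ('v, 'e) gvertex set \<Rightarrow> nat \<Rightarrow> ('v, 'e) gvertex \<Rightarrow> 'v multiset"
where
  "unf E H 0 g = {#gbase g#}"
| "unf E H (Suc j) g = (\<Sum>e\<in>out_mod E H g. unf E H j (Proper (head E e)))"

text \<open>Monomials of exponent above \<open>k\<close> are ignored, so the relations can be
  respected only for large \<open>k\<close>.\<close>

definition unf_at :: "('v, 'e) pre_digraph \<Rightarrow> ('v, 'e) gvertex set \<Rightarrow> int \<Rightarrow> ('v, 'e) gsum \<Rightarrow> 'v multiset"
where
  "unf_at E H k a =
     (\<Sum>(m, g)\<in>#a. if g \<in> H \<or> k < m then {#} else unf E H (nat (k - m)) g)"

section \<open>Elementary rules for levels and path ends\<close>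

lemma size_le_sum_mset:
  fixes f :: "'x \<Rightarrow> nat"
  shows "(\<And>w. w \<in># X \<Longrightarrow> f w \<ge> 1) \<Longrightarrow> size X \<le> (\<Sum>w\<in>#X. f w)"
proof (induction X)
  case (add x X)
  then have "size X \<le> (\<Sum>w\<in>#X. f w)" "f x \<ge> 1" by auto
  then show ?case by simp
qed simp

lemma size_less_sum_mset:
  fixes f :: "'x \<Rightarrow> nat"
  assumes "\<And>w. w \<in># X \<Longrightarrow> f w \<ge> 1" "w \<in># X" "f w \<noteq> 1"
  shows "size X < (\<Sum>w\<in>#X. f w)"
proof -
  obtain Y where Y: "X = add_mset w Y" using assms(2) by (metis insert_DiffM)
  have "size Y \<le> (\<Sum>w\<in>#Y. f w)" using assms(1) Y by (intro size_le_sum_mset) auto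
  moreover have "f w \<ge> 2" using assms(1)[OF assms(2)] assms(3) by linarith
  ultimately show ?thesis using Y by simp
qed

lemma lev_empty [simp]: "\<not> lev E H w {#} k"
  by (simp add: lev_def)

lemma lev_add [simp]: "lev E H w (a + b) k \<longleftrightarrow> lev E H w a k \<or> lev E H w b k"
  by (auto simp: lev_def)

lemma lev_monomial:
  "lev E H w (monomial m g) k \<longleftrightarrow> g \<notin> H \<and> m \<le> k \<and> reach E H w (nat (k - m)) g"
  by (auto simp: lev_def)

lemma lev_shift: "lev E H w (shift n a) k \<longleftrightarrow> lev E H w a (k - n)"
proof
  assume "lev E H w (shift n a) k"
  then obtain m g where "(m, g) \<in># a" "g \<notin> H" "n + m \<le> k" "reach E H w (nat (k - (n + m))) g"
    by (auto simp: lev_def shift_def)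
  then show "lev E H w a (k - n)"
    unfolding lev_def by (intro exI[of _ m] exI[of _ g]) (simp add: diff_diff_eq algebra_simps)
next
  assume "lev E H w a (k - n)"
  then obtain m g where "(m, g) \<in># a" "g \<notin> H" "n + m \<le> k" "reach E H w (nat (k - n - m)) g"
    by (auto simp: lev_def)
  then show "lev E H w (shift n a) k"
    unfolding lev_def by (intro exI[of _ "n + m"] exI[of _ g]) (force simp: diff_diff_eq shift_def)
qed

lemma lev_range_sum:
  assumes "finite Z"
  shows "lev E H w (range_sum E (m + 1) Z) k \<longleftrightarrow>
    m < k \<and> (\<exists>e\<in>Z. Proper (head E e) \<notin> H \<and> reach E H w (nat (k - m - 1)) (Proper (head E e)))"
proof -
  have "nat (k - (m + 1)) = nat (k - m - 1)" by simp
  then show ?thesis by (fastforce simp: lev_def set_range_sum[OF assms])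
qed

lemma lev_supp: "snd ` set_mset b \<subseteq> H \<Longrightarrow> \<not> lev E H w b k"
  by (force simp: lev_def)

lemma unf_at_empty [simp]: "unf_at E H k {#} = {#}"
  by (simp add: unf_at_def)

lemma unf_at_add [simp]: "unf_at E H k (a + b) = unf_at E H k a + unf_at E H k b"
  by (simp add: unf_at_def)

lemma unf_at_monomial:
  "unf_at E H k (monomial m g) = (if g \<in> H \<or> k < m then {#} else unf E H (nat (k - m)) g)"
  by (simp add: unf_at_def monomial_def)

lemma unf_at_sum: "finite A \<Longrightarrow> unf_at E H k (sum f A) = (\<Sum>x\<in>A. unf_at E H k (f x))"
  by (induction A rule: finite_induct) auto

lemma unf_at_shift: "unf_at E H k (shift n a) = unf_at E H (k - n) a"
  by (induction a)
    (auto simp: unf_at_def shift_def algebra_simps case_prod_beta)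

lemma unf_at_range_sum:
  assumes "finite Z" "m < k"
  shows "unf_at E H k (range_sum E (m + 1) Z) =
    (\<Sum>e\<in>{e\<in>Z. Proper (head E e) \<notin> H}. unf E H (nat (k - m - 1)) (Proper (head E e)))"
proof -
  have "nat (k - (m + 1)) = nat (k - m - 1)" by simp
  then have "unf_at E H k (range_sum E (m + 1) Z) =
    (\<Sum>e\<in>Z. if Proper (head E e) \<notin> H then unf E H (nat (k - m - 1)) (Proper (head E e)) else {#})"
    using assms by (auto simp: range_sum_def unf_at_sum unf_at_monomial intro!: sum.cong)
  also have "\<dots> = (\<Sum>e\<in>{e\<in>Z. Proper (head E e) \<notin> H}. unf E H (nat (k - m - 1)) (Proper (head E e)))"
    using assms(1) by (simp add: sum.inter_filter)
  finally show ?thesis .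
qed

lemma unf_at_supp: "snd ` set_mset b \<subseteq> H \<Longrightarrow> unf_at E H k b = {#}"
  by (induction b) (auto simp: unf_at_def)

lemma set_unf_at:
  "w \<in># unf_at E H k a \<longleftrightarrow>
     (\<exists>m g. (m, g) \<in># a \<and> g \<notin> H \<and> m \<le> k \<and> w \<in># unf E H (nat (k - m)) g)"
  by (force simp: unf_at_def split: if_splits)

lemma in_sum_mset_set:
  fixes f :: "'a \<Rightarrow> 'b multiset"
  shows "x \<in># sum f A \<Longrightarrow> \<exists>a\<in>A. x \<in># f a"
  by (induction A rule: infinite_finite_induct) auto

text \<open>The converse can fail: an infinite sum collapses to \<open>{#}\<close> and loses its
  ends.\<close>

lemma reach_unf: "w \<in># unf E H j g \<Longrightarrow> reach E H w j g"
  by (induction j arbitrary: g) (auto dest!: in_sum_mset_set)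

section \<open>Invariance under the relations\<close>

context wf_digraph
begin

text \<open>Apply the clause of \<open>closed_set\<close> that isolates the edge \<open>e\<close>:
  the set \<open>{e}\<close> at an infinite emitter, and the step from \<open>Z\<close> to
  \<open>insert e Z\<close> at an improper vertex.\<close>

lemma out_mod_notin:
  assumes "closed_set G H" "g \<in> gvertices G" "e \<in> out_mod G H g"
  shows "g \<notin> H"
proof (cases g)
  case (Proper v)
  then have e: "e \<in> out_arcs G v" "Proper (head G e) \<notin> H" using assms(3) by auto
  show ?thesis
  proof (cases "finite (out_arcs G v)")
    case True
    then have "is_regular G v" using e assms(2) Proper by (auto simp: is_regular_def)
    then show ?thesis using closed_set_regular[OF assms(1)] e Proper by auto
  next
    case False
    then have "is_inf_emitter G v" using assms(2) Proper by (auto simp: is_inf_emitter_def)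
    from closed_set_inf_emitter[OF assms(1) this, of "{e}"] show ?thesis using e Proper by auto
  qed
next
  case (Improper v Z)
  then have e: "e \<in> out_arcs G v" "e \<notin> Z" "Proper (head G e) \<notin> H" using assms(3) by auto
  have "is_inf_emitter G v" "finite Z" "Z \<noteq> {}" "Z \<subseteq> out_arcs G v"
    using assms(2) Improper by auto
  with closed_set_improper[OF assms(1), of v "insert e Z" Z] show ?thesis
    using e Improper by auto
qed

lemma gbase_notin:
  assumes "closed_set G H" "g \<in> gvertices G" "g \<notin> H"
  shows "Proper (gbase g) \<notin> H"
  using assms closed_set_inf_emitter[OF assms(1)] by (cases g) auto

lemma gbase_in_verts: "g \<in> gvertices G \<Longrightarrow> gbase g \<in> verts G"
  by (cases g) (auto simp: is_inf_emitter_def)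

text \<open>If \<open>q_W\<close> lies in \<open>H\<close>, every edge outside \<open>W\<close>
  leads into \<open>H\<close>, which gives finiteness. If no edge were left, the closure conditions
  would put \<open>g\<close> itself into \<open>H\<close>.\<close>

lemma out_mod_nonterminal:
  assumes H: "closed_set G H" and g: "g \<in> gvertices G" "g \<notin> H" and nt: "\<not> terminal G H (gbase g)"
  shows "finite (out_mod G H g)" "out_mod G H g \<noteq> {}"
proof -
  let ?v = "gbase g"
  have v: "?v \<in> verts G" "Proper ?v \<notin> H"
    using gbase_in_verts[OF g(1)] gbase_notin[OF H g] by auto
  have "finite (out_mod G H g) \<and> out_mod G H g \<noteq> {}"
  proof (cases "is_regular G ?v")
    case True
    then obtain v where "g = Proper v"
      using g(1) by (cases g) (auto simp: is_regular_def is_inf_emitter_def)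
    then show ?thesis using True closed_set_regular[OF H True] v
      by (auto simp: is_regular_def simp del: in_out_arcs_conv)
  next
    case False
    then obtain W where W: "Improper ?v W \<in> H" using nt v by (auto simp: terminal_def)
    then have W': "is_inf_emitter G ?v" "finite W" "W \<noteq> {}" "W \<subseteq> out_arcs G ?v"
      using subsetD[OF closed_set_subset[OF H] W] by auto
    have sub: "out_mod G H (Proper ?v) \<subseteq> W"
    proof
      fix e assume e: "e \<in> out_mod G H (Proper ?v)"
      show "e \<in> W"
      proof (rule ccontr)
        assume "e \<notin> W"
        then show False
          using e out_mod_notin[OF H, of "Improper ?v W" e] W W' by auto
      qed
    qed
    then have fin: "finite (out_mod G H (Proper ?v))" using W'(2) finite_subset by blast
    show ?thesis
    proof (cases g)
      case (Proper v)
      then have "\<exists>e\<in>W. Proper (head G e) \<notin> H"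
        using closed_set_inf_emitter[OF H W'] W v by auto
      then show ?thesis using fin Proper W'(4) by (auto simp del: in_out_arcs_conv)
    next
      case (Improper v Z)
      have Z: "finite Z" "Z \<noteq> {}" "Z \<subseteq> out_arcs G v" using g(1) Improper by auto
      \<comment> \<open>\<open>q_Z\<close> and \<open>q_W\<close> are compared through their common
        refinement.\<close>
      have "finite (Z \<union> W)" "Z \<union> W \<subseteq> out_arcs G v" using Z W' Improper by auto
      then have "Improper v (Z \<union> W) \<in> H"
        using closed_set_improper[OF H, of v "Z \<union> W" W] W W' Improper by auto
      then have "\<exists>e\<in>(Z \<union> W) - Z. Proper (head G e) \<notin> H"
        using closed_set_improper[OF H, of v "Z \<union> W" Z] W W' Z Improper g(2) by auto
      then have "out_mod G H g \<noteq> {}" using Improper W'(4) by (auto simp del: in_out_arcs_conv)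
      moreover have "out_mod G H g \<subseteq> out_mod G H (Proper ?v)" using Improper by auto
      ultimately show ?thesis using fin finite_subset by blast
    qed
  qed
  then show "finite (out_mod G H g)" "out_mod G H g \<noteq> {}" by auto
qed

lemma lev_monomial_step:
  assumes "closed_set G H" "g \<in> gvertices G"
  shows "lev G H w (monomial m g) k \<longleftrightarrow> (g \<notin> H \<and> k = m \<and> gbase g = w) \<or>
    (m < k \<and> (\<exists>e\<in>out_mod G H g. reach G H w (nat (k - m - 1)) (Proper (head G e))))"
proof (cases "m < k")
  case True
  then have "nat (k - m) = Suc (nat (k - m - 1))" by simp
  then show ?thesis using True out_mod_notin[OF assms] by (auto simp: lev_monomial)
qed (auto simp: lev_monomial)

text \<open>Only the path of length 0 could get lost. In (A1) it ends in a regular vertex, which is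
  not terminal. In (A2) and (A3) it is kept by the improper vertex on the right, which has the same
  base and lies outside \<open>H\<close> if that base is terminal.\<close>

lemma arrow1_lev:
  assumes H: "closed_set G H" and w: "terminal G H w" and "arrow1 G a b"
  shows "lev G H w a k \<longleftrightarrow> lev G H w b k"
  using assms(3)
proof (cases rule: arrow1.cases)
  case (A1 c v m)
  then have "v \<in> verts G" "v \<noteq> w" "finite (out_arcs G v)"
    using w by (auto simp: terminal_def is_regular_def)
  then show ?thesis using A1 by (auto simp: lev_monomial_step[OF H] lev_range_sum)
next
  case (A2 c v Z m)
  then have "v \<in> verts G" by (auto simp: is_inf_emitter_def)
  moreover have "v = w \<Longrightarrow> Proper v \<notin> H \<and> Improper v Z \<notin> H" using w by (auto simp: terminal_def)
  moreover have "out_mod G H (Proper v) =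
      {e\<in>Z. Proper (head G e) \<notin> H} \<union> out_mod G H (Improper v Z)"
    using A2 by auto
  ultimately show ?thesis
    using A2 by (auto simp: lev_monomial_step[OF H] lev_range_sum simp del: out_mod.simps)
next
  case (A3 c v W Z m)
  have fin: "finite Z" "Z \<subseteq> out_arcs G v" "W \<noteq> {}" "finite (W - Z)"
    using A3 finite_subset[of Z W] by auto
  moreover have "v = w \<Longrightarrow> Improper v W \<notin> H \<and> Improper v Z \<notin> H" using w by (auto simp: terminal_def)
  moreover have "out_mod G H (Improper v Z) =
      {e\<in>W - Z. Proper (head G e) \<notin> H} \<union> out_mod G H (Improper v W)"
    using A3 by auto
  ultimately show ?thesis
    using A3 by (auto simp: lev_monomial_step[OF H] lev_range_sum simp del: out_mod.simps)
qed

lemma gcong_lev: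
  assumes H: "closed_set G H" and w: "terminal G H w" and "gcong G a b"
  shows "lev G H w a k \<longleftrightarrow> lev G H w b k"
  using assms(3) by (induction arbitrary: k) (auto simp: lev_shift arrow1_lev[OF H w])

lemma unf_at_monomial_step:
  assumes "closed_set G H" "g \<in> gvertices G" "m < k"
  shows "unf_at G H k (monomial m g) =
    (\<Sum>e\<in>out_mod G H g. unf G H (nat (k - m - 1)) (Proper (head G e)))"
proof (cases "g \<in> H")
  case True
  then have "out_mod G H g = {}" using out_mod_notin[OF assms(1,2)] by blast
  then show ?thesis using True by (simp add: unf_at_monomial)
next
  case False
  have "nat (k - m) = Suc (nat (k - m - 1))" using assms(3) by simp
  then show ?thesis using False assms(3) by (simp add: unf_at_monomial)
qed

lemma finite_out_mod:
  assumes H: "closed_set G H" and good: "\<And>w k. terminal G H w \<Longrightarrow> \<not> lev G H w a k"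
    and g: "(m, g) \<in># a" "g \<in> gvertices G"
  shows "finite (out_mod G H g)"
proof (cases "g \<in> H")
  case True
  then have "out_mod G H g = {}" using out_mod_notin[OF H g(2)] by blast
  then show ?thesis by simp
next
  case False
  then have "lev G H (gbase g) a m" using g unfolding lev_def by force
  then show ?thesis using good out_mod_nonterminal(1)[OF H g(2) False] by blast
qed

text \<open>From level \<open>m + 1\<close> on, an arrow merely partitions the sum over the first
  edge; at level \<open>m\<close> the path of length 0 interferes. Splitting the sum requires a
  finite set of edges, which \<open>good\<close> provides.\<close>

lemma arrow1_unf_at:
  assumes H: "closed_set G H" and "arrow1 G a b"
    and good: "\<And>w k. terminal G H w \<Longrightarrow> \<not> lev G H w a k"
  shows "\<exists>K. \<forall>k\<ge>K. unf_at G H k a = unf_at G H k b"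
  using assms(2)
proof (cases rule: arrow1.cases)
  case (A1 c v m)
  then have "v \<in> verts G" "finite (out_arcs G v)"
    by (auto simp: is_regular_def)
  then have "unf_at G H k a = unf_at G H k b" if "k \<ge> m + 1" for k
    using A1 that by (simp add: unf_at_monomial_step[OF H] unf_at_range_sum)
  then show ?thesis by blast
next
  case (A2 c v Z m)
  then have v: "v \<in> verts G" by (auto simp: is_inf_emitter_def)
  then have "finite (out_mod G H (Proper v))"
    using A2 by (intro finite_out_mod[OF H good, of m]) auto
  moreover have "out_mod G H (Proper v) =
      {e\<in>Z. Proper (head G e) \<notin> H} \<union> out_mod G H (Improper v Z)"
     "{e\<in>Z. Proper (head G e) \<notin> H} \<inter> out_mod G H (Improper v Z) = {}"
    using A2 by auto
  ultimately have "unf_at G H k a = unf_at G H k b" if "k \<ge> m + 1" for k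
    using A2 that v
    by (simp add: unf_at_monomial_step[OF H] unf_at_range_sum sum.union_disjoint del: out_mod.simps)
  then show ?thesis by blast
next
  case (A3 c v W Z m)
  have fin: "finite Z" "Z \<subseteq> out_arcs G v" "W \<noteq> {}" "finite (W - Z)"
    using A3 finite_subset[of Z W] by auto
  then have "finite (out_mod G H (Improper v Z))"
    using A3 by (intro finite_out_mod[OF H good, of m]) auto
  moreover have "out_mod G H (Improper v Z) =
      {e\<in>W - Z. Proper (head G e) \<notin> H} \<union> out_mod G H (Improper v W)"
     "{e\<in>W - Z. Proper (head G e) \<notin> H} \<inter> out_mod G H (Improper v W) = {}"
    using A3 by auto
  ultimately have "unf_at G H k a = unf_at G H k b" if "k \<ge> m + 1" for k
    using A3 that fin
    by (simp add: unf_at_monomial_step[OF H] unf_at_range_sum sum.union_disjoint del: out_mod.simps)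
  then show ?thesis by blast
qed

text \<open>The threshold depends on the derivation: it is the maximum of two under sums and
  transitivity, and is translated by shifts. The hypothesis \<open>good\<close> passes to
  intermediate elements by \<open>gcong_lev\<close>, which holds at all levels.\<close>

lemma gcong_unf_at:
  assumes H: "closed_set G H" and "gcong G a b"
    and good: "\<And>w k. terminal G H w \<Longrightarrow> \<not> lev G H w a k"
  shows "\<exists>K. \<forall>k\<ge>K. unf_at G H k a = unf_at G H k b"
  using assms(2,3)
proof (induction rule: gcong.induct)
  case (base a b)
  then show ?case using arrow1_unf_at[OF H] by blast
next
  case (sym a b)
  then obtain K where "\<forall>k\<ge>K. unf_at G H k a = unf_at G H k b"
    using gcong_lev[OF H _ sym(1)] by blast
  then show ?case by (intro exI[of _ K]) simp
next
  case (trans a b c)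
  then obtain K where "\<forall>k\<ge>K. unf_at G H k a = unf_at G H k b" by blast
  moreover obtain L where "\<forall>k\<ge>L. unf_at G H k b = unf_at G H k c"
    using trans gcong_lev[OF H _ trans(1)] by blast
  ultimately show ?case by (intro exI[of _ "max K L"]) simp
next
  case (add a b c d)
  then obtain K where "\<forall>k\<ge>K. unf_at G H k a = unf_at G H k b" by auto
  moreover obtain L where "\<forall>k\<ge>L. unf_at G H k c = unf_at G H k d"
    using add by auto
  ultimately show ?case by (intro exI[of _ "max K L"]) simp
next
  case (shift a b n)
  have "\<not> lev G H w a k" if "terminal G H w" for w k
    using shift.prems[OF that, of "k + n"] by (simp add: lev_shift)
  then obtain K where "\<forall>k\<ge>K. unf_at G H k a = unf_at G H k b" using shift.IH by blast
  then show ?case by (intro exI[of _ "K + n"]) (simp add: unf_at_shift)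
qed auto

lemma good_gvertex_out_mod:
  assumes H: "closed_set G H" and g: "g \<in> gvertices G" "g \<notin> H"
    and good: "\<And>w j. terminal G H w \<Longrightarrow> \<not> reach G H w j g"
  shows "finite (out_mod G H g)" "out_mod G H g \<noteq> {}"
    "\<And>e w j. e \<in> out_mod G H g \<Longrightarrow> terminal G H w \<Longrightarrow> \<not> reach G H w j (Proper (head G e))"
proof -
  have "\<not> terminal G H (gbase g)"
    using good[of "gbase g" 0] by auto
  then show "finite (out_mod G H g)" "out_mod G H g \<noteq> {}"
    using out_mod_nonterminal[OF H g] by auto
  show "\<not> reach G H w j (Proper (head G e))" if "e \<in> out_mod G H g" "terminal G H w" for e w j
    using good[OF that(2), of "Suc j"] that(1) by auto
qed

lemma out_mod_head:
  assumes "e \<in> out_mod G H g"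
  shows "Proper (head G e) \<in> gvertices G" "Proper (head G e) \<notin> H"
  using assms by (cases g; auto)+

text \<open>No vertex that is met is terminal, so a path can always be prolonged, and the sums
  involved are finite.\<close>

lemma unf_ne:
  assumes H: "closed_set G H"
  shows "\<lbrakk>g \<in> gvertices G; g \<notin> H; \<And>w j. terminal G H w \<Longrightarrow> \<not> reach G H w j g\<rbrakk>
    \<Longrightarrow> unf G H j g \<noteq> {#}"
proof (induction j arbitrary: g)
  case (Suc j)
  note out = good_gvertex_out_mod[OF H Suc.prems(1,2)]
  obtain e where e: "e \<in> out_mod G H g"
    using out(2) Suc.prems(3) by auto
  then have "unf G H j (Proper (head G e)) \<noteq> {#}"
    using out(3) Suc.prems(3) out_mod_head[OF e] by (intro Suc.IH) blast+
  moreover have "finite (out_mod G H g)" using out(1) Suc.prems(3) by blast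
  ultimately show ?case using e by (simp add: sum.remove[OF _ e])
qed simp

lemma in_unf_notin:
  assumes H: "closed_set G H"
  shows "\<lbrakk>g \<in> gvertices G; g \<notin> H; w \<in># unf G H j g\<rbrakk> \<Longrightarrow> w \<in> verts G \<and> Proper w \<notin> H"
proof (induction j arbitrary: g)
  case 0
  then show ?case using gbase_notin[OF H] gbase_in_verts by auto
next
  case (Suc j)
  then obtain e where "e \<in> out_mod G H g" "w \<in># unf G H j (Proper (head G e))"
    by (auto dest!: in_sum_mset_set)
  then show ?case using Suc.IH out_mod_head by blast
qed

lemma image_mset_sum_mset:
  fixes f :: "'x \<Rightarrow> 'y multiset" and h :: "'y \<Rightarrow> 'z multiset"
  shows "(\<Sum>y\<in>#(\<Sum>x\<in>A. f x). h y) = (\<Sum>x\<in>A. \<Sum>y\<in>#f x. h y)"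
  by (induction A rule: infinite_finite_induct) auto

text \<open>\<open>unf\<close> adds edges in front, while passing from one level to the next adds
  them at the end. The path must already have an edge: the empty path from \<open>q_Z\<close> ends
  in \<open>v\<close>, which emits more edges than \<open>q_Z\<close> does.\<close>

lemma unf_Suc_end:
  "unf G H (Suc (Suc j)) g = (\<Sum>w\<in>#unf G H (Suc j) g. unf G H 1 (Proper w))"
proof (induction j arbitrary: g)
  case 0
  then show ?case by (simp add: image_mset_sum_mset del: out_mod.simps)
next
  case (Suc j)
  have "unf G H (Suc (Suc (Suc j))) g =
      (\<Sum>e\<in>out_mod G H g. \<Sum>w\<in>#unf G H (Suc j) (Proper (head G e)). unf G H 1 (Proper w))"
    by (subst unf.simps(2)) (simp only: Suc.IH)
  also have "\<dots> = (\<Sum>w\<in>#unf G H (Suc (Suc j)) g. unf G H 1 (Proper w))"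
    by (simp only: image_mset_sum_mset unf.simps(2)[of _ _ "Suc j"])
  finally show ?case .
qed

lemma unf_at_Suc:
  assumes "\<And>m g. (m, g) \<in># a \<Longrightarrow> m < k"
  shows "unf_at G H (k + 1) a = (\<Sum>w\<in>#unf_at G H k a. unf G H 1 (Proper w))"
  using assms
proof (induction a)
  case (add p a)
  obtain m g where p: "p = (m, g)" by (cases p)
  have "m < k" using add.prems p by auto
  then have "nat (k - m) = Suc (nat (k - m - 1))" "nat (k + 1 - m) = Suc (Suc (nat (k - m - 1)))"
    by auto
  then have "unf G H (nat (k + 1 - m)) g = (\<Sum>w\<in>#unf G H (nat (k - m)) g. unf G H 1 (Proper w))"
    by (simp only: unf_Suc_end)
  moreover have "unf_at G H (k + 1) a = (\<Sum>w\<in>#unf_at G H k a. unf G H 1 (Proper w))"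
    using add by auto
  ultimately show ?case using \<open>m < k\<close> by (simp add: p unf_at_def del: unf.simps)
qed simp

lemma size_unf_1: "size (unf G H 1 g) = card (out_mod G H g)"
  by simp

text \<open>The number of paths of length \<open>k\<close> from \<open>a\<close> is nondecreasing in \<open>k\<close> and eventually periodic,
  so every vertex that is reached late emits exactly one edge outside \<open>H\<close>.\<close>

lemma periodic_core:
  assumes H: "closed_set G H" and cong: "gcong G a (shift n a + b)" and n: "n > 0"
    and b: "snd ` set_mset b \<subseteq> H"
  obtains V where "finite V"
    "\<And>w. w \<in> V \<Longrightarrow> w \<in> verts G \<and> Proper w \<notin> H"
    "\<And>w. w \<in> V \<Longrightarrow> \<exists>e. out_mod G H (Proper w) = {e} \<and> head G e \<in> V"
    "\<And>m g. (m, g) \<in># a \<Longrightarrow> g \<notin> H \<Longrightarrow> (\<exists>J. \<forall>j\<ge>J. unf G H j g \<noteq> {#} \<and> set_mset (unf G H j g) \<subseteq> V)"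
    "\<And>m g w j. (m, g) \<in># a \<Longrightarrow> g \<notin> H \<Longrightarrow> terminal G H w \<Longrightarrow> \<not> reach G H w j g"
proof -
  have free: "a \<in> free_gmonoid G" using gcong_free[OF cong] by simp
  \<comment> \<open>Bounds for the exponents in \<open>a\<close>; inserting 0 keeps them defined
    when \<open>a\<close> is empty.\<close>
  define L where "L = Min (insert 0 (fst ` set_mset a))"
  define M where "M = Max (insert 0 (fst ` set_mset a))"
  have LM: "L \<le> m" "m \<le> M" if "(m, g) \<in># a" for m g
    unfolding L_def M_def using that by (force intro!: Min_le Max_ge)+
  \<comment> \<open>A terminal vertex met at level \<open>k\<close> is met at \<open>k - n\<close>,
    \<open>k - 2n\<close> and so on, since \<open>b\<close> contributes nothing outside
    \<open>H\<close>. This descends below the smallest exponent.\<close>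
  have good: "\<not> lev G H w a k" if w: "terminal G H w" for w k
  proof
    assume k: "lev G H w a k"
    have lev_i: "lev G H w a (k - int i * n)" for i
    proof (induction i)
      case (Suc i)
      then have "lev G H w (shift n a + b) (k - int i * n)"
        using gcong_lev[OF H w cong] by blast
      then have "lev G H w a (k - int i * n - n)"
        using lev_supp[OF b, of G w] by (simp add: lev_shift)
      then show ?case by (simp add: algebra_simps)
    qed (use k in simp)
    have L: "L \<le> k'" if "lev G H w a k'" for k'
    proof -
      obtain m g where "(m, g) \<in># a" "m \<le> k'" using \<open>lev G H w a k'\<close> by (auto simp: lev_def)
      then show ?thesis using LM(1)[of m g] by linarith
    qed
    \<comment> \<open>As \<open>n \<ge> 1\<close>, this many periods lead from \<open>k\<close>
      below \<open>L\<close>.\<close>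
    from L[OF lev_i[of "nat (k - L + 1)"]] have 1: "L \<le> k - int (nat (k - L + 1)) * n" .
    have "L \<le> k" by (rule L[OF k])
    then have 2: "k - L + 1 \<le> int (nat (k - L + 1)) * n"
      using n mult_left_mono[of 1 n "k - L + 1"] by simp
    define X where "X = int (nat (k - L + 1)) * n"
    from 1 2 show False unfolding X_def[symmetric] by linarith
  qed
  have goodg: "\<not> reach G H w j g" if "(m, g) \<in># a" "g \<notin> H" "terminal G H w" for m g w j
  proof
    assume "reach G H w j g"
    then have "lev G H w a (m + int j)"
      using that unfolding lev_def by (intro exI[of _ m] exI[of _ g]) simp
    then show False using good that(3) by blast
  qed
  have V: "w \<in> verts G" "Proper w \<notin> H" "finite (out_mod G H (Proper w))" "out_mod G H (Proper w) \<noteq> {}"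
    if "w \<in># unf_at G H k a" for w k
  proof -
    obtain m g where mg: "(m, g) \<in># a" "g \<notin> H" "w \<in># unf G H (nat (k - m)) g"
      using \<open>w \<in># unf_at G H k a\<close> by (auto simp: set_unf_at)
    have "g \<in> gvertices G" using free mg(1) by (force simp: free_gmonoid_def)
    with in_unf_notin[OF H this mg(2,3)] show w: "w \<in> verts G" "Proper w \<notin> H" by auto
    have "\<not> terminal G H w" using goodg[OF mg(1,2)] reach_unf[OF mg(3)] by blast
    then show "finite (out_mod G H (Proper w))" "out_mod G H (Proper w) \<noteq> {}"
      using out_mod_nonterminal[OF H, of "Proper w"] w by auto
  qed
  obtain K0 where "\<forall>k\<ge>K0. unf_at G H k a = unf_at G H k (shift n a + b)"
    using gcong_unf_at[OF H cong good] by blast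
  then have per0: "unf_at G H k a = unf_at G H (k - n) a" if "k \<ge> K0" for k
    using that by (simp add: unf_at_shift unf_at_supp[OF b])
  \<comment> \<open>Beyond \<open>M\<close> every path counted has at least one edge, as
    \<open>unf_at_Suc\<close> demands.\<close>
  define K where "K = max K0 (M + 1)"
  have per: "unf_at G H (k + n) a = unf_at G H k a" if "k \<ge> K" for k
    using per0[of "k + n"] that n by (simp add: K_def)
  have step: "unf_at G H (k + 1) a = (\<Sum>w\<in>#unf_at G H k a. unf G H 1 (Proper w))" if "k \<ge> K" for k
    using that LM by (intro unf_at_Suc) (force simp: K_def)
  define s where "s k = size (unf_at G H k a)" for k
  have s_step: "s (k + 1) = (\<Sum>w\<in>#unf_at G H k a. card (out_mod G H (Proper w)))" if "k \<ge> K" for k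
  proof -
    have size_sum: "size (\<Sum>w\<in>#X. f w) = (\<Sum>w\<in>#X. size (f w))" for X :: "'a multiset" and f :: "'a \<Rightarrow> 'a multiset"
      by (induction X) auto
    show ?thesis unfolding s_def step[OF that] size_sum by (simp only: size_unf_1)
  qed
  have card_ge: "card (out_mod G H (Proper w)) \<ge> 1" if "w \<in># unf_at G H k a" for w k
    using V(3,4)[OF that] by (simp add: Suc_le_eq card_gt_0_iff)
  have s_mono: "s k \<le> s (k + 1)" if "k \<ge> K" for k
    unfolding s_step[OF that] unfolding s_def by (intro size_le_sum_mset card_ge)
  have s_mono': "s k \<le> s (k + int i)" if "k \<ge> K" for k i
  proof (induction i)
    case (Suc i)
    have "s (k + int i) \<le> s (k + int i + 1)" using that by (intro s_mono) simp
    then show ?case using Suc by (simp add: algebra_simps)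
  qed simp
  have card1: "card (out_mod G H (Proper w)) = 1" if "k \<ge> K" "w \<in># unf_at G H k a" for k w
  proof (rule ccontr)
    assume "card (out_mod G H (Proper w)) \<noteq> 1"
    then have "s k < s (k + 1)"
      unfolding s_step[OF that(1)] unfolding s_def using that(2) by (intro size_less_sum_mset card_ge) auto
    \<comment> \<open>Together with the first step this makes \<open>n\<close> steps, after which
      periodicity returns the value \<open>s k\<close>.\<close>
    also have "\<dots> \<le> s (k + 1 + int (nat (n - 1)))" using that(1) by (intro s_mono') simp
    also have "\<dots> = s k" using per[OF that(1)] n by (simp add: s_def algebra_simps)
    finally show False by simp
  qed
  \<comment> \<open>One full period of levels is enough to see all late vertices.\<close>
  define V where "V = (\<Union>k\<in>{K..<K + n}. set_mset (unf_at G H k a))"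
  have head_V: "head G e \<in># unf_at G H (k + 1) a"
    if "k \<ge> K" "w \<in># unf_at G H k a" "out_mod G H (Proper w) = {e}" for k w e
  proof -
    have "head G e \<in># unf G H 1 (Proper w)" using that(3) by (simp del: out_mod.simps)
    then show ?thesis unfolding step[OF that(1)] using that(2) by (auto simp del: unf.simps)
  qed
  have inV: "set_mset (unf_at G H (K + int i) a) \<subseteq> V" for i
  proof (induction i rule: less_induct)
    case (less i)
    show ?case
    proof (cases "int i < n")
      case True
      then show ?thesis by (force simp: V_def)
    next
      case False
      then have "unf_at G H (K + int (i - nat n)) a = unf_at G H (K + int i) a"
        using per[of "K + int (i - nat n)"] n by (simp add: of_nat_diff)
      then show ?thesis using less[of "i - nat n"] n False by simp
    qed
  qed
  have inV': "set_mset (unf_at G H k a) \<subseteq> V" if "k \<ge> K" for k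
    using inV[of "nat (k - K)"] that by simp
  show ?thesis
  proof
    show "finite V" by (simp add: V_def)
    show "w \<in> verts G \<and> Proper w \<notin> H" if "w \<in> V" for w
      using that V(1,2) by (auto simp: V_def)
    show "\<exists>e. out_mod G H (Proper w) = {e} \<and> head G e \<in> V" if "w \<in> V" for w
    proof -
      obtain k where k: "k \<ge> K" "w \<in># unf_at G H k a" using \<open>w \<in> V\<close> by (auto simp: V_def)
      then obtain e where "out_mod G H (Proper w) = {e}" using card1 card_1_singletonE by blast
      then show ?thesis using head_V[OF k] inV'[of "k + 1"] k(1) by auto
    qed
    show "\<exists>J. \<forall>j\<ge>J. unf G H j g \<noteq> {#} \<and> set_mset (unf G H j g) \<subseteq> V" if mg: "(m, g) \<in># a" "g \<notin> H" for m g
    proof (intro exI[of _ "nat (K - m)"] allI impI conjI)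
      fix j assume j: "j \<ge> nat (K - m)"
      have "g \<in> gvertices G" using free mg(1) by (force simp: free_gmonoid_def)
      then show "unf G H j g \<noteq> {#}" using goodg[OF mg] by (intro unf_ne[OF H _ mg(2)])
      have "set_mset (unf G H j g) \<subseteq> set_mset (unf_at G H (m + int j) a)"
        using mg by (force simp: set_unf_at)
      also have "\<dots> \<subseteq> V" using j by (intro inV') simp
      finally show "set_mset (unf G H j g) \<subseteq> V" .
    qed
    show "\<not> reach G H w j g" if "(m, g) \<in># a" "g \<notin> H" "terminal G H w" for m g w j
      using goodg that .
  qed
qed

end

section \<open>Cycles and periodic classes\<close>

text \<open>Two equal sources force periodicity from there on. Choosing the smallest distance
  between equal sources anywhere on the path makes the sources within one period distinct, as a
  cycle requires.\<close>

lemma (in wf_digraph) deterministic_path_ends_in_cycle: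
  assumes p: "infinite_path G p" and fin: "finite S" and S: "\<And>i. tail G (p i) \<in> S"
    and det: "\<And>i j. tail G (p i) = tail G (p j) \<Longrightarrow> p i = p j"
  shows "\<exists>c n. is_cycle G c \<and> set c \<subseteq> range p \<and> (\<forall>i. p (n + i) = c ! (i mod length c))"
proof -
  let ?R = "\<lambda>d. d > 0 \<and> (\<exists>i. tail G (p (i + d)) = tail G (p i))"
  have "\<not> inj (\<lambda>i. tail G (p i))"
    using fin S by (metis finite_subset image_subsetI infinite_UNIV_nat finite_imageD)
  then obtain i j where "tail G (p i) = tail G (p j)" "i < j"
    unfolding inj_def by (metis linorder_neqE_nat)
  then have "?R (j - i)" by (intro conjI exI[of _ i]) auto
  then have ex: "\<exists>d. ?R d" by blast
  define d where "d = (LEAST d. ?R d)"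
  have "?R d" unfolding d_def using LeastI_ex[OF ex] .
  then obtain n where d: "d > 0" and n: "tail G (p (n + d)) = tail G (p n)" by blast
  have least: "d \<le> d'" if "?R d'" for d' unfolding d_def using Least_le[of ?R, OF that] .
  have adj: "tail G (p (Suc i)) = head G (p i)" and arcs: "p i \<in> arcs G" for i
    using p by (auto simp: infinite_path_def)
  have per: "p (n + i + d) = p (n + i)" for i
  proof (induction i)
    case 0
    then show ?case using det[OF n] by simp
  next
    case (Suc i)
    then show ?case using det[of "n + Suc i + d" "n + Suc i"] adj[of "n + i + d"] adj[of "n + i"]
      by simp
  qed
  define c where "c = map (\<lambda>i. p (n + i)) [0..<d]"
  have len: "length c = d" by (simp add: c_def)
  have eq: "p (n + i) = c ! (i mod length c)" for i
  proof (induction i rule: less_induct)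
    case (less i)
    show ?case
    proof (cases "i < d")
      case True
      then show ?thesis by (simp add: c_def)
    next
      case False
      then have "p (n + i) = p (n + (i - d))" using per[of "i - d"] by simp
      also have "\<dots> = c ! ((i - d) mod d)" using less[of "i - d"] False d len by simp
      finally show ?thesis using False len by (simp add: le_mod_geq)
    qed
  qed
  have walk: "awalk (tail G (p k)) (map (\<lambda>i. p (k + i)) [0..<l]) (tail G (p (k + l)))" for k l
  proof (induction l arbitrary: k)
    case 0
    then show ?case using arcs by (simp add: awalk_Nil_iff)
  next
    case (Suc l)
    have "map (\<lambda>i. p (k + i)) [0..<Suc l] = p k # map (\<lambda>i. p (Suc k + i)) [0..<l]"
      by (simp add: upt_conv_Cons map_Suc_upt[symmetric] comp_def del: upt_Suc)
    then show ?case using Suc[of "Suc k"] arcs adj by (simp add: awalk_Cons_iff)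
  qed
  have "distinct (map (tail G) c)"
  proof (rule ccontr)
    assume "\<not> distinct (map (tail G) c)"
    then obtain i j where ij: "i < j" "j < d" "tail G (p (n + i)) = tail G (p (n + j))"
      unfolding c_def distinct_conv_nth by (auto simp: ) (metis linorder_neqE_nat)
    then have "?R (j - i)" by (intro conjI exI[of _ "n + i"]) auto
    then have "d \<le> j - i" by (rule least)
    then show False using ij by simp
  qed
  moreover have "awalk (tail G (p n)) c (tail G (p n))"
    using walk[of n d] n by (simp add: c_def)
  moreover have "c \<noteq> []" using d by (simp add: c_def)
  ultimately have "is_cycle G c" by (auto simp: is_cycle_def)
  moreover have "set c \<subseteq> range p" by (auto simp: c_def)
  ultimately show ?thesis using eq by blast
qed

section \<open>Walks along cycles in the graph monoid\<close>

context wf_digraph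
begin

lemma awalk_tail_hd: "awalk u p v \<Longrightarrow> p \<noteq> [] \<Longrightarrow> tail G (hd p) = u"
  by (cases p) (auto simp: awalk_Cons_iff)

text \<open>A shortest nonempty closed walk at \<open>v\<close> repeats no source, as the part
  between two occurrences could be cut out.\<close>

lemma closed_walk_cycle:
  assumes "awalk v p v" "p \<noteq> []"
  obtains c where "is_cycle G c" "awalk v c v"
proof -
  let ?P = "\<lambda>p. awalk v p v \<and> p \<noteq> []"
  define c where "c = (ARG_MIN length p. ?P p)"
  have "?P p" using assms by simp
  then have c: "?P c" and min: "\<And>q. ?P q \<Longrightarrow> length c \<le> length q"
    unfolding c_def by (rule arg_min_natI) (rule arg_min_nat_le)
  have "distinct (map (tail G) c)"
  proof (rule ccontr)
    assume "\<not> distinct (map (tail G) c)"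
    then obtain xs y ys zs where "map (tail G) c = xs @ [y] @ ys @ [y] @ zs"
      using not_distinct_decomp by blast
    then obtain c1 c' where 1: "c = c1 @ c'" "map (tail G) c' = y # ys @ y # zs"
      by (auto simp: map_eq_append_conv)
    then obtain e c'' where 2: "c' = e # c''" "tail G e = y" "map (tail G) c'' = ys @ y # zs"
      by (auto simp: map_eq_Cons_conv)
    then obtain c2 f c3 where "c'' = c2 @ f # c3" "tail G f = y"
      by (auto simp: map_eq_append_conv map_eq_Cons_conv)
    with 1 2 have c': "c = c1 @ e # c2 @ f # c3" "tail G e = y" "tail G f = y" by simp_all
    \<comment> \<open>The second occurrence \<open>f\<close> is kept, so the shortened walk is still
      nonempty and based at \<open>v\<close>.\<close>
    then have "awalk v (c1 @ f # c3) v" using c by (auto simp: awalk_Cons_iff)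
    then show False using min[of "c1 @ f # c3"] c' by simp
  qed
  then show ?thesis using that c by (auto simp: is_cycle_def)
qed

lemma cycle_out_arcs:
  assumes "is_cycle G c" "f \<in> set c" "e \<in> out_arcs G (tail G f)" "e \<in> set c"
  shows "e = f"
  using assms by (auto simp: is_cycle_def distinct_map inj_on_def)

lemma no_exit_cycle_out_arcs:
  assumes "is_cycle G c" "\<not> has_exit G c" "f \<in> set c"
  shows "out_arcs G (tail G f) = {f}"
proof -
  have "f \<in> arcs G" using assms by (auto simp: is_cycle_def awalk_def)
  moreover have "e = f" if "e \<in> out_arcs G (tail G f)" for e
    using that assms cycle_out_arcs[OF assms(1,3) that] by (auto simp: has_exit_def)
  ultimately show ?thesis by auto
qed

text \<open>Following the only edge outside \<open>H\<close> gives a deterministic infinite path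
  inside the finite set \<open>V\<close>.\<close>

lemma cycle_of_singleton_core:
  assumes fin: "finite V" and w0: "w0 \<in> V"
    and V: "\<And>w. w \<in> V \<Longrightarrow> \<exists>e. out_mod G H (Proper w) = {e} \<and> head G e \<in> V"
  shows "\<exists>c. is_cycle G c \<and> (\<forall>f\<in>set c. tail G f \<in> V \<and> out_mod G H (Proper (tail G f)) = {f})"
proof -
  obtain nxt where nxt: "\<And>w. w \<in> V \<Longrightarrow> out_mod G H (Proper w) = {nxt w} \<and> head G (nxt w) \<in> V"
    using V by metis
  define w where "w i = ((\<lambda>w. head G (nxt w)) ^^ i) w0" for i
  have wV: "w i \<in> V" for i by (induction i) (auto simp: w_def w0 nxt)
  define p where "p i = nxt (w i)" for i
  have p: "p i \<in> arcs G" "tail G (p i) = w i" for i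
    using nxt[OF wV, of i] by (auto simp: p_def)
  have "infinite_path G p"
    unfolding infinite_path_def using p(1) p(2)[of "Suc _"] by (simp add: p_def w_def)
  then obtain c where "is_cycle G c" "set c \<subseteq> range p"
    using deterministic_path_ends_in_cycle[OF _ fin, of p] p wV by (metis p_def)
  moreover have "tail G f \<in> V \<and> out_mod G H (Proper (tail G f)) = {f}" if "f \<in> range p" for f
    using that nxt[OF wV] wV p by (auto simp: p_def simp del: out_mod.simps)
  ultimately show ?thesis by blast
qed

text \<open>The remainder \<open>b\<close> collects the exits of the path.\<close>

lemma path_expand:
  assumes "awalk u p w"
  shows "\<exists>b. gcong G (monomial m (Proper u)) (monomial (m + int (length p)) (Proper w) + b) \<and>
    (\<forall>g\<in>snd ` set_mset b. \<exists>f\<in>set p.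
       (\<exists>e\<in>out_arcs G (tail G f) - {f}. g = Proper (head G e)) \<or>
       is_inf_emitter G (tail G f) \<and> g = Improper (tail G f) {f}) \<and>
    (b = {#} \<longleftrightarrow> (\<forall>f\<in>set p. out_arcs G (tail G f) = {f}))"
  using assms
proof (induction p arbitrary: u m)
  case Nil
  then have "u = w" "u \<in> verts G" by (auto simp: awalk_Nil_iff)
  then show ?case by (intro exI[of _ "{#}"]) (auto intro: gcong.refl)
next
  case (Cons e es)
  then have e: "e \<in> out_arcs G u" "tail G e = u" "e \<in> arcs G" "u \<in> verts G"
    and es: "awalk (head G e) es w"
    by (auto simp: awalk_Cons_iff)
  obtain b where b: "gcong G (monomial (m + 1) (Proper (head G e)))
        (monomial (m + 1 + int (length es)) (Proper w) + b)"
      "\<forall>g\<in>snd ` set_mset b. \<exists>f\<in>set es.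
       (\<exists>e\<in>out_arcs G (tail G f) - {f}. g = Proper (head G e)) \<or>
       is_inf_emitter G (tail G f) \<and> g = Improper (tail G f) {f}"
      "b = {#} \<longleftrightarrow> (\<forall>f\<in>set es. out_arcs G (tail G f) = {f})"
    using Cons.IH[OF es] by blast
  obtain x where x: "gcong G (monomial m (Proper u)) (monomial (m + 1) (Proper (head G e)) + x)"
    "\<forall>g\<in>snd ` set_mset x. (\<exists>e'\<in>out_arcs G u - {e}. g = Proper (head G e')) \<or>
       is_inf_emitter G u \<and> g = Improper u {e}"
    "x = {#} \<longleftrightarrow> out_arcs G u = {e}" "x \<in> free_gmonoid G"
  proof (cases "finite (out_arcs G u)")
    case True
    then have "is_regular G u" using e by (auto simp: is_regular_def)
    then have "gcong G (monomial m (Proper u)) (range_sum G (m + 1) (out_arcs G u))"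
      using gcong.base[OF arrow1.A1[OF free_empty, of G u m]] by simp
    moreover have "range_sum G (m + 1) (out_arcs G u) =
        monomial (m + 1) (Proper (head G e)) + range_sum G (m + 1) (out_arcs G u - {e})"
      unfolding range_sum_def using sum.remove[OF True e(1)] .
    moreover have "range_sum G (m + 1) (out_arcs G u - {e}) \<in> free_gmonoid G"
      using True by (intro free_range_sum) auto
    moreover have "range_sum G (m + 1) (out_arcs G u - {e}) = {#} \<longleftrightarrow> out_arcs G u = {e}"
      using True e(1) range_sum_eq_empty[of "out_arcs G u - {e}"] by auto
    ultimately show ?thesis
      using True by (intro that[of "range_sum G (m + 1) (out_arcs G u - {e})"])
        (auto simp: set_range_sum)
  next
    case False
    then have inf: "is_inf_emitter G u" using e by (auto simp: is_inf_emitter_def)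
    \<comment> \<open>At an infinite emitter only the edge of the path is split off; all other exits
      are hidden in \<open>q_Z\<close> with \<open>Z = {e}\<close>, a nonzero remainder.\<close>
    have "gcong G (monomial m (Proper u)) (monomial m (Improper u {e}) + range_sum G (m + 1) {e})"
      using gcong.base[OF arrow1.A2[OF free_empty inf, of "{e}" m]] e by simp
    then show ?thesis using inf e False
      by (intro that[of "monomial m (Improper u {e})"])
        (auto simp: range_sum_def add.commute simp del: in_out_arcs_conv)
  qed
  have "gcong G (monomial (m + 1) (Proper (head G e)) + x)
      (monomial (m + 1 + int (length es)) (Proper w) + b + x)"
    using b(1) x(4) by (intro gcong.add gcong.refl)
  with x(1) have "gcong G (monomial m (Proper u))
      (monomial (m + int (length (e # es))) (Proper w) + (b + x))"
    by (simp add: gcong.trans algebra_simps)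
  moreover have "\<forall>g\<in>snd ` set_mset (b + x). \<exists>f\<in>set (e # es).
       (\<exists>e\<in>out_arcs G (tail G f) - {f}. g = Proper (head G e)) \<or>
       is_inf_emitter G (tail G f) \<and> g = Improper (tail G f) {f}"
    using b(2) x(2) e(2) by (simp add: image_Un ball_Un del: in_out_arcs_conv) blast
  moreover have "b + x = {#} \<longleftrightarrow> (\<forall>f\<in>set (e # es). out_arcs G (tail G f) = {f})"
    using b(3) x(3) e(2) by auto
  ultimately show ?case by blast
qed

text \<open>Going around a cycle without an exit leaves no remainder in \<open>path_expand\<close>.
  Conversely, the core for \<open>H = {}\<close> is a set of vertices that emit a single edge
  each.\<close>

lemma no_exit_cycle_iff:
  "(\<exists>c. is_cycle G c \<and> \<not> has_exit G c) \<longleftrightarrow>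
     (\<exists>a n. n > 0 \<and> a \<noteq> {#} \<and> gcong G a (shift n a))"
proof
  assume "\<exists>c. is_cycle G c \<and> \<not> has_exit G c"
  then obtain c v where c: "is_cycle G c" "\<not> has_exit G c" "awalk v c v" "c \<noteq> []"
    by (auto simp: is_cycle_def)
  then have "gcong G (monomial 0 (Proper v)) (monomial (int (length c)) (Proper v))"
    using path_expand[OF c(3), of 0] no_exit_cycle_out_arcs[OF c(1,2)] by auto
  then show "\<exists>a n. n > 0 \<and> a \<noteq> {#} \<and> gcong G a (shift n a)"
    using c(4) by (intro exI[of _ "monomial 0 (Proper v)"] exI[of _ "int (length c)"]) simp
next
  assume "\<exists>a n. n > 0 \<and> a \<noteq> {#} \<and> gcong G a (shift n a)"
  then obtain a n where a: "n > 0" "a \<noteq> {#}" "gcong G a (shift n a + {#})" by auto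
  have emp: "out_mod G {} (Proper w) = out_arcs G w" for w by auto
  obtain V where V: "finite V" "\<And>w. w \<in> V \<Longrightarrow> \<exists>e. out_mod G {} (Proper w) = {e} \<and> head G e \<in> V"
    "\<And>m g. (m, g) \<in># a \<Longrightarrow> \<exists>J. \<forall>j\<ge>J. unf G {} j g \<noteq> {#} \<and> set_mset (unf G {} j g) \<subseteq> V"
    by (rule periodic_core[OF closed_set_empty a(3,1)]) auto
  obtain m g where "(m, g) \<in># a" using a(2) by (metis multiset_nonemptyE surj_pair)
  then obtain w0 where "w0 \<in> V" using V(3) by (metis order.refl multiset_nonemptyE subsetD)
  then obtain c where "is_cycle G c" "\<forall>f\<in>set c. out_arcs G (tail G f) = {f}"
    using cycle_of_singleton_core[OF V(1) _ V(2)] unfolding emp by blast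
  then show "\<exists>c. is_cycle G c \<and> \<not> has_exit G c"
    by (intro exI[of _ c]) (auto simp: has_exit_def)
qed

end

section \<open>Condition (K)\<close>

lemma list_diverge:
  "p \<noteq> q \<Longrightarrow> (\<exists>r. r \<noteq> [] \<and> (p = q @ r \<or> q = p @ r)) \<or>
     (\<exists>s e f p' q'. p = s @ e # p' \<and> q = s @ f # q' \<and> e \<noteq> f)"
proof (induction p arbitrary: q)
  case (Cons x p)
  show ?case
  proof (cases q)
    case q: (Cons y q')
    show ?thesis
    proof (cases "x = y")
      case True
      then have "p \<noteq> q'" using Cons.prems q by auto
      from Cons.IH[OF this] show ?thesis
      proof
        assume "\<exists>r. r \<noteq> [] \<and> (p = q' @ r \<or> q' = p @ r)"
        then show ?thesis using q True by auto
      next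
        assume "\<exists>s e f p'' q''. p = s @ e # p'' \<and> q' = s @ f # q'' \<and> e \<noteq> f"
        then show ?thesis using q True by (metis append_Cons)
      qed
    next
      case False
      then show ?thesis using q by (metis append_Nil)
    qed
  qed auto
qed auto

context wf_digraph
begin

lemma first_hit_walk:
  "awalk u p v \<Longrightarrow> \<exists>q. awalk u q v \<and> (\<forall>e\<in>set q. tail G e \<noteq> v)"
proof (induction p arbitrary: u)
  case Nil
  then show ?case by (intro exI[of _ "[]"]) auto
next
  case (Cons e es)
  show ?case
  proof (cases "u = v")
    case True
    then show ?thesis using Cons.prems by (intro exI[of _ "[]"]) (auto simp: awalk_Nil_iff)
  next
    case False
    obtain q where "awalk (head G e) q v" "\<forall>e\<in>set q. tail G e \<noteq> v"
      using Cons.IH[of "head G e"] Cons.prems by (auto simp: awalk_Cons_iff)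
    then show ?thesis using Cons.prems False
      by (intro exI[of _ "e # q"]) (auto simp: awalk_Cons_iff)
  qed
qed

lemma cycle_closed_simple_path:
  assumes "is_cycle G c" "awalk v c v"
  shows "closed_simple_path G v c"
proof -
  obtain e es where c: "c = e # es" using assms(1) by (cases c) (auto simp: is_cycle_def)
  then have "tail G e = v" using assms(2) by (simp add: awalk_Cons_iff)
  moreover have "tail G e \<notin> tail G ` set es" using assms(1) c by (auto simp: is_cycle_def)
  ultimately have "\<forall>x\<in>set es. tail G x \<noteq> v" by (metis imageI)
  then show ?thesis using assms c by (simp add: closed_simple_path_def)
qed

text \<open>Neither path is a proper prefix of the other, because the longer one would return to
  \<open>v\<close> too early. Hence they differ at some first edge.\<close>

lemma closed_simple_paths_diverge:
  assumes "closed_simple_path G v p" "closed_simple_path G v q" "p \<noteq> q"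
  obtains s e f p' q' where "p = s @ e # p'" "q = s @ f # q'" "e \<noteq> f"
proof -
  have no_prefix: False
    if "closed_simple_path G v p" "closed_simple_path G v (p @ r)" "r \<noteq> []" for p r
  proof -
    have "awalk v p v" "p \<noteq> []" "awalk v (p @ r) v" using that by (auto simp: closed_simple_path_def)
    then have "awalk v r v" by auto
    then have "tail G (hd r) = v" using that(3) awalk_tail_hd by blast
    moreover have "hd r \<in> set (tl (p @ r))" using \<open>p \<noteq> []\<close> that(3) by (cases p) auto
    ultimately show False using that(2) by (auto simp: closed_simple_path_def)
  qed
  show thesis using list_diverge[OF assms(3)] no_prefix assms(1,2) that by blast
qed

lemma closed_set_tail:
  assumes "closed_set G H" "Proper (tail G e) \<in> H" "e \<in> arcs G"
  shows "Proper (head G e) \<in> H"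
  using out_mod_notin[OF assms(1), of "Proper (tail G e)" e] assms(2,3) by auto

lemma closed_set_awalk:
  assumes "closed_set G H"
  shows "awalk u p v \<Longrightarrow> Proper u \<in> H \<Longrightarrow> Proper v \<in> H"
  by (induction p arbitrary: u)
    (auto simp: awalk_Nil_iff awalk_Cons_iff intro: closed_set_tail[OF assms])

text \<open>The complement consists of everything that flows to the vertex \<open>v\<close>, which lies on a closed
  walk.\<close>

lemma closed_set_not_reaching:
  assumes "awalk v c v" "c \<noteq> []"
  defines "R \<equiv> \<lambda>u. \<exists>p. awalk u p v"
  shows "closed_set G {g \<in> gvertices G. case g of Proper u \<Rightarrow> \<not> R u
      | Improper u Z \<Rightarrow> \<forall>e\<in>out_arcs G u - Z. \<not> R (head G e)}" (is "closed_set G ?H")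
proof -
  have R: "R u \<longleftrightarrow> (\<exists>e\<in>out_arcs G u. R (head G e))" for u
  proof
    assume "R u"
    then obtain p where p: "awalk u p v" by (auto simp: R_def)
    \<comment> \<open>At \<open>u = v\<close> the empty walk is replaced by the closed walk
      \<open>c\<close>, so that there is a first edge.\<close>
    obtain q where "awalk u q v" "q \<noteq> []"
    proof (cases "p = []")
      case True
      then have "u = v" using p by (simp add: awalk_Nil_iff)
      then show ?thesis using that assms by blast
    qed (use p that in blast)
    then show "\<exists>e\<in>out_arcs G u. R (head G e)"
      by (cases q) (auto simp: awalk_Cons_iff R_def)
  next
    assume "\<exists>e\<in>out_arcs G u. R (head G e)"
    then obtain e p where "e \<in> out_arcs G u" "awalk (head G e) p v" by (auto simp: R_def)
    then have "awalk u (e # p) v" by (auto simp: awalk_Cons_iff)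
    then show "R u" unfolding R_def ..
  qed
  show ?thesis
  proof (rule closed_setI)
    fix v assume "is_regular G v"
    then show "Proper v \<in> ?H \<longleftrightarrow> (\<forall>e\<in>out_arcs G v. Proper (head G e) \<in> ?H)"
      using R[of v] by (auto simp: is_regular_def)
  next
    fix v Z assume "is_inf_emitter G v" "finite Z" "Z \<noteq> {}" "Z \<subseteq> out_arcs G v"
    moreover from this have "v \<in> verts G" "\<And>e. e \<in> Z \<Longrightarrow> head G e \<in> verts G"
      by (auto simp: is_inf_emitter_def)
    ultimately show "Proper v \<in> ?H \<longleftrightarrow> Improper v Z \<in> ?H \<and> (\<forall>e\<in>Z. Proper (head G e) \<in> ?H)"
      using R[of v] by (simp del: in_out_arcs_conv) blast
  next
    fix v Z W assume *: "is_inf_emitter G v" "finite W" "Z \<noteq> {}" "Z \<subset> W" "W \<subseteq> out_arcs G v"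
    then have "finite Z" "Z \<subseteq> out_arcs G v" "W \<noteq> {}" "\<And>e. e \<in> W - Z \<Longrightarrow> head G e \<in> verts G"
      using finite_subset[of Z W] by auto
    with * show "Improper v Z \<in> ?H \<longleftrightarrow> Improper v W \<in> ?H \<and> (\<forall>e\<in>W - Z. Proper (head G e) \<in> ?H)"
      by (simp del: in_out_arcs_conv) blast
  qed auto
qed

text \<open>Suppose \<open>v\<close> has only one closed simple path \<open>c\<close>. A walk from
  an exit of \<open>c\<close> back to \<open>v\<close>, stopped at its first visit to
  \<open>v\<close>, would complete a second one. So all exits of \<open>c\<close> lie in the closed
  set of what does not flow to \<open>v\<close>, and \<open>c\<close> makes \<open>v\<close>
  periodic modulo it.\<close>

lemma not_condition_K_imp:
  assumes "\<not> condition_K G"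
  shows "\<exists>a b n H. n > 0 \<and> closed_set G H \<and> snd ` set_mset b \<subseteq> H \<and> \<not> snd ` set_mset a \<subseteq> H \<and>
    gcong G a (shift n a + b)"
proof -
  obtain v where "\<exists>u p. closed_simple_path G u p \<and> v \<in> tail G ` set p"
    and unique: "\<And>p q. closed_simple_path G v p \<Longrightarrow> closed_simple_path G v q \<Longrightarrow> p = q"
    using assms unfolding condition_K_def by blast
  then obtain u p where v: "closed_simple_path G u p" "v \<in> tail G ` set p" by blast
  then obtain f p1 p2 where "p = p1 @ f # p2" "tail G f = v"
    by (metis imageE split_list)
  then have "awalk v (f # p2 @ p1) v"
    using v(1) by (auto simp: closed_simple_path_def awalk_Cons_iff)
  then obtain c where c: "is_cycle G c" "awalk v c v" by (rule closed_walk_cycle) simp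
  then have c': "closed_simple_path G v c" "c \<noteq> []"
    using cycle_closed_simple_path by (auto simp: closed_simple_path_def)
  have exits: "\<not> awalk (head G e) q v" if f: "f \<in> set c" and e: "e \<in> out_arcs G (tail G f)" "e \<noteq> f" for e f q
  proof
    assume "awalk (head G e) q v"
    then obtain q0 where q0: "awalk (head G e) q0 v" "\<forall>e\<in>set q0. tail G e \<noteq> v"
      using first_hit_walk by blast
    obtain s c1 where s: "c = s @ f # c1" using f by (metis split_list)
    have "awalk v (s @ e # q0) v"
      using c(2) e q0(1) unfolding s by (auto simp: awalk_Cons_iff)
    moreover have "\<forall>e\<in>set (tl (s @ e # q0)). tail G e \<noteq> v"
      using c'(1) q0(2) e(1) unfolding s closed_simple_path_def by (cases s) auto
    ultimately have "closed_simple_path G v (s @ e # q0)" by (simp add: closed_simple_path_def)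
    from unique[OF this c'(1)] show False using e(2) s by simp
  qed
  let ?H = "{g \<in> gvertices G. case g of Proper u \<Rightarrow> \<not> (\<exists>p. awalk u p v)
      | Improper u Z \<Rightarrow> \<forall>e\<in>out_arcs G u - Z. \<not> (\<exists>p. awalk (head G e) p v)}"
  have H: "closed_set G ?H" using closed_set_not_reaching[OF c(2) c'(2)] .
  obtain b where b: "gcong G (monomial 0 (Proper v)) (monomial (int (length c)) (Proper v) + b)"
    and b': "\<forall>g\<in>snd ` set_mset b. \<exists>f\<in>set c.
       (\<exists>e\<in>out_arcs G (tail G f) - {f}. g = Proper (head G e)) \<or>
       is_inf_emitter G (tail G f) \<and> g = Improper (tail G f) {f}"
    using path_expand[OF c(2), of 0] by auto
  have "snd ` set_mset b \<subseteq> ?H"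
  proof
    fix g assume g: "g \<in> snd ` set_mset b"
    then obtain f where f: "f \<in> set c" and
      "(\<exists>e\<in>out_arcs G (tail G f) - {f}. g = Proper (head G e)) \<or>
       is_inf_emitter G (tail G f) \<and> g = Improper (tail G f) {f}" using b' by blast
    moreover have "f \<in> arcs G" using f c(2) by (auto simp: awalk_def)
    ultimately show "g \<in> ?H" using exits[OF f] by auto
  qed
  moreover have "\<not> snd ` set_mset (monomial 0 (Proper v)) \<subseteq> ?H" using c(2) by auto
  ultimately show ?thesis using b H c'(2)
    by (intro exI[of _ "monomial 0 (Proper v)"] exI[of _ b] exI[of _ "int (length c)"] exI[of _ ?H])
      simp
qed

text \<open>A vertex of the core has two closed simple paths by Condition (K). They stay in the core
  up to the vertex where they diverge, but there only one edge avoids \<open>H\<close>.\<close>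

lemma condition_K_imp:
  assumes n: "n > 0" and H: "closed_set G H" and b: "snd ` set_mset b \<subseteq> H"
    and a: "\<not> snd ` set_mset a \<subseteq> H" and cong: "gcong G a (shift n a + b)"
  shows "\<not> condition_K G"
proof
  assume K: "condition_K G"
  obtain V where V: "finite V" "\<And>w. w \<in> V \<Longrightarrow> w \<in> verts G \<and> Proper w \<notin> H"
    "\<And>w. w \<in> V \<Longrightarrow> \<exists>e. out_mod G H (Proper w) = {e} \<and> head G e \<in> V"
    "\<And>m g. (m, g) \<in># a \<Longrightarrow> g \<notin> H \<Longrightarrow> \<exists>J. \<forall>j\<ge>J. unf G H j g \<noteq> {#} \<and> set_mset (unf G H j g) \<subseteq> V"
    by (rule periodic_core[OF H cong n b]) auto
  obtain x where "x \<in># a" "snd x \<notin> H" using a by blast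
  then obtain m g where "(m, g) \<in># a" "g \<notin> H" by (cases x) auto
  then obtain w0 where "w0 \<in> V" using V(4) by (metis order.refl multiset_nonemptyE subsetD)
  then obtain c where c: "is_cycle G c" "\<forall>f\<in>set c. tail G f \<in> V \<and> out_mod G H (Proper (tail G f)) = {f}"
    using cycle_of_singleton_core[OF V(1) _ V(3)] by blast
  then obtain v where v: "awalk v c v" "c \<noteq> []" by (auto simp: is_cycle_def)
  then have "v = tail G (hd c)" using awalk_tail_hd by auto
  then have vV: "v \<in> V" and vc: "v \<in> tail G ` set c" using c v by auto
  moreover have "closed_simple_path G v c" using cycle_closed_simple_path c v by blast
  ultimately obtain p q where pq: "p \<noteq> q" "closed_simple_path G v p" "closed_simple_path G v q"
    using K V(2) unfolding condition_K_def by metis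
  then obtain s e f p' q' where s: "p = s @ e # p'" "q = s @ f # q'" "e \<noteq> f"
    using closed_simple_paths_diverge by metis
  \<comment> \<open>Closed sets contain everything that their vertices flow to, so a head in
    \<open>H\<close> would put \<open>v\<close> into \<open>H\<close>.\<close>
  have notin: "Proper (head G x) \<notin> H" if "awalk v r v" "x \<in> set r" for r x
  proof
    assume x: "Proper (head G x) \<in> H"
    obtain r1 r2 where "r = r1 @ x # r2" using \<open>x \<in> set r\<close> by (metis split_list)
    then have "awalk (head G x) r2 v" using that(1) by (auto simp: awalk_Cons_iff)
    from closed_set_awalk[OF H this x] show False using V(2) vV by blast
  qed
  have pw: "awalk v p v" "awalk v q v" using pq by (auto simp: closed_simple_path_def)
  have stay: "awalk u r w \<Longrightarrow> u \<in> V \<Longrightarrow> (\<And>x. x \<in> set r \<Longrightarrow> Proper (head G x) \<notin> H) \<Longrightarrow> w \<in> V" for u r w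
  proof (induction r arbitrary: u)
    case Nil
    then show ?case by (simp add: awalk_Nil_iff)
  next
    case (Cons x r)
    then have "x \<in> out_mod G H (Proper u)" by (auto simp: awalk_Cons_iff)
    then have "head G x \<in> V" using V(3)[OF Cons.prems(2)] by (auto simp del: out_mod.simps)
    then show ?case using Cons by (auto simp: awalk_Cons_iff)
  qed
  define w where "w = tail G e"
  have w: "awalk v s w" "w = tail G f" "e \<in> arcs G" "f \<in> arcs G"
    using pw s by (auto simp: awalk_Cons_iff w_def)
  have "w \<in> V" using stay[OF w(1) vV] notin[OF pw(1)] s(1) by auto
  moreover have "e \<in> out_mod G H (Proper w)" "f \<in> out_mod G H (Proper w)"
    using notin[OF pw(1)] notin[OF pw(2)] s w by (auto simp: w_def)
  ultimately show False using V(3) s(3) by (metis singletonD)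
qed

lemma condition_K_iff:
  "condition_K G \<longleftrightarrow> \<not> (\<exists>a b n H. n > 0 \<and> closed_set G H \<and> snd ` set_mset b \<subseteq> H \<and>
     \<not> snd ` set_mset a \<subseteq> H \<and> gcong G a (shift n a + b))"
proof
  show "\<not> (\<exists>a b n H. n > 0 \<and> closed_set G H \<and> snd ` set_mset b \<subseteq> H \<and>
     \<not> snd ` set_mset a \<subseteq> H \<and> gcong G a (shift n a + b))" if "condition_K G"
    using that by (metis (no_types) condition_K_imp)
qed (rule ccontr, drule not_condition_K_imp, erule notE)

section \<open>Cycles with exits\<close>

lemma closed_walk_out_arcs:
  assumes "no_exit_graph G" "awalk v p v" "p \<noteq> []"
  shows "out_arcs G v = {hd p}"
proof -
  obtain c where c: "is_cycle G c" "awalk v c v" using closed_walk_cycle[OF assms(2,3)] .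
  then have "c \<noteq> []" "\<not> has_exit G c" using assms(1) by (auto simp: is_cycle_def no_exit_graph_def)
  then have "out_arcs G v = {hd c}"
    using no_exit_cycle_out_arcs[OF c(1), of "hd c"] awalk_tail_hd[OF c(2)] by simp
  moreover have "hd p \<in> out_arcs G v"
    using assms(2,3) by (cases p) (auto simp: awalk_Cons_iff)
  ultimately show ?thesis by auto
qed

text \<open>Without exits a walk can only follow the closed walk it starts on. Its end therefore
  carries a rotation of that closed walk, with the same edges.\<close>

lemma walk_from_closed_walk:
  assumes "no_exit_graph G" "awalk v p v" "p \<noteq> []" "set p \<subseteq> U" "awalk v r w"
  shows "\<exists>q. awalk w q w \<and> q \<noteq> [] \<and> set q \<subseteq> U"
  using assms(2-)
proof (induction r arbitrary: v p)
  case Nil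
  then show ?case by (auto simp: awalk_Nil_iff)
next
  case (Cons e r)
  have "e \<in> out_arcs G v" using Cons.prems by (auto simp: awalk_Cons_iff)
  then obtain p' where p: "p = e # p'"
    using closed_walk_out_arcs[OF assms(1) Cons.prems(1,2)] Cons.prems(2) by (cases p) auto
  have "awalk (head G e) (p' @ [e]) (head G e)"
    using Cons.prems(1) unfolding p by (auto simp: awalk_Cons_iff awalk_Nil_iff)
  then show ?case using Cons.IH[of "head G e" "p' @ [e]"] Cons.prems p
    by (auto simp: awalk_Cons_iff)
qed

end

text \<open>The number of paths in the edge set \<open>U\<close> that have length \<open>k\<close>, or are shorter and end in a vertex
  some of whose edges are missing from \<open>U\<close> (or which is a sink). For finite \<open>U\<close> in a no-exit graph it
  is stable for large \<open>k\<close>, and then it is compatible with the relations that only involve \<open>U\<close>.\<close>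

primrec tr :: "('v, 'e) pre_digraph \<Rightarrow> 'e set \<Rightarrow> nat \<Rightarrow> 'v \<Rightarrow> nat" where
  "tr E U 0 v = 1"
| "tr E U (Suc k) v = (\<Sum>e\<in>out_arcs E v \<inter> U. tr E U k (head E e)) +
     (if is_regular E v \<and> out_arcs E v \<subseteq> U then 0 else 1)"

text \<open>The length \<open>Suc (card U)\<close> forces a path inside \<open>U\<close> to repeat
  an edge, which makes the count stable. The summand 1 at \<open>q_Z\<close> is the one that
  \<open>tr\<close> adds at a vertex that is not regular.\<close>

primrec trace :: "('v, 'e) pre_digraph \<Rightarrow> 'e set \<Rightarrow> ('v, 'e) gvertex \<Rightarrow> nat" where
  "trace E U (Proper v) = tr E U (Suc (card U)) v"
| "trace E U (Improper v Z) =
     (\<Sum>e\<in>out_arcs E v \<inter> U - Z. tr E U (Suc (card U)) (head E e)) + 1"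

definition trace_sum :: "('v, 'e) pre_digraph \<Rightarrow> 'e set \<Rightarrow> ('v, 'e) gsum \<Rightarrow> nat" where
  "trace_sum E U a = (\<Sum>(m, g)\<in>#a. trace E U g)"

section \<open>Additivity, shift invariance and positivity of the trace\<close>

lemma trace_sum_add [simp]: "trace_sum E U (a + b) = trace_sum E U a + trace_sum E U b"
  by (simp add: trace_sum_def)

lemma trace_sum_monomial [simp]: "trace_sum E U (monomial m g) = trace E U g"
  by (simp add: trace_sum_def monomial_def)

lemma trace_sum_range_sum:
  "finite Z \<Longrightarrow> trace_sum E U (range_sum E m Z) = (\<Sum>e\<in>Z. tr E U (Suc (card U)) (head E e))"
  by (induction Z rule: finite_induct) (auto simp: range_sum_def trace_sum_def monomial_def)

lemma trace_sum_shift [simp]: "trace_sum E U (shift n a) = trace_sum E U a"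
  by (induction a) (auto simp: trace_sum_def shift_def case_prod_beta)

lemma tr_pos:
  assumes "finite U"
  shows "tr E U k v \<ge> 1"
proof (induction k arbitrary: v)
  case (Suc k)
  show ?case
  proof (cases "is_regular E v \<and> out_arcs E v \<subseteq> U")
    case True
    then obtain e where e: "e \<in> out_arcs E v \<inter> U"
      by (auto simp: is_regular_def simp del: in_out_arcs_conv)
    then have "1 \<le> (\<Sum>e\<in>out_arcs E v \<inter> U. tr E U k (head E e))"
      using Suc[of "head E e"] assms member_le_sum[OF e, of "\<lambda>e. tr E U k (head E e)"]
      by (meson finite_Int le0 order_trans)
    then show ?thesis by simp
  next
    case False
    show ?thesis unfolding tr.simps if_not_P[OF False] by simp
  qed
qed simp

lemma trace_sum_pos:
  assumes "finite U" "b \<noteq> {#}"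
  shows "trace_sum E U b \<ge> 1"
proof -
  obtain m g c where "b = add_mset (m, g) c" using assms(2) by (metis multiset_cases surj_pair)
  moreover have "trace E U g \<ge> 1" using tr_pos[OF assms(1)] by (cases g) (auto simp del: tr.simps)
  ultimately show ?thesis by (simp add: trace_sum_def)
qed

context wf_digraph
begin

text \<open>A difference between consecutive lengths must already occur behind some first edge.
  After \<open>k\<close> edges it is localized at a vertex whose count for length 1 differs from
  that for length 0.\<close>

lemma tr_unstable_walk:
  assumes "v \<in> verts G" "tr G U (Suc k) v \<noteq> tr G U k v"
  shows "\<exists>p w. awalk v p w \<and> length p = k \<and> set p \<subseteq> U \<and> tr G U 1 w \<noteq> 1"
  using assms
proof (induction k arbitrary: v)
  case 0
  then show ?case by (intro exI[of _ "[]"] exI[of _ v]) (auto simp: awalk_Nil_iff)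
next
  case (Suc k)
  then obtain e where e: "e \<in> out_arcs G v \<inter> U" "tr G U (Suc k) (head G e) \<noteq> tr G U k (head G e)"
    by (force intro!: sum.cong)
  then obtain p w where "awalk (head G e) p w" "length p = k" "set p \<subseteq> U" "tr G U 1 w \<noteq> 1"
    using Suc.IH[of "head G e"] by auto
  then show ?case using e(1) by (intro exI[of _ "e # p"] exI[of _ w]) (auto simp: awalk_Cons_iff)
qed

text \<open>A walk witnessing instability has more edges than \<open>U\<close>, so it runs into a
  closed walk in \<open>U\<close> and ends on it. Its end emits exactly one edge, which lies in
  \<open>U\<close>, and its count for length 1 is then 1 after all.\<close>

lemma tr_stable:
  assumes ne: "no_exit_graph G" and U: "finite U" and v: "v \<in> verts G"
  shows "tr G U (Suc (Suc (card U))) v = tr G U (Suc (card U)) v"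
proof (rule ccontr)
  assume "tr G U (Suc (Suc (card U))) v \<noteq> tr G U (Suc (card U)) v"
  from tr_unstable_walk[OF v this] obtain p w where
    p: "awalk v p w" "length p = Suc (card U)" "set p \<subseteq> U" "tr G U 1 w \<noteq> 1" by blast
  then have "\<not> distinct p" using card_mono[OF U p(3)] by (auto dest: distinct_card)
  then obtain xs y ys zs where "p = xs @ [y] @ ys @ [y] @ zs" using not_distinct_decomp by blast
  then have "awalk (tail G y) (y # ys) (tail G y)" "awalk (tail G y) (y # zs) w" "set (y # ys) \<subseteq> U"
    using p by (auto simp: awalk_Cons_iff)
  then obtain q where q: "awalk w q w" "q \<noteq> []" "set q \<subseteq> U"
    using walk_from_closed_walk[OF ne, of "tail G y" "y # ys" U "y # zs" w] by auto
  then have "out_arcs G w = {hd q}" "hd q \<in> U" using closed_walk_out_arcs[OF ne q(1,2)] by auto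
  moreover from this have "is_regular G w" using awalk_hd_in_verts[OF q(1)] by (auto simp: is_regular_def)
  ultimately show False using p(4) by simp
qed

text \<open>It suffices that \<open>U\<close> contains the edges named by the arrow. By stability
  the trace of \<open>v\<close> may be computed with one more edge, and then the recursion for
  \<open>tr\<close> is the required identity.\<close>

lemma arrow1_trace:
  assumes ne: "no_exit_graph G" and "arrow1 G a b"
  shows "\<exists>U0. finite U0 \<and> (\<forall>U. finite U \<and> U0 \<subseteq> U \<longrightarrow> trace_sum G U a = trace_sum G U b)"
  using assms(2)
proof (cases rule: arrow1.cases)
  case (A1 c v m)
  then have v: "v \<in> verts G" "finite (out_arcs G v)" by (auto simp: is_regular_def)
  have "trace_sum G U a = trace_sum G U b" if "finite U" "out_arcs G v \<subseteq> U" for U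
  proof -
    have "tr G U (Suc (card U)) v = tr G U (Suc (Suc (card U))) v"
      using tr_stable[OF ne that(1) v(1)] by simp
    also have "\<dots> = (\<Sum>e\<in>out_arcs G v. tr G U (Suc (card U)) (head G e))"
      using that A1 by (subst tr.simps(2)) (simp add: Int_absorb2)
    finally show ?thesis using A1 v by (simp add: trace_sum_range_sum del: tr.simps)
  qed
  then show ?thesis using v by blast
next
  case (A2 c v Z m)
  then have v: "v \<in> verts G" "\<not> is_regular G v" by (auto simp: is_inf_emitter_def is_regular_def)
  have "trace_sum G U a = trace_sum G U b" if "finite U" "Z \<subseteq> U" for U
  proof -
    have "tr G U (Suc (card U)) v = tr G U (Suc (Suc (card U))) v"
      using tr_stable[OF ne that(1) v(1)] by simp
    also have "\<dots> = (\<Sum>e\<in>out_arcs G v \<inter> U. tr G U (Suc (card U)) (head G e)) + 1"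
      using v(2) by (subst tr.simps(2)) simp
    also have "(\<Sum>e\<in>out_arcs G v \<inter> U. tr G U (Suc (card U)) (head G e)) =
      (\<Sum>e\<in>out_arcs G v \<inter> U - Z. tr G U (Suc (card U)) (head G e)) + (\<Sum>e\<in>Z. tr G U (Suc (card U)) (head G e))"
      using that A2 by (intro sum.subset_diff) auto
    finally show ?thesis using A2 v by (simp add: trace_sum_range_sum del: tr.simps)
  qed
  then show ?thesis using A2 by blast
next
  case (A3 c v W Z m)
  have "trace_sum G U a = trace_sum G U b" if "finite U" "W \<subseteq> U" for U
  proof -
    have "(\<Sum>e\<in>out_arcs G v \<inter> U - Z. tr G U (Suc (card U)) (head G e)) =
      (\<Sum>e\<in>out_arcs G v \<inter> U - Z - (W - Z). tr G U (Suc (card U)) (head G e)) +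
      (\<Sum>e\<in>W - Z. tr G U (Suc (card U)) (head G e))"
      using that A3 by (intro sum.subset_diff) auto
    moreover have "out_arcs G v \<inter> U - Z - (W - Z) = out_arcs G v \<inter> U - W" using A3 by auto
    ultimately show ?thesis using A3 by (simp add: trace_sum_range_sum del: tr.simps)
  qed
  then show ?thesis using A3 by blast
qed

lemma gcong_trace:
  assumes ne: "no_exit_graph G" and "gcong G a b"
  shows "\<exists>U0. finite U0 \<and> (\<forall>U. finite U \<and> U0 \<subseteq> U \<longrightarrow> trace_sum G U a = trace_sum G U b)"
  using assms(2)
proof (induction rule: gcong.induct)
  case (base a b)
  then show ?case by (rule arrow1_trace[OF ne])
next
  case (sym a b)
  then show ?case by metis
next
  case (trans a b c)
  then obtain U1 U2 where "finite U1" "\<forall>U. finite U \<and> U1 \<subseteq> U \<longrightarrow> trace_sum G U a = trace_sum G U b"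
     "finite U2" "\<forall>U. finite U \<and> U2 \<subseteq> U \<longrightarrow> trace_sum G U b = trace_sum G U c" by blast
  then show ?case by (intro exI[of _ "U1 \<union> U2"]) simp
next
  case (add a b c d)
  then obtain U1 U2 where "finite U1" "\<forall>U. finite U \<and> U1 \<subseteq> U \<longrightarrow> trace_sum G U a = trace_sum G U b"
     "finite U2" "\<forall>U. finite U \<and> U2 \<subseteq> U \<longrightarrow> trace_sum G U c = trace_sum G U d" by blast
  then show ?case by (intro exI[of _ "U1 \<union> U2"]) simp
qed auto

text \<open>An exit makes the remainder in \<open>path_expand\<close> nonzero. Conversely, without
  exits the trace is additive and shift invariant on the derivation, so \<open>b\<close> has trace 0
  although nonzero elements have positive trace.\<close>

lemma exit_cycle_iff:
  "(\<exists>c. is_cycle G c \<and> has_exit G c) \<longleftrightarrow>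
     (\<exists>a b n. n > 0 \<and> b \<noteq> {#} \<and> gcong G a (shift n a + b))"
proof
  assume "\<exists>c. is_cycle G c \<and> has_exit G c"
  then obtain c v where c: "is_cycle G c" "has_exit G c" "awalk v c v" "c \<noteq> []"
    by (auto simp: is_cycle_def)
  obtain f e where "f \<in> set c" "e \<in> out_arcs G (tail G f)" "e \<notin> set c"
    using c(2) by (auto simp: has_exit_def)
  then have "\<not> (\<forall>f\<in>set c. out_arcs G (tail G f) = {f})"
    by (metis singletonD)
  then obtain b where "b \<noteq> {#}"
      "gcong G (monomial 0 (Proper v)) (monomial (int (length c)) (Proper v) + b)"
    using path_expand[OF c(3), of 0] by auto
  then show "\<exists>a b n. n > 0 \<and> b \<noteq> {#} \<and> gcong G a (shift n a + b)"
    using c(4) by (intro exI[of _ "monomial 0 (Proper v)"] exI[of _ b] exI[of _ "int (length c)"]) simp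
next
  assume "\<exists>a b n. n > 0 \<and> b \<noteq> {#} \<and> gcong G a (shift n a + b)"
  then obtain a b n where a: "n > 0" "b \<noteq> {#}" "gcong G a (shift n a + b)" by blast
  show "\<exists>c. is_cycle G c \<and> has_exit G c"
  proof (rule ccontr)
    assume "\<nexists>c. is_cycle G c \<and> has_exit G c"
    then have "no_exit_graph G" by (simp add: no_exit_graph_def)
    from gcong_trace[OF this a(3)] obtain U where
      "finite U" "trace_sum G U a = trace_sum G U (shift n a + b)" by blast
    then show False using trace_sum_pos[OF _ a(2), of U G] by simp
  qed
qed

section \<open>Row-finite no-exit graphs without sinks\<close>

text \<open>Periodic elements are stable under sums, shifts and congruence. A vertex that is not
  periodic thus emits an edge to another such vertex, and these edges form an infinite path. It ends
  in a cycle without exits, whose vertices are periodic.\<close>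

lemma row_finite_no_exit_periodic:
  assumes rf: "row_finite G" and ne: "no_exit_graph G" and ns: "\<forall>v. \<not> is_sink G v"
    and paths: "\<forall>p. infinite_path G p \<longrightarrow> ends_in_cycle G p"
    and a: "a \<in> free_gmonoid G"
  shows "\<exists>n>0. gcong G a (shift n a)"
proof -
  define P where "P a \<longleftrightarrow> (\<exists>n>0. gcong G a (shift n a))" for a
  have mult: "gcong G a (shift (int k * n) a)" if "gcong G a (shift n a)" for a n k
  proof (induction k)
    case 0
    then show ?case using gcong_free(1)[OF that] by (simp add: shift_0 gcong.refl)
  next
    case (Suc k)
    have "gcong G (shift n a) (shift n (shift (int k * n) a))" using Suc by (rule gcong.shift)
    with that have "gcong G a (shift n (shift (int k * n) a))" by (rule gcong.trans)
    then show ?case by (simp add: shift_shift algebra_simps)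
  qed
  have P_add: "P (a + b)" if P: "P a" "P b" for a b
  proof -
    obtain n m where nm: "n > 0" "m > 0" "gcong G a (shift n a)" "gcong G b (shift m b)"
      using P by (auto simp: P_def)
    \<comment> \<open>The product is a common period: \<open>m\<close> rounds of \<open>n\<close>
      for \<open>a\<close>, and \<open>n\<close> rounds of \<open>m\<close> for
      \<open>b\<close>.\<close>
    then have "gcong G a (shift (m * n) a)" "gcong G b (shift (m * n) b)"
      using mult[of a n "nat m"] mult[of b m "nat n"] by (simp_all add: mult.commute)
    then have "gcong G (a + b) (shift (m * n) (a + b))" by (simp add: gcong.add)
    then show ?thesis using nm by (auto simp: P_def intro!: exI[of _ "m * n"])
  qed
  have P_shift: "P (shift k a)" if P: "P a" for k a
  proof -
    obtain n where "n > 0" "gcong G a (shift n a)" using P by (auto simp: P_def)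
    then show ?thesis using gcong.shift[of G a "shift n a" k]
      by (auto simp: P_def shift_shift add.commute)
  qed
  have P_cong: "P b" if ba: "gcong G b a" and P: "P a" for a b
  proof -
    obtain n where n: "n > 0" "gcong G a (shift n a)" using P by (auto simp: P_def)
    have "gcong G (shift n a) (shift n b)" using ba by (rule gcong.shift[OF gcong.sym])
    with ba n(2) have "gcong G b (shift n b)" by (meson gcong.trans)
    then show ?thesis using n(1) by (auto simp: P_def)
  qed
  have P_empty: "P {#}" by (auto simp: P_def intro!: exI[of _ 1] gcong.refl)
  have regular: "is_regular G v" if "v \<in> verts G" for v
    using that rf ns by (auto simp: is_regular_def row_finite_def is_inf_emitter_def is_sink_def)
  have step: "\<exists>e\<in>out_arcs G v. \<not> P (monomial 0 (Proper (head G e)))"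
    if v: "v \<in> verts G" "\<not> P (monomial 0 (Proper v))" for v
  proof (rule ccontr)
    assume *: "\<not> ?thesis"
    have "P (range_sum G 1 Z)" if "finite Z" "Z \<subseteq> out_arcs G v" for Z
      using that
    proof (induction Z rule: finite_induct)
      case (insert e Z)
      have "P (monomial 0 (Proper (head G e)))" using * insert.prems by blast
      then have "P (monomial 1 (Proper (head G e)))" using P_shift[of "monomial 0 (Proper (head G e))" 1] by simp
      then show ?case using insert by (simp add: range_sum_def P_add)
    qed (simp add: range_sum_def P_empty)
    moreover have "gcong G (monomial 0 (Proper v)) (range_sum G 1 (out_arcs G v))"
      using gcong.base[OF A1[OF free_empty regular[OF v(1)], of 0]] by simp
    ultimately show False using P_cong v regular[OF v(1)] by (auto simp: is_regular_def simp del: in_out_arcs_conv)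
  qed
  have P_vertex: "P (monomial 0 (Proper v))" if "v \<in> verts G" for v
  proof (rule ccontr)
    assume nP: "\<not> P (monomial 0 (Proper v))"
    obtain nxt where nxt: "\<And>v. v \<in> verts G \<Longrightarrow> \<not> P (monomial 0 (Proper v)) \<Longrightarrow>
        nxt v \<in> out_arcs G v \<and> \<not> P (monomial 0 (Proper (head G (nxt v))))"
      using step by metis
    define w where "w i = ((\<lambda>v. head G (nxt v)) ^^ i) v" for i
    have w: "w i \<in> verts G \<and> \<not> P (monomial 0 (Proper (w i)))" for i
    proof (induction i)
      case 0
      then show ?case using nP \<open>v \<in> verts G\<close> by (simp add: w_def)
    next
      case (Suc i)
      then show ?case using nxt[of "w i"] by (simp add: w_def)
    qed
    define p where "p i = nxt (w i)" for i
    have p: "p i \<in> arcs G" "tail G (p i) = w i" "head G (p i) = w (Suc i)" for i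
      using nxt w[of i] by (auto simp: p_def w_def)
    have "infinite_path G p" by (simp add: infinite_path_def p)
    then obtain c n where c: "is_cycle G c" and n: "\<And>i. p (n + i) = c ! (i mod length c)"
      using paths unfolding ends_in_cycle_def by metis
    then have "c \<noteq> []" by (auto simp: is_cycle_def)
    obtain u where u: "awalk u c u" using c by (auto simp: is_cycle_def)
    have "hd c = p n" using n[of 0] \<open>c \<noteq> []\<close> by (simp add: hd_conv_nth)
    then have u': "u = w n" using awalk_tail_hd[OF u \<open>c \<noteq> []\<close>] p(2) by simp
    have "\<not> has_exit G c" using ne c by (auto simp: no_exit_graph_def)
    then have "gcong G (monomial 0 (Proper u)) (monomial (int (length c)) (Proper u))"
      using path_expand[OF u, of 0] no_exit_cycle_out_arcs[OF c] by auto
    then have "P (monomial 0 (Proper u))"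
      using \<open>c \<noteq> []\<close> by (auto simp: P_def intro!: exI[of _ "int (length c)"])
    then show False using w[of n] u' by simp
  qed
  have "P a" using a
  proof (induction a)
    case empty
    show ?case by (rule P_empty)
  next
    case (add x a)
    obtain m g where x: "x = (m, g)" by (cases x)
    have eq: "add_mset x a = monomial m g + a" by (simp add: monomial_def x)
    have g: "g \<in> gvertices G" "a \<in> free_gmonoid G" using add.prems unfolding eq by auto
    then obtain v where v: "g = Proper v" "v \<in> verts G"
      using rf by (cases g) (auto simp: row_finite_def is_inf_emitter_def)
    have "P (monomial m g)" using P_shift[OF P_vertex[OF v(2)], of m] v by simp
    then show ?case unfolding eq using add.IH[OF g(2)] by (intro P_add)
  qed
  then show ?thesis by (simp add: P_def)
qed

text \<open>The core for \<open>H = {}\<close> is applied to a single vertex. That vertex reaches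
  nothing terminal, hence is regular, and long paths from it end where only one edge can be
  followed.\<close>

lemma periodic_row_finite:
  assumes per: "\<And>a. a \<in> free_gmonoid G \<Longrightarrow> \<exists>n>0. gcong G a (shift n a)"
  shows "row_finite G" "\<not> is_sink G v" "infinite_path G p \<Longrightarrow> ends_in_cycle G p"
proof -
  have emp: "out_mod G {} (Proper w) = out_arcs G w" for w by auto
  have core: "is_regular G v \<and> (\<exists>V. finite V \<and> (\<forall>w\<in>V. \<exists>e. out_arcs G w = {e} \<and> head G e \<in> V) \<and>
      (\<exists>J. \<forall>j\<ge>J. set_mset (unf G {} j (Proper v)) \<subseteq> V))" if v: "v \<in> verts G" for v
  proof -
    obtain n where n: "n > 0" "gcong G (monomial 0 (Proper v)) (shift n (monomial 0 (Proper v)) + {#})"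
      using per[of "monomial 0 (Proper v)"] v by auto
    obtain V where V: "finite V" "\<And>w. w \<in> V \<Longrightarrow> \<exists>e. out_mod G {} (Proper w) = {e} \<and> head G e \<in> V"
      "\<exists>J. \<forall>j\<ge>J. unf G {} j (Proper v) \<noteq> {#} \<and> set_mset (unf G {} j (Proper v)) \<subseteq> V"
      "\<And>w j. terminal G {} w \<Longrightarrow> \<not> reach G {} w j (Proper v)"
      by (rule periodic_core[OF closed_set_empty n(2,1)]) (auto simp del: shift_monomial)
    have "\<not> terminal G {} v" using V(4)[of v 0] by auto
    then have "is_regular G v" using v by (auto simp: terminal_def)
    then show ?thesis using V(1-3) unfolding emp by meson
  qed
  show rf: "row_finite G"
    using core by (auto simp: row_finite_def is_inf_emitter_def is_regular_def)
  show "\<not> is_sink G v" using core by (auto simp: is_sink_def is_regular_def)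
  show "ends_in_cycle G p" if p: "infinite_path G p"
  proof -
    have arcs: "p i \<in> arcs G" and adj: "tail G (p (Suc i)) = head G (p i)" for i
      using p by (auto simp: infinite_path_def)
    \<comment> \<open>Regularity keeps the sums in \<open>unf\<close> finite, so no end of a path is
      lost.\<close>
    have tail_unf: "tail G (p (i + j)) \<in># unf G {} j (Proper (tail G (p i)))" for i j
    proof (induction j arbitrary: i)
      case (Suc j)
      have "finite (out_arcs G (tail G (p i)))"
        using core[of "tail G (p i)"] arcs by (auto simp: is_regular_def)
      then have "set_mset (unf G {} (Suc j) (Proper (tail G (p i)))) =
          (\<Union>e\<in>out_arcs G (tail G (p i)). set_mset (unf G {} j (Proper (head G e))))"
        unfolding unf.simps(2) emp by (rule set_mset_sum)
      moreover have "tail G (p (i + Suc j)) \<in># unf G {} j (Proper (head G (p i)))"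
        using Suc[of "Suc i"] by (simp add: adj)
      moreover have "p i \<in> out_arcs G (tail G (p i))" using arcs by simp
      ultimately show ?case by blast
    qed simp
    obtain V J where V: "finite V" "\<And>w. w \<in> V \<Longrightarrow> \<exists>e. out_arcs G w = {e} \<and> head G e \<in> V"
      "\<And>j. j \<ge> J \<Longrightarrow> set_mset (unf G {} j (Proper (tail G (p 0)))) \<subseteq> V"
      using core[OF tail_in_verts[OF arcs[of 0]]] by metis
    define q where "q i = p (J + i)" for i
    have q: "infinite_path G q" using p by (simp add: infinite_path_def q_def)
    have qV: "tail G (q i) \<in> V" for i
      using tail_unf[of 0 "J + i"] V(3)[of "J + i"] by (auto simp: q_def)
    have "q i \<in> out_arcs G (tail G (q i))" for i by (simp add: q_def arcs)
    then have "q i = q j" if "tail G (q i) = tail G (q j)" for i j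
      using V(2)[OF qV[of i]] that by (metis singletonD)
    from deterministic_path_ends_in_cycle[OF q V(1) qV this] obtain c n
      where "is_cycle G c" "\<forall>i. q (n + i) = c ! (i mod length c)" by blast
    then show ?thesis unfolding ends_in_cycle_def q_def
      by (intro exI[of _ c] exI[of _ "J + n"]) (simp add: add.assoc)
  qed
qed

end

section \<open>Ideals of the free algebra and of the Leavitt path algebra\<close>

text \<open>A multiple of the empty word. Scalar multiplication becomes ring multiplication,
  although the empty word is excluded from the free algebra without unit.\<close>

definition scal :: "'k::field \<Rightarrow> ('v, 'e, 'k) lpoly" where
  "scal k = Poly_Mapping.single 0 k"

lemma lpoly_induct [case_names zero add]:
  fixes f :: "('v, 'e, 'k::field) lpoly"
  assumes "P 0" and "\<And>f k xs. P f \<Longrightarrow> P (f + scal k * wd xs)"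
  shows "P f"
proof (induction f rule: update_induct)
  case const
  then show ?case by (rule assms(1))
next
  case (update f w k)
  obtain xs where w: "w = Word xs" by (cases w)
  have "scal k * wd xs = Poly_Mapping.single w k"
    by (simp add: scal_def wd_def mult_single w)
  moreover have "Poly_Mapping.update w k f = f + Poly_Mapping.single w k"
    using update(1)
    by (intro poly_mapping_eqI) (auto simp: lookup_update lookup_add lookup_single in_keys_iff)
  ultimately show ?case using assms(2)[OF update(3), of k xs] by simp
qed

lemma wd_append: "wd (xs @ ys) = wd xs * wd ys"
  by (simp add: wd_def mult_single plus_free_word_def)

lemma scal_commute:
  fixes f :: "('v, 'e, 'k::field) lpoly"
  shows "f * scal k = scal k * f"
proof (induction f rule: lpoly_induct)
  case (add f c xs)
  have "scal c * wd xs * scal k = scal k * (scal c * wd xs)"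
    by (simp add: scal_def wd_def mult_single mult.commute)
  with add show ?case by (simp only: ring_distribs)
qed simp

lemma scal_left_commute:
  fixes f :: "('v, 'e, 'k::field) lpoly"
  shows "f * (scal k * g) = scal k * (f * g)"
  by (simp only: mult.assoc[symmetric] scal_commute)

lemma scal_add: "scal (a + b) = scal a + scal b"
  by (simp add: scal_def single_add)

lemma scal_mult: "scal (a * b) = scal a * scal b"
  by (simp add: scal_def mult_single)

lemma scal_1 [simp]: "scal 1 = 1"
  by (simp add: scal_def)

lemma scal_0 [simp]: "scal 0 = 0"
  by (simp add: scal_def)

lemma scal_minus_1:
  fixes f :: "('v, 'e, 'k::field) lpoly"
  shows "scal (- 1) * f = - f"
proof -
  have "1 + scal (- 1) = (0 :: ('v, 'e, 'k::field) lpoly)" using scal_add[of "1::'k" "- 1"] by simp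
  then have "scal (- 1) = (- 1 :: ('v, 'e, 'k) lpoly)" by (simp add: eq_neg_iff_add_eq_0 add.commute)
  then show ?thesis by simp
qed

lemma smult_scal: "Poly_Mapping.map ((*) k) f = scal k * f"
  by (simp add: scal_def mult_map_scale_conv_mult)

text \<open>The free algebra with unit, the natural home of factors such as scalars or possibly
  empty words.\<close>

definition unital_lalg :: "('v, 'e) pre_digraph \<Rightarrow> ('v, 'e, 'k::field) lpoly set" where
  "unital_lalg E = {f. \<forall>w \<in> Poly_Mapping.keys f. set (letters w) \<subseteq> lgens E}"

abbreviation lcarrier :: "('v, 'e) pre_digraph \<Rightarrow> ('v, 'e, 'k::field) lpoly set" where
  "lcarrier E \<equiv> carrier (free_lalg E)"

lemma free_lalg_simps [simp]:
  "azero (free_lalg E) = 0" "aadd (free_lalg E) = (+)" "amult (free_lalg E) = (*)"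
  "asmult (free_lalg E) k f = scal k * f"
  by (simp_all add: free_lalg_def smult_scal)

lemma lcarrier_iff:
  "f \<in> lcarrier E \<longleftrightarrow>
     (\<forall>w \<in> Poly_Mapping.keys f. letters w \<noteq> [] \<and> set (letters w) \<subseteq> lgens E)"
  by (simp add: free_lalg_def)

lemma lcarrier_unital: "f \<in> lcarrier E \<Longrightarrow> f \<in> unital_lalg E"
  by (auto simp: lcarrier_iff unital_lalg_def)

lemma wd_lcarrier [simp]: "wd xs \<in> lcarrier E \<longleftrightarrow> xs \<noteq> [] \<and> set xs \<subseteq> lgens E"
  by (auto simp: lcarrier_iff wd_def)

lemma wd_unital [simp]: "wd xs \<in> unital_lalg E \<longleftrightarrow> set xs \<subseteq> lgens E"
  by (auto simp: unital_lalg_def wd_def)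

lemma scal_unital [simp]: "scal k \<in> unital_lalg E"
  by (auto simp: unital_lalg_def scal_def zero_free_word_def)

lemma lcarrier_0 [simp]: "0 \<in> lcarrier E"
  by (simp add: lcarrier_iff)

lemma lcarrier_add: "f \<in> lcarrier E \<Longrightarrow> g \<in> lcarrier E \<Longrightarrow> f + g \<in> lcarrier E"
  using keys_add[of f g] by (auto simp: lcarrier_iff)

lemma lcarrier_mult_unital:
  assumes "f \<in> lcarrier E" "g \<in> unital_lalg E"
  shows "f * g \<in> lcarrier E" "g * f \<in> lcarrier E"
  using assms keys_mult[of f g] keys_mult[of g f]
  by (fastforce simp: lcarrier_iff unital_lalg_def plus_free_word_def)+

lemma unital_mult:
  assumes "f \<in> unital_lalg E" "g \<in> unital_lalg E"
  shows "f * g \<in> unital_lalg E"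
  using assms keys_mult[of f g]
  by (fastforce simp: unital_lalg_def plus_free_word_def)

lemma lcarrier_scal: "f \<in> lcarrier E \<Longrightarrow> scal k * f \<in> lcarrier E"
  by (rule lcarrier_mult_unital) auto

lemma lcarrier_diff: "f \<in> lcarrier E \<Longrightarrow> g \<in> lcarrier E \<Longrightarrow> f - g \<in> lcarrier E"
  using lcarrier_add[of f E "scal (- 1) * g"] lcarrier_scal[of g E "- 1"] by (simp add: scal_minus_1)

lemma lcarrier_sum: "(\<And>x. x \<in> A \<Longrightarrow> f x \<in> lcarrier E) \<Longrightarrow> sum f A \<in> lcarrier E"
  by (induction A rule: infinite_finite_induct) (auto intro: lcarrier_add)

section \<open>Ideals of the free algebra\<close>

abbreviation lideal :: "('v, 'e) pre_digraph \<Rightarrow> ('v, 'e, 'k::field) lpoly set \<Rightarrow> bool" where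
  "lideal E \<equiv> alg_ideal (free_lalg E)"

lemma lideal_iff:
  "lideal E J \<longleftrightarrow> J \<subseteq> lcarrier E \<and> 0 \<in> J \<and> (\<forall>f\<in>J. \<forall>g\<in>J. f + g \<in> J) \<and> (\<forall>k. \<forall>f\<in>J. scal k * f \<in> J) \<and>
     (\<forall>f\<in>J. \<forall>g\<in>lcarrier E. f * g \<in> J \<and> g * f \<in> J)"
  by (simp add: alg_ideal_def alg_subspace_def)

lemma lideal_carrier: "lideal E (lcarrier E)"
  by (auto simp: lideal_iff lcarrier_add lcarrier_scal lcarrier_mult_unital lcarrier_unital)

context
  fixes E :: "('v, 'e) pre_digraph" and J :: "('v, 'e, 'k::field) lpoly set"
  assumes J: "lideal E J"
begin

lemma lideal_subset: "f \<in> J \<Longrightarrow> f \<in> lcarrier E"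
  using J by (auto simp: lideal_iff)

lemma lideal_0: "0 \<in> J"
  using J by (auto simp: lideal_iff)

lemma lideal_add: "f \<in> J \<Longrightarrow> g \<in> J \<Longrightarrow> f + g \<in> J"
  using J by (auto simp: lideal_iff)

lemma lideal_scal: "f \<in> J \<Longrightarrow> scal k * f \<in> J"
  using J by (auto simp: lideal_iff)

lemma lideal_minus: "f \<in> J \<Longrightarrow> - f \<in> J"
  using lideal_scal[of f "- 1"] by (simp add: scal_minus_1)

lemma lideal_diff: "f \<in> J \<Longrightarrow> g \<in> J \<Longrightarrow> f - g \<in> J"
  using lideal_add[of f "- g"] lideal_minus by simp

lemma lideal_sum: "(\<And>x. x \<in> A \<Longrightarrow> f x \<in> J) \<Longrightarrow> sum f A \<in> J"
  by (induction A rule: infinite_finite_induct) (auto intro: lideal_add lideal_0)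

text \<open>An ideal also absorbs factors with a constant term: that term acts as a scalar, and what
  remains lies in the algebra without unit.\<close>

lemma lideal_mult:
  assumes f: "f \<in> J" and "g \<in> unital_lalg E"
  shows "f * g \<in> J" "g * f \<in> J"
proof -
  have car: "h \<in> lcarrier E" if "Poly_Mapping.lookup h 0 = 0" "h \<in> unital_lalg E" for h
    unfolding lcarrier_iff
  proof (intro ballI conjI)
    fix w assume w: "w \<in> Poly_Mapping.keys h"
    then have "w \<noteq> Word []" using that(1) by (auto simp: zero_free_word_def in_keys_iff)
    then show "letters w \<noteq> []" by (cases w) simp
    show "set (letters w) \<subseteq> lgens E" using w that(2) by (auto simp: unital_lalg_def)
  qed
  define c :: "('v, 'e, 'k) lpoly" where "c = scal (Poly_Mapping.lookup g 0)"
  have c0: "Poly_Mapping.lookup c w = (if w = 0 then Poly_Mapping.lookup g 0 else 0)" for w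
    by (auto simp: c_def scal_def lookup_single)
  have "g - c \<in> unital_lalg E"
    using assms(2) unfolding unital_lalg_def
    by (auto simp: in_keys_iff lookup_minus c0 zero_free_word_def split: if_splits)
  moreover have "Poly_Mapping.lookup (g - c) 0 = 0" by (simp add: lookup_minus c0)
  ultimately have "g - c \<in> lcarrier E" by (intro car)
  then have "f * (g - c) \<in> J" "(g - c) * f \<in> J"
    using J f unfolding lideal_iff by blast+
  moreover have "c * f \<in> J" unfolding c_def by (rule lideal_scal[OF f])
  ultimately have "f * (g - c) + c * f \<in> J" "(g - c) * f + c * f \<in> J"
    by (auto intro: lideal_add)
  then show "f * g \<in> J" "g * f \<in> J"
    by (simp_all add: c_def algebra_simps scal_commute)
qed

end

text \<open>Including the defining relations makes this the preimage of the ideal that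
  \<open>S\<close> generates in the Leavitt path algebra.\<close>

definition lgenideal :: "('v, 'e) pre_digraph \<Rightarrow> ('v, 'e, 'k::field) lpoly set \<Rightarrow> ('v, 'e, 'k) lpoly set"
where "lgenideal E S = alg_genideal (free_lalg E) (lrels E \<union> S)"

lemma (in wf_digraph) lrels_lcarrier: "lrels G \<subseteq> lcarrier G"
proof
  fix f :: "('a, 'b, 'c::field) lpoly" assume "f \<in> lrels G"
  then show "f \<in> lcarrier G"
  proof (cases rule: lrels.cases)
    case (CK2 v)
    then show ?thesis
      by (auto simp: is_regular_def lgens_def intro!: lcarrier_diff lcarrier_sum)
  qed (auto simp: lgens_def intro!: lcarrier_diff)
qed

lemma lgenideal_least: "lideal E J \<Longrightarrow> lrels E \<union> S \<subseteq> J \<Longrightarrow> lgenideal E S \<subseteq> J"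
  by (auto simp: lgenideal_def alg_genideal_def)

lemma lgenideal_incl: "lrels E \<union> S \<subseteq> lgenideal E S"
  by (auto simp: lgenideal_def alg_genideal_def)

lemma (in wf_digraph) lgenideal_ideal:
  fixes S :: "('a, 'b, 'k::field) lpoly set"
  assumes "S \<subseteq> lcarrier G"
  shows "lideal G (lgenideal G S)"
proof -
  let ?C = "{J. lideal G J \<and> lrels G \<union> S \<subseteq> J}"
  have top: "lcarrier G \<in> ?C"
    using lideal_carrier lrels_lcarrier assms by auto
  have eq: "lgenideal G S = \<Inter>?C" by (simp add: lgenideal_def alg_genideal_def)
  show ?thesis
    unfolding eq lideal_iff[of G "\<Inter>?C"]
  proof (intro conjI ballI allI)
    show "\<Inter>?C \<subseteq> lcarrier G" using top by (rule Inter_lower)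
    show "0 \<in> \<Inter>?C" by (auto intro: lideal_0)
    show "f + g \<in> \<Inter>?C" if "f \<in> \<Inter>?C" "g \<in> \<Inter>?C" for f g
      using that by (auto intro: lideal_add)
    show "scal k * f \<in> \<Inter>?C" if "f \<in> \<Inter>?C" for f k
      using that by (auto intro: lideal_scal)
    show "f * g \<in> \<Inter>?C" "g * f \<in> \<Inter>?C" if "f \<in> \<Inter>?C" "g \<in> lcarrier G" for f g
      using that by (auto intro: lideal_mult lcarrier_unital)
  qed
qed

section \<open>The Leavitt path algebra as a quotient\<close>

context wf_digraph
begin

abbreviation lrel_ideal :: "('a, 'b, 'k::field) lpoly set" where
  "lrel_ideal \<equiv> lgenideal G {}"

lemma lrel_ideal: "lideal G lrel_ideal"
  by (rule lgenideal_ideal) simp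

lemma lrel_ideal_least: "lideal G J \<Longrightarrow> lrels G \<subseteq> J \<Longrightarrow> lrel_ideal \<subseteq> J"
  using lgenideal_least[of G J "{}"] by simp

definition lclass :: "('a, 'b, 'k::field) lpoly \<Rightarrow> ('a, 'b, 'k) lpoly set" where
  "lclass f = lcong G `` {f}"

lemma lclass_iff: "g \<in> lclass f \<longleftrightarrow> f \<in> lcarrier G \<and> g \<in> lcarrier G \<and> f - g \<in> lrel_ideal"
  by (simp add: lclass_def lcong_def lgenideal_def)

lemma lclass_eq_iff:
  assumes "f \<in> lcarrier G" "g \<in> lcarrier G"
  shows "lclass f = lclass g \<longleftrightarrow> f - g \<in> lrel_ideal"
proof
  assume "lclass f = lclass g"
  moreover have "g \<in> lclass g" using assms lideal_0[OF lrel_ideal] by (simp add: lclass_iff)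
  ultimately have "g \<in> lclass f" by simp
  then show "f - g \<in> lrel_ideal" by (simp add: lclass_iff)
next
  assume fg: "f - g \<in> lrel_ideal"
  have "f - h \<in> lrel_ideal \<longleftrightarrow> g - h \<in> lrel_ideal" for h
    using lideal_diff[OF lrel_ideal _ fg, of "f - h"] lideal_add[OF lrel_ideal fg, of "g - h"]
    by (auto simp: algebra_simps)
  then show "lclass f = lclass g" using assms by (auto simp: lclass_iff)
qed

lemma carrier_leavitt: "carrier (leavitt_algebra K G) = lclass ` lcarrier G"
  by (auto simp: leavitt_algebra_def lclass_def quotient_def)

lemma lclass_self: "f \<in> lcarrier G \<Longrightarrow> f \<in> lclass f"
  using lideal_0[OF lrel_ideal] by (simp add: lclass_iff)

lemma lclass_UN:
  assumes "f \<in> lcarrier G" and "\<And>f'. f' \<in> lclass f \<Longrightarrow> F f' = X"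
  shows "(\<Union>f'\<in>lclass f. F f') = X"
proof -
  have "(\<Union>f'\<in>lclass f. F f') = (\<Union>f'\<in>lclass f. X)" by (intro SUP_cong HOL.refl assms(2))
  also have "\<dots> = X" using lclass_self[OF assms(1)] by blast
  finally show ?thesis .
qed

lemma azero_leavitt: "azero (leavitt_algebra K G) = lclass 0"
  by (simp add: leavitt_algebra_def lclass_def)

lemma aadd_leavitt:
  assumes "f \<in> lcarrier G" "g \<in> lcarrier G"
  shows "aadd (leavitt_algebra K G) (lclass f) (lclass g) = lclass (f + g)"
proof -
  have "lclass (f' + g') = lclass (f + g)" if "f' \<in> lclass f" "g' \<in> lclass g" for f' g'
  proof -
    have "(f - f') + (g - g') \<in> lrel_ideal"
      using that by (intro lideal_add[OF lrel_ideal]) (auto simp: lclass_iff)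
    from lideal_minus[OF lrel_ideal this] show ?thesis
      using that assms by (subst lclass_eq_iff) (auto simp: lclass_iff lcarrier_add algebra_simps)
  qed
  then have "(\<Union>f'\<in>lclass f. \<Union>g'\<in>lclass g. lclass (f' + g')) = lclass (f + g)"
    using assms by (intro lclass_UN)
  then show ?thesis by (simp add: leavitt_algebra_def lclass_def)
qed

lemma amult_leavitt:
  assumes "f \<in> lcarrier G" "g \<in> lcarrier G"
  shows "amult (leavitt_algebra K G) (lclass f) (lclass g) = lclass (f * g)"
proof -
  have "lclass (f' * g') = lclass (f * g)" if "f' \<in> lclass f" "g' \<in> lclass g" for f' g'
  proof -
    have "(f - f') * g + f' * (g - g') \<in> lrel_ideal"
      using that assms
      by (intro lideal_add[OF lrel_ideal] lideal_mult[OF lrel_ideal])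
        (auto simp: lclass_iff lcarrier_unital)
    from lideal_minus[OF lrel_ideal this] show ?thesis
      using that assms
      by (subst lclass_eq_iff) (auto simp: lclass_iff lcarrier_mult_unital lcarrier_unital algebra_simps)
  qed
  then have "(\<Union>f'\<in>lclass f. \<Union>g'\<in>lclass g. lclass (f' * g')) = lclass (f * g)"
    using assms by (intro lclass_UN)
  then show ?thesis by (simp add: leavitt_algebra_def lclass_def)
qed

lemma asmult_leavitt:
  assumes "f \<in> lcarrier G"
  shows "asmult (leavitt_algebra K G) k (lclass f) = lclass (scal k * f)"
proof -
  have "lclass (scal k * f') = lclass (scal k * f)" if "f' \<in> lclass f" for f'
  proof -
    have "scal k * (f - f') \<in> lrel_ideal"
      using that by (intro lideal_scal[OF lrel_ideal]) (auto simp: lclass_iff)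
    from lideal_minus[OF lrel_ideal this] show ?thesis
      using that assms by (subst lclass_eq_iff) (auto simp: lclass_iff lcarrier_scal algebra_simps)
  qed
  then have "(\<Union>f'\<in>lclass f. lclass (scal k * f')) = lclass (scal k * f)"
    using assms by (intro lclass_UN)
  then show ?thesis by (simp add: leavitt_algebra_def lclass_def)
qed

text \<open>With \<open>leavitt_ideal_image\<close>, the correspondence between ideals of the
  quotient and ideals upstairs that contain the relations. All later calculations take place
  upstairs.\<close>

lemma leavitt_ideal_preimage:
  assumes I: "alg_ideal (leavitt_algebra K G) I"
  defines "J \<equiv> {f \<in> lcarrier G. lclass f \<in> I}"
  shows "lideal G J" "lrel_ideal \<subseteq> J" "lclass ` J = I"
proof -
  have sub: "I \<subseteq> lclass ` lcarrier G" and zero: "lclass 0 \<in> I"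
    and add: "\<And>x y. x \<in> I \<Longrightarrow> y \<in> I \<Longrightarrow> aadd (leavitt_algebra K G) x y \<in> I"
    and smult: "\<And>k x. x \<in> I \<Longrightarrow> asmult (leavitt_algebra K G) k x \<in> I"
    and mult: "\<And>x y. x \<in> I \<Longrightarrow> y \<in> lclass ` lcarrier G \<Longrightarrow>
        amult (leavitt_algebra K G) x y \<in> I \<and> amult (leavitt_algebra K G) y x \<in> I"
    using I by (auto simp: alg_ideal_def alg_subspace_def carrier_leavitt azero_leavitt)
  show "lideal G J"
    unfolding lideal_iff
  proof (intro conjI ballI allI)
    show "J \<subseteq> lcarrier G" "0 \<in> J" using zero by (auto simp: J_def)
    show "f + g \<in> J" if "f \<in> J" "g \<in> J" for f g
      using that add[of "lclass f" "lclass g"] by (auto simp: J_def aadd_leavitt lcarrier_add)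
    show "scal k * f \<in> J" if "f \<in> J" for k f
      using that smult[of "lclass f" k] by (auto simp: J_def asmult_leavitt lcarrier_scal)
    show "f * g \<in> J" "g * f \<in> J" if "f \<in> J" "g \<in> lcarrier G" for f g
      using that mult[of "lclass f" "lclass g"]
      by (auto simp: J_def amult_leavitt lcarrier_mult_unital lcarrier_unital)
  qed
  show "lrel_ideal \<subseteq> J"
  proof
    fix f :: "('a, 'b, 'c) lpoly" assume f: "f \<in> lrel_ideal"
    have "f \<in> lcarrier G" using lideal_subset[OF lrel_ideal f] .
    moreover from this have "lclass f = lclass 0" using f by (simp add: lclass_eq_iff)
    ultimately show "f \<in> J" using zero by (simp add: J_def)
  qed
  show "lclass ` J = I" using sub by (auto simp: J_def)
qed

lemma leavitt_ideal_image:
  assumes J: "lideal G J" and "lrel_ideal \<subseteq> J"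
  shows "alg_ideal (leavitt_algebra K G) (lclass ` J)"
    and "f \<in> lcarrier G \<Longrightarrow> lclass f \<in> lclass ` J \<longleftrightarrow> f \<in> J"
proof -
  note sub = lideal_subset[OF J]
  show "alg_ideal (leavitt_algebra K G) (lclass ` J)"
    unfolding alg_ideal_def alg_subspace_def carrier_leavitt azero_leavitt
  proof (intro conjI ballI allI)
    show "lclass ` J \<subseteq> lclass ` lcarrier G" using sub by auto
    show "lclass 0 \<in> lclass ` J" using lideal_0[OF J] by simp
    show "aadd (leavitt_algebra K G) x y \<in> lclass ` J" if "x \<in> lclass ` J" "y \<in> lclass ` J" for x y
      using that sub by (auto simp: aadd_leavitt lideal_add[OF J])
    show "asmult (leavitt_algebra K G) k x \<in> lclass ` J" if "x \<in> lclass ` J" for k x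
      using that sub by (auto simp: asmult_leavitt lideal_scal[OF J])
    show "amult (leavitt_algebra K G) x y \<in> lclass ` J" "amult (leavitt_algebra K G) y x \<in> lclass ` J"
      if "x \<in> lclass ` J" "y \<in> lclass ` lcarrier G" for x y
      using that sub by (auto simp: amult_leavitt lideal_mult[OF J] lcarrier_unital)
  qed
  show "lclass f \<in> lclass ` J \<longleftrightarrow> f \<in> J" if f: "f \<in> lcarrier G"
  proof
    assume "lclass f \<in> lclass ` J"
    then obtain g where g: "g \<in> J" "lclass f = lclass g" by auto
    then have "f - g \<in> J" using assms(2) f sub by (auto simp: lclass_eq_iff)
    then have "(f - g) + g \<in> J" using g(1) by (rule lideal_add[OF J])
    then show "f \<in> J" by simp
  qed simp
qed

lemma lgenideal_lclass:
  assumes S: "S \<subseteq> lcarrier G"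
  shows "alg_genideal (leavitt_algebra K G) (lclass ` S) = lclass ` lgenideal G S"
proof -
  let ?J = "lgenideal G S"
  have J: "lideal G ?J" by (rule lgenideal_ideal[OF S])
  have RJ: "lrel_ideal \<subseteq> ?J"
    using lrel_ideal_least[OF J] lgenideal_incl[of G S] by simp
  have incl: "lclass ` S \<subseteq> lclass ` ?J" using lgenideal_incl[of G S] by auto
  have "lclass ` ?J \<subseteq> I" if I: "alg_ideal (leavitt_algebra K G) I" "lclass ` S \<subseteq> I" for I
  proof -
    note pre = leavitt_ideal_preimage[OF I(1)]
    have "lgenideal G S \<subseteq> {f \<in> lcarrier G. lclass f \<in> I}"
    proof (rule lgenideal_least[OF pre(1)])
      show "lrels G \<union> S \<subseteq> {f \<in> lcarrier G. lclass f \<in> I}"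
        using pre(2) lgenideal_incl[of G "{}"] I(2) S by auto
    qed
    then show ?thesis by auto
  qed
  then show ?thesis
    using leavitt_ideal_image(1)[OF J RJ, of K] incl unfolding alg_genideal_def by blast
qed

end

section \<open>Graded ideals are determined by their generators\<close>

text \<open>Equations in the Leavitt path algebra are used as congruences modulo an ideal containing
  the relations.\<close>

definition cng :: "('v, 'e, 'k::field) lpoly set \<Rightarrow> ('v, 'e, 'k) lpoly \<Rightarrow> ('v, 'e, 'k) lpoly \<Rightarrow> bool"
where "cng J f g \<longleftrightarrow> f - g \<in> J"

abbreviation vx :: "'v \<Rightarrow> ('v, 'e, 'k::field) lpoly" where "vx v \<equiv> wd [Vertex v]"
abbreviation ed :: "'e \<Rightarrow> ('v, 'e, 'k::field) lpoly" where "ed e \<equiv> wd [Edge e]"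
abbreviation gh :: "'e \<Rightarrow> ('v, 'e, 'k::field) lpoly" where "gh e \<equiv> wd [Ghost e]"

definition pw :: "'v \<Rightarrow> 'e list \<Rightarrow> ('v, 'e, 'k::field) lpoly" where
  "pw u p = wd (path_word u p)"

definition gw :: "'v \<Rightarrow> 'e list \<Rightarrow> ('v, 'e, 'k::field) lpoly" where
  "gw u p = wd (ghost_word u p)"

lemma pw_Nil [simp]: "pw u [] = vx u"
  by (simp add: pw_def path_word_def)

lemma gw_Nil [simp]: "gw u [] = vx u"
  by (simp add: gw_def ghost_word_def)

text \<open>The homogeneous elements of degree \<open>n\<close>, filtered by a bound
  \<open>N\<close> on path lengths that serves as induction measure.\<close>

inductive_set hspan :: "('v, 'e) pre_digraph \<Rightarrow> int \<Rightarrow> nat \<Rightarrow> ('v, 'e, 'k::field) lpoly set"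
  for E n N where
  zero: "0 \<in> hspan E n N"
| add: "\<lbrakk>x \<in> hspan E n N; pre_digraph.awalk E u p w; pre_digraph.awalk E u' q w;
     int (length p) - int (length q) = n; length p \<le> N; length q \<le> N\<rbrakk> \<Longrightarrow>
     x + scal k * (pw u p * gw u' q) \<in> hspan E n N"

lemma hspan_add: "y \<in> hspan E n N \<Longrightarrow> x \<in> hspan E n N \<Longrightarrow> x + y \<in> hspan E n N"
  by (induction rule: hspan.induct) (auto simp: add.assoc[symmetric] intro: hspan.intros)

lemma hspan_scal: "x \<in> hspan E n N \<Longrightarrow> scal c * x \<in> hspan E n N"
proof (induction rule: hspan.induct)
  case (add x u p w u' q k)
  then show ?case
    using hspan.add[OF add.IH add.hyps(2-6), of "c * k"]
    by (simp add: distrib_left scal_mult mult.assoc)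
qed (simp add: hspan.zero)

lemma hspan_mono: "x \<in> hspan E n N \<Longrightarrow> N \<le> M \<Longrightarrow> x \<in> hspan E n M"
  by (induction rule: hspan.induct) (auto intro: hspan.intros)

lemma hspan_gen:
  assumes "pre_digraph.awalk E u p w" "pre_digraph.awalk E u' q w"
     "int (length p) - int (length q) = n" "length p \<le> N" "length q \<le> N"
  shows "pw u p * gw u' q \<in> hspan E n N"
  using hspan.add[OF hspan.zero assms, of 1] by simp

primrec gelt :: "('v, 'e) gvertex \<Rightarrow> ('v, 'e, 'k::field) lpoly" where
  "gelt (Proper v) = vx v"
| "gelt (Improper v Z) = vx v - (\<Sum>e\<in>Z. ed e * gh e)"

lemma in_lgens [simp]:
  "Vertex v \<in> lgens E \<longleftrightarrow> v \<in> verts E" "Edge e \<in> lgens E \<longleftrightarrow> e \<in> arcs E"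
  "Ghost e \<in> lgens E \<longleftrightarrow> e \<in> arcs E"
  by (auto simp: lgens_def)

section \<open>Calculation modulo an ideal that contains the relations\<close>

context wf_digraph
begin

lemma gen_unital [simp]:
  "v \<in> verts G \<Longrightarrow> vx v \<in> unital_lalg G" "e \<in> arcs G \<Longrightarrow> ed e \<in> unital_lalg G"
  "e \<in> arcs G \<Longrightarrow> gh e \<in> unital_lalg G"
  by (auto simp: lgens_def)

lemma gen_lcarrier [simp]:
  "v \<in> verts G \<Longrightarrow> vx v \<in> lcarrier G" "e \<in> arcs G \<Longrightarrow> ed e \<in> lcarrier G"
  "e \<in> arcs G \<Longrightarrow> gh e \<in> lcarrier G"
  by (auto simp: lgens_def)

lemma path_word_lgens: "awalk u p w \<Longrightarrow> set (path_word u p) \<subseteq> lgens G"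
  by (auto simp: path_word_def awalk_def lgens_def)

lemma ghost_word_lgens: "awalk u p w \<Longrightarrow> set (ghost_word u p) \<subseteq> lgens G"
  by (auto simp: ghost_word_def awalk_def lgens_def)

lemma pw_unital: "awalk u p w \<Longrightarrow> pw u p \<in> unital_lalg G"
  by (simp add: pw_def path_word_lgens)

lemma gw_unital: "awalk u p w \<Longrightarrow> gw u p \<in> unital_lalg G"
  by (simp add: gw_def ghost_word_lgens)

lemma pw_lcarrier: "awalk u p w \<Longrightarrow> pw u p \<in> lcarrier G"
  using path_word_lgens[of u p w] by (auto simp: pw_def path_word_def)

lemma hspan_lcarrier: "x \<in> hspan G n N \<Longrightarrow> x \<in> lcarrier G"
  by (induction rule: hspan.induct)
    (blast intro: lcarrier_0 lcarrier_add lcarrier_scal lcarrier_mult_unital(1) pw_lcarrier gw_unital)+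

lemma gelt_lcarrier: "g \<in> gvertices G \<Longrightarrow> gelt g \<in> lcarrier G"
  by (cases g)
    (auto simp: is_inf_emitter_def intro!: lcarrier_diff lcarrier_sum lcarrier_mult_unital)

text \<open>Left multiplication by \<open>\<Sum>e e*\<close>, written so that the shorter element
  \<open>e* x\<close> is visible. It fixes monomials whose real path starts with an edge in
  \<open>Z\<close>; \<open>Rz\<close> is its mirror image for the ghost path.\<close>

definition Lz :: "'b set \<Rightarrow> ('a, 'b, 'k) lpoly \<Rightarrow> ('a, 'b, 'k::field) lpoly" where
  "Lz Z x = (\<Sum>e\<in>Z. ed e * (gh e * x))"

definition Rz :: "'b set \<Rightarrow> ('a, 'b, 'k) lpoly \<Rightarrow> ('a, 'b, 'k::field) lpoly" where
  "Rz Z x = (\<Sum>e\<in>Z. x * ed e * gh e)"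

text \<open>What \<open>Z\<close> leaves of the vertex \<open>u\<close>. If the edges of
  \<open>Z\<close> at \<open>u\<close> form a nonempty set \<open>Y\<close> and \<open>u\<close> is
  an infinite emitter, this is the element for \<open>q_Y\<close>.\<close>

definition tz :: "'b set \<Rightarrow> 'a \<Rightarrow> ('a, 'b, 'k::field) lpoly" where
  "tz Z u = vx u - (\<Sum>e\<in>{e\<in>Z. tail G e = u}. ed e * gh e)"

context
  fixes J :: "('a, 'b, 'k::field) lpoly set"
  assumes J: "lideal G J" and R: "lrels G \<subseteq> J"
begin

lemma cng_refl [simp]: "cng J f f"
  by (simp add: cng_def lideal_0[OF J])

lemma cng_sym: "cng J f g \<Longrightarrow> cng J g f"
  using lideal_minus[OF J, of "f - g"] by (simp add: cng_def)

lemma cng_trans [trans]: "cng J f g \<Longrightarrow> cng J g h \<Longrightarrow> cng J f h"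
  using lideal_add[OF J, of "f - g" "g - h"] by (simp add: cng_def)

lemma cng_add: "cng J f g \<Longrightarrow> cng J f' g' \<Longrightarrow> cng J (f + f') (g + g')"
  using lideal_add[OF J, of "f - g" "f' - g'"] by (simp add: cng_def algebra_simps)

lemma cng_diff: "cng J f g \<Longrightarrow> cng J f' g' \<Longrightarrow> cng J (f - f') (g - g')"
  using lideal_diff[OF J, of "f - g" "f' - g'"] by (simp add: cng_def algebra_simps)

lemma cng_sum: "(\<And>x. x \<in> A \<Longrightarrow> cng J (f x) (g x)) \<Longrightarrow> cng J (sum f A) (sum g A)"
  unfolding cng_def sum_subtractf[symmetric] by (rule lideal_sum[OF J])

lemma cng_scal: "cng J f g \<Longrightarrow> cng J (scal k * f) (scal k * g)"
  using lideal_scal[OF J, of "f - g" k] by (simp add: cng_def algebra_simps)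

lemma cng_mult_left: "z \<in> unital_lalg G \<Longrightarrow> cng J f g \<Longrightarrow> cng J (z * f) (z * g)"
  using lideal_mult(2)[OF J, of "f - g" z] by (simp add: cng_def algebra_simps)

lemma cng_mult_right: "z \<in> unital_lalg G \<Longrightarrow> cng J f g \<Longrightarrow> cng J (f * z) (g * z)"
  using lideal_mult(1)[OF J, of "f - g" z] by (simp add: cng_def algebra_simps)

lemma cng_in: "cng J f g \<Longrightarrow> f \<in> J \<longleftrightarrow> g \<in> J"
  using lideal_add[OF J, of "f - g" g] lideal_diff[OF J, of f "f - g"] by (auto simp: cng_def)

lemma wd2: "wd [a, b] = wd [a] * wd [b]"
  using wd_append[of "[a]" "[b]"] by simp

lemma cng_orth: "v \<in> verts G \<Longrightarrow> w \<in> verts G \<Longrightarrow> v \<noteq> w \<Longrightarrow> cng J (vx v * vx w) 0"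
  using R lrels.orth[of v G w] by (auto simp: cng_def wd2)

lemma cng_idem: "v \<in> verts G \<Longrightarrow> cng J (vx v * vx v) (vx v)"
  using R lrels.idem[of v G] by (auto simp: cng_def wd2)

lemma cng_src_edge: "e \<in> arcs G \<Longrightarrow> cng J (vx (tail G e) * ed e) (ed e)"
  using R lrels.src_edge[of e G] by (auto simp: cng_def wd2)

lemma cng_edge_rng: "e \<in> arcs G \<Longrightarrow> cng J (ed e * vx (head G e)) (ed e)"
  using R lrels.edge_rng[of e G] by (auto simp: cng_def wd2)

lemma cng_rng_ghost: "e \<in> arcs G \<Longrightarrow> cng J (vx (head G e) * gh e) (gh e)"
  using R lrels.rng_ghost[of e G] by (auto simp: cng_def wd2)

lemma cng_ghost_src: "e \<in> arcs G \<Longrightarrow> cng J (gh e * vx (tail G e)) (gh e)"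
  using R lrels.ghost_src[of e G] by (auto simp: cng_def wd2)

lemma cng_CK1_orth: "e \<in> arcs G \<Longrightarrow> f \<in> arcs G \<Longrightarrow> e \<noteq> f \<Longrightarrow> cng J (gh e * ed f) 0"
  using R lrels.CK1_orth[of e G f] by (auto simp: cng_def wd2)

lemma cng_CK1: "e \<in> arcs G \<Longrightarrow> cng J (gh e * ed e) (vx (head G e))"
  using R lrels.CK1[of e G] by (auto simp: cng_def wd2)

lemma cng_CK2: "is_regular G v \<Longrightarrow> cng J (vx v) (\<Sum>e\<in>out_arcs G v. ed e * gh e)"
  using R lrels.CK2[of G v] by (auto simp: cng_def wd2 simp del: in_out_arcs_conv)

lemma cng_vertex_edge_ne:
  assumes "u \<in> verts G" "e \<in> arcs G" "tail G e \<noteq> u"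
  shows "cng J (vx u * ed e) 0"
proof -
  have "cng J (vx u * ed e) (vx u * (vx (tail G e) * ed e))"
    using assms by (intro cng_mult_left cng_sym[OF cng_src_edge]) auto
  also have "cng J (vx u * (vx (tail G e) * ed e)) (0 * ed e)"
    unfolding mult.assoc[symmetric] using assms by (intro cng_mult_right cng_orth) auto
  finally show ?thesis by simp
qed

lemma cng_ghost_vertex_ne:
  assumes "u \<in> verts G" "e \<in> arcs G" "tail G e \<noteq> u"
  shows "cng J (gh e * vx u) 0"
proof -
  have "cng J (gh e * vx u) (gh e * vx (tail G e) * vx u)"
    using assms by (intro cng_mult_right cng_sym[OF cng_ghost_src]) auto
  also have "cng J (gh e * vx (tail G e) * vx u) (gh e * 0)"
    unfolding mult.assoc using assms by (intro cng_mult_left cng_orth) auto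
  finally show ?thesis by simp
qed

lemma cng_pw_start:
  assumes "awalk u p w"
  shows "cng J (vx u * pw u p) (pw u p)"
proof (cases p)
  case Nil
  then show ?thesis using assms by (auto simp: awalk_Nil_iff intro: cng_idem)
next
  case (Cons e p')
  then have e: "e \<in> arcs G" "u = tail G e" "set p' \<subseteq> arcs G"
    using assms by (auto simp: awalk_Cons_iff awalk_def)
  have eq: "pw u p = (ed e * wd (map Edge p') :: ('a, 'b, 'k) lpoly)"
    using wd_append[of "[Edge e]" "map Edge p'"] by (simp add: Cons pw_def path_word_def)
  have "(wd (map Edge p') :: ('a, 'b, 'k) lpoly) \<in> unital_lalg G" using e by (auto simp: lgens_def)
  then show ?thesis
    unfolding eq unfolding e(2) mult.assoc[symmetric] by (intro cng_mult_right cng_src_edge e(1))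
qed

lemma cng_gw_end:
  assumes "awalk u p w"
  shows "cng J (gw u p * vx u) (gw u p)"
proof (cases p)
  case Nil
  then show ?thesis using assms by (auto simp: awalk_Nil_iff intro: cng_idem)
next
  case (Cons e p')
  then have e: "e \<in> arcs G" "u = tail G e" "set p' \<subseteq> arcs G"
    using assms by (auto simp: awalk_Cons_iff awalk_def)
  have eq: "gw u p = (wd (rev (map Ghost p')) * gh e :: ('a, 'b, 'k) lpoly)"
    using wd_append[of "rev (map Ghost p')" "[Ghost e]"] by (simp add: Cons gw_def ghost_word_def)
  have "(wd (rev (map Ghost p')) :: ('a, 'b, 'k) lpoly) \<in> unital_lalg G" using e by (auto simp: lgens_def)
  then show ?thesis
    unfolding eq unfolding e(2) mult.assoc by (intro cng_mult_left cng_ghost_src e(1))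
qed

lemma cng_pw_Cons:
  assumes "awalk u (f # p) w"
  shows "cng J (pw u (f # p)) (ed f * pw (head G f) p)"
proof (cases "p = []")
  case True
  then show ?thesis
    using assms by (auto simp: awalk_Cons_iff pw_def path_word_def intro: cng_sym cng_edge_rng)
next
  case False
  then have "pw u (f # p) = (ed f * pw (head G f) p :: ('a, 'b, 'k) lpoly)"
    using wd_append[of "[Edge f]" "map Edge p"] by (simp add: pw_def path_word_def)
  then show ?thesis by simp
qed

lemma cng_gw_Cons:
  assumes "awalk u (f # p) w"
  shows "cng J (gw u (f # p)) (gw (head G f) p * gh f)"
proof (cases "p = []")
  case True
  then show ?thesis
    using assms by (auto simp: awalk_Cons_iff gw_def ghost_word_def intro: cng_sym cng_rng_ghost)
next
  case False
  then have "gw u (f # p) = (gw (head G f) p * gh f :: ('a, 'b, 'k) lpoly)"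
    using wd_append[of "rev (map Ghost p)" "[Ghost f]"] by (simp add: gw_def ghost_word_def)
  then show ?thesis by simp
qed

lemma cng_ghost_mon:
  assumes e: "e \<in> arcs G" and p: "awalk u (f # p) w" and q: "awalk u' q w"
  shows "cng J (gh e * (pw u (f # p) * gw u' q)) (if e = f then pw (head G f) p * gw u' q else 0)"
proof -
  have f: "f \<in> arcs G" and p': "awalk (head G f) p w" using p by (auto simp: awalk_Cons_iff)
  have "cng J (gh e * (pw u (f # p) * gw u' q)) (gh e * (ed f * pw (head G f) p * gw u' q))"
    using e p q by (intro cng_mult_left cng_mult_right cng_pw_Cons gw_unital) auto
  also have "gh e * (ed f * pw (head G f) p * gw u' q) = (gh e * ed f) * (pw (head G f) p * gw u' q)"
    by (simp add: mult.assoc)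
  also have "cng J \<dots> ((if e = f then vx (head G f) else 0) * (pw (head G f) p * gw u' q))"
    using e f p' q
    by (intro cng_mult_right) (auto intro: cng_CK1 cng_CK1_orth unital_mult pw_unital gw_unital)
  also have "cng J \<dots> (if e = f then pw (head G f) p * gw u' q else 0)"
    using cng_mult_right[OF gw_unital[OF q] cng_pw_start[OF p']] by (simp add: mult.assoc)
  finally show ?thesis .
qed

lemma cng_mon_edge:
  assumes e: "e \<in> arcs G" and p: "awalk u p w" and q: "awalk u' (f # q) w"
  shows "cng J (pw u p * gw u' (f # q) * ed e) (if e = f then pw u p * gw (head G f) q else 0)"
proof -
  have f: "f \<in> arcs G" and q': "awalk (head G f) q w" using q by (auto simp: awalk_Cons_iff)
  have "cng J (pw u p * gw u' (f # q) * ed e) (pw u p * (gw (head G f) q * gh f) * ed e)"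
    using e p q by (intro cng_mult_left cng_mult_right cng_gw_Cons pw_unital) auto
  also have "pw u p * (gw (head G f) q * gh f) * ed e = (pw u p * gw (head G f) q) * (gh f * ed e)"
    by (simp add: mult.assoc)
  also have "cng J \<dots> ((pw u p * gw (head G f) q) * (if e = f then vx (head G f) else 0))"
    using e f p q'
    by (intro cng_mult_left) (auto intro: cng_CK1 cng_CK1_orth unital_mult pw_unital gw_unital)
  also have "cng J \<dots> (if e = f then pw u p * gw (head G f) q else 0)"
    using cng_mult_left[OF pw_unital[OF p] cng_gw_end[OF q']] by (simp add: mult.assoc)
  finally show ?thesis .
qed

section \<open>Splitting homogeneous elements at their first edges\<close>

lemma Lz_lin: "Lz Z (x + scal k * y) = Lz Z x + scal k * Lz Z y"
  by (simp add: Lz_def distrib_left sum.distrib sum_distrib_left scal_left_commute)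

lemma Rz_lin: "Rz Z (x + scal k * y) = Rz Z x + scal k * Rz Z y"
  by (simp add: Rz_def distrib_left distrib_right sum.distrib sum_distrib_left mult.assoc)

lemma Lz_cng: "Z \<subseteq> arcs G \<Longrightarrow> cng J x y \<Longrightarrow> cng J (Lz Z x) (Lz Z y)"
  unfolding Lz_def by (intro cng_sum cng_mult_left) auto

lemma Lz_mon:
  assumes p: "awalk u (f # p) w" and q: "awalk u' q w" and Z: "finite Z" "f \<in> Z" "Z \<subseteq> arcs G"
  shows "cng J (Lz Z (pw u (f # p) * gw u' q)) (pw u (f # p) * gw u' q)"
proof -
  have "cng J (Lz Z (pw u (f # p) * gw u' q))
      (\<Sum>e\<in>Z. ed e * (if e = f then pw (head G f) p * gw u' q else 0))"
    unfolding Lz_def using p q Z by (intro cng_sum cng_mult_left cng_ghost_mon) auto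
  also have "(\<Sum>e\<in>Z. ed e * (if e = f then pw (head G f) p * gw u' q else 0)) =
      ed f * pw (head G f) p * gw u' q"
    using Z by (simp add: if_distrib[of "\<lambda>x. _ * x"] sum.delta mult.assoc cong: if_cong)
  also have "cng J \<dots> (pw u (f # p) * gw u' q)"
    using p q by (intro cng_mult_right cng_sym[OF cng_pw_Cons] gw_unital)
  finally show ?thesis .
qed

lemma Rz_mon:
  assumes p: "awalk u p w" and q: "awalk u' (f # q) w" and Z: "finite Z" "f \<in> Z" "Z \<subseteq> arcs G"
  shows "cng J (Rz Z (pw u p * gw u' (f # q))) (pw u p * gw u' (f # q))"
proof -
  have "cng J (Rz Z (pw u p * gw u' (f # q)))
      (\<Sum>e\<in>Z. (if e = f then pw u p * gw (head G f) q else 0) * gh e)"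
    unfolding Rz_def using p q Z by (intro cng_sum cng_mult_right cng_mon_edge) auto
  also have "(\<Sum>e\<in>Z. (if e = f then pw u p * gw (head G f) q else 0) * gh e) =
      pw u p * (gw (head G f) q * gh f)"
    using Z by (simp add: if_distrib[of "\<lambda>x. x * _"] sum.delta mult.assoc cong: if_cong)
  also have "cng J \<dots> (pw u p * gw u' (f # q))"
    using p q by (intro cng_mult_left cng_sym[OF cng_gw_Cons] pw_unital)
  finally show ?thesis .
qed

text \<open>In positive degree every monomial has a real first edge. Allowing all larger
  \<open>Z\<close> lets the edge sets of different summands be merged in the induction.\<close>

lemma hspan_pos_decomp:
  assumes "x \<in> hspan G n N" "n > 0"
  shows "\<exists>Z0. finite Z0 \<and> Z0 \<subseteq> arcs G \<and>
    (\<forall>Z. finite Z \<and> Z0 \<subseteq> Z \<and> Z \<subseteq> arcs G \<longrightarrow> cng J x (Lz Z x))"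
  using assms(1)
proof (induction rule: hspan.induct)
  case zero
  then show ?case by (intro exI[of _ "{}"]) (simp add: Lz_def)
next
  case (add x u p w u' q k)
  then obtain f p' where p: "p = f # p'" using assms(2) by (cases p) auto
  obtain Z0 where Z0: "finite Z0" "Z0 \<subseteq> arcs G"
     "\<And>Z. finite Z \<and> Z0 \<subseteq> Z \<and> Z \<subseteq> arcs G \<Longrightarrow> cng J x (Lz Z x)" using add.IH by blast
  have f: "f \<in> arcs G" using add.hyps p by (auto simp: awalk_Cons_iff)
  have "cng J (x + scal k * (pw u p * gw u' q)) (Lz Z (x + scal k * (pw u p * gw u' q)))"
    if "finite Z" "insert f Z0 \<subseteq> Z" "Z \<subseteq> arcs G" for Z
    unfolding Lz_lin unfolding p
    using that add.hyps p by (intro cng_add cng_scal cng_sym[OF Lz_mon] Z0(3)) auto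
  then show ?case using Z0 f by (intro exI[of _ "insert f Z0"]) auto
qed

lemma hspan_neg_decomp:
  assumes "x \<in> hspan G n N" "n < 0"
  shows "\<exists>Z0. finite Z0 \<and> Z0 \<subseteq> arcs G \<and>
    (\<forall>Z. finite Z \<and> Z0 \<subseteq> Z \<and> Z \<subseteq> arcs G \<longrightarrow> cng J x (Rz Z x))"
  using assms(1)
proof (induction rule: hspan.induct)
  case zero
  then show ?case by (intro exI[of _ "{}"]) (simp add: Rz_def)
next
  case (add x u p w u' q k)
  then obtain f q' where q: "q = f # q'" using assms(2) by (cases q) auto
  obtain Z0 where Z0: "finite Z0" "Z0 \<subseteq> arcs G"
     "\<And>Z. finite Z \<and> Z0 \<subseteq> Z \<and> Z \<subseteq> arcs G \<Longrightarrow> cng J x (Rz Z x)" using add.IH by blast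
  have f: "f \<in> arcs G" using add.hyps q by (auto simp: awalk_Cons_iff)
  have "cng J (x + scal k * (pw u p * gw u' q)) (Rz Z (x + scal k * (pw u p * gw u' q)))"
    if "finite Z" "insert f Z0 \<subseteq> Z" "Z \<subseteq> arcs G" for Z
    unfolding Rz_lin unfolding q
    using that add.hyps q by (intro cng_add cng_scal cng_sym[OF Rz_mon] Z0(3)) auto
  then show ?case using Z0 f by (intro exI[of _ "insert f Z0"]) auto
qed

text \<open>The ghost edge cancels the first edge of \<open>p\<close>. The bound drops for
  \<open>q\<close> as well, since \<open>q\<close> is shorter than \<open>p\<close> in positive
  degree.\<close>

lemma hspan_pos_shrink:
  assumes "x \<in> hspan G n N" "n > 0" "e \<in> arcs G"
  shows "\<exists>y\<in>hspan G (n - 1) (N - 1). cng J (gh e * x) y"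
  using assms(1)
proof (induction rule: hspan.induct)
  case zero
  then show ?case by (intro bexI[of _ 0]) (auto intro: hspan.zero)
next
  case (add x u p w u' q k)
  then obtain f p' where p: "p = f # p'" using assms(2) by (cases p) auto
  obtain y where y: "y \<in> hspan G (n - 1) (N - 1)" "cng J (gh e * x) y" using add.IH by blast
  let ?m = "if e = f then pw (head G f) p' * gw u' q else 0"
  have "gh e * (x + scal k * (pw u p * gw u' q)) = gh e * x + scal k * (gh e * (pw u p * gw u' q))"
    by (simp add: distrib_left scal_left_commute)
  also have "cng J \<dots> (y + scal k * ?m)"
    unfolding p using add.hyps assms(3) p by (intro cng_add y(2) cng_scal cng_ghost_mon[where w = w]) auto
  finally have "cng J (gh e * (x + scal k * (pw u p * gw u' q))) (y + scal k * ?m)" .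
  moreover have "?m \<in> hspan G (n - 1) (N - 1)"
    using add.hyps p assms(2)
    by (auto simp: awalk_Cons_iff intro!: hspan.zero hspan_gen[where w = w])
  ultimately show ?case using y(1) by (intro bexI[of _ "y + scal k * ?m"] hspan_add hspan_scal)
qed

lemma hspan_neg_shrink:
  assumes "x \<in> hspan G n N" "n < 0" "e \<in> arcs G"
  shows "\<exists>y\<in>hspan G (n + 1) (N - 1). cng J (x * ed e) y"
  using assms(1)
proof (induction rule: hspan.induct)
  case zero
  then show ?case by (intro bexI[of _ 0]) (auto intro: hspan.zero)
next
  case (add x u p w u' q k)
  then obtain f q' where q: "q = f # q'" using assms(2) by (cases q) auto
  obtain y where y: "y \<in> hspan G (n + 1) (N - 1)" "cng J (x * ed e) y" using add.IH by blast
  let ?m = "if e = f then pw u p * gw (head G f) q' else 0"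
  have "(x + scal k * (pw u p * gw u' q)) * ed e = x * ed e + scal k * (pw u p * gw u' q * ed e)"
    by (simp add: distrib_right mult.assoc)
  also have "cng J \<dots> (y + scal k * ?m)"
    unfolding q using add.hyps assms(3) q by (intro cng_add y(2) cng_scal cng_mon_edge[where w = w]) auto
  finally have "cng J ((x + scal k * (pw u p * gw u' q)) * ed e) (y + scal k * ?m)" .
  moreover have "?m \<in> hspan G (n + 1) (N - 1)"
    using add.hyps q assms(2)
    by (auto simp: awalk_Cons_iff intro!: hspan.zero hspan_gen[where w = w])
  ultimately show ?case using y(1) by (intro bexI[of _ "y + scal k * ?m"] hspan_add hspan_scal)
qed

lemma cng_ghost_vertex_edge:
  assumes "u \<in> verts G" "e \<in> arcs G" "f \<in> arcs G"
  shows "cng J (gh e * (vx u * vx u) * ed f) (if e = f \<and> tail G e = u then vx (head G e) else 0)"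
proof (cases "tail G e = u \<and> tail G f = u")
  case True
  have "cng J (gh e * (vx u * vx u) * ed f) (gh e * vx u * ed f)"
    using assms by (intro cng_mult_right cng_mult_left cng_idem) auto
  also have "cng J \<dots> (gh e * ed f)"
    using assms True cng_ghost_src[OF assms(2)] by (intro cng_mult_right) auto
  also have "cng J \<dots> (if e = f \<and> tail G e = u then vx (head G e) else 0)"
    using True assms by (auto intro: cng_CK1 cng_CK1_orth)
  finally show ?thesis .
next
  case False
  then consider "tail G e \<noteq> u" | "tail G f \<noteq> u" by blast
  then have "cng J (gh e * (vx u * vx u) * ed f) 0"
  proof cases
    case 1
    have "cng J (gh e * vx u * (vx u * ed f)) (0 * (vx u * ed f))"
      using 1 assms by (intro cng_mult_right cng_ghost_vertex_ne) (auto intro: unital_mult)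
    then show ?thesis by (simp add: mult.assoc)
  next
    case 2
    have "cng J (gh e * vx u * (vx u * ed f)) (gh e * vx u * 0)"
      using 2 assms by (intro cng_mult_left cng_vertex_edge_ne) (auto intro: unital_mult)
    then show ?thesis by (simp add: mult.assoc)
  qed
  then show ?thesis using False by auto
qed

text \<open>In degree 0 both paths must lose an edge. If both are empty the result is again a
  vertex, which satisfies any bound.\<close>

lemma hspan_zero_shrink:
  assumes "x \<in> hspan G 0 N" "e \<in> arcs G" "f \<in> arcs G"
  shows "\<exists>y\<in>hspan G 0 (N - 1). cng J (gh e * x * ed f) y"
  using assms(1)
proof (induction rule: hspan.induct)
  case zero
  then show ?case by (intro bexI[of _ 0]) (auto intro: hspan.zero)
next
  case (add x u p w u' q k)
  obtain y where y: "y \<in> hspan G 0 (N - 1)" "cng J (gh e * x * ed f) y" using add.IH by blast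
  have "\<exists>m\<in>hspan G 0 (N - 1). cng J (gh e * (pw u p * gw u' q) * ed f) m"
  proof (cases p)
    case Nil
    then have q: "q = []" "u' = u" "w = u" and u: "u \<in> verts G"
      using add.hyps by (auto simp: awalk_Nil_iff)
    let ?m = "if e = f \<and> tail G e = u then vx (head G e) * vx (head G e) else 0"
    have "cng J (gh e * (pw u p * gw u' q) * ed f) (if e = f \<and> tail G e = u then vx (head G e) else 0)"
      unfolding Nil q using cng_ghost_vertex_edge[OF u assms(2,3)] by simp
    also have "cng J \<dots> ?m" using assms by (auto intro: cng_sym[OF cng_idem])
    finally have "cng J (gh e * (pw u p * gw u' q) * ed f) ?m" .
    moreover have "?m \<in> hspan G 0 (N - 1)"
      using hspan_gen[of G "head G e" "[]" "head G e" "head G e" "[]" 0 "N - 1"] assms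
      by (auto intro: hspan.zero simp: awalk_Nil_iff)
    ultimately show ?thesis by blast
  next
    case (Cons f0 p')
    then obtain g0 q' where q: "q = g0 # q'" using add.hyps by (cases q) auto
    have p': "awalk (head G f0) p' w" and q': "awalk (head G g0) q' w"
      using add.hyps Cons q by (auto simp: awalk_Cons_iff)
    let ?m1 = "if e = f0 then pw (head G f0) p' * gw u' q else 0"
    let ?m = "if e = f0 then (if f = g0 then pw (head G f0) p' * gw (head G g0) q' else 0) else 0"
    have "cng J (gh e * (pw u p * gw u' q) * ed f) (?m1 * ed f)"
      unfolding Cons using add.hyps assms Cons
      by (intro cng_mult_right cng_ghost_mon[where w = w]) auto
    also have "cng J (?m1 * ed f) ?m"
      using cng_mon_edge[OF assms(3) p' add.hyps(3)[unfolded q]] q by auto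
    finally have "cng J (gh e * (pw u p * gw u' q) * ed f) ?m" .
    moreover have "?m \<in> hspan G 0 (N - 1)"
      using add.hyps Cons q p' q' by (auto intro!: hspan.zero hspan_gen[where w = w])
    ultimately show ?thesis by blast
  qed
  then obtain m where m: "m \<in> hspan G 0 (N - 1)" "cng J (gh e * (pw u p * gw u' q) * ed f) m" by blast
  have "gh e * (x + scal k * (pw u p * gw u' q)) * ed f =
      gh e * x * ed f + scal k * (gh e * (pw u p * gw u' q) * ed f)"
    by (simp add: distrib_left distrib_right scal_left_commute mult.assoc)
  also have "cng J \<dots> (y + scal k * m)" by (intro cng_add y(2) cng_scal m(2))
  finally show ?case using y(1) m(1) by (intro bexI[of _ "y + scal k * m"] hspan_add hspan_scal)
qed

text \<open>Edges with another source are killed by \<open>u\<close>, and by (CK1) \<open>Lz\<close>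
  reproduces each \<open>e e*\<close> at \<open>u\<close>. So the second summand is exactly what
  \<open>tz\<close> subtracts.\<close>

lemma tz_Lz_Rz:
  assumes u: "u \<in> verts G" and Z: "finite Z" "Z \<subseteq> arcs G"
  shows "cng J (vx u * vx u) (tz Z u + Lz Z (Rz Z (vx u * vx u)))"
proof -
  let ?s = "\<Sum>e\<in>{e\<in>Z. tail G e = u}. ed e * gh e :: ('a, 'b, 'k) lpoly"
  have step: "cng J (vx u * vx u * ed e * gh e) (if tail G e = u then ed e * gh e else 0)"
    if "e \<in> Z" for e
  proof -
    have e: "e \<in> arcs G" using that Z by auto
    have "cng J (vx u * vx u * ed e) (vx u * ed e)"
      using u e by (intro cng_mult_right cng_idem) auto
    also have "cng J \<dots> (if tail G e = u then ed e else 0)"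
      using u e cng_src_edge[OF e] by (auto intro: cng_vertex_edge_ne)
    finally have "cng J (vx u * vx u * ed e * gh e) ((if tail G e = u then ed e else 0) * gh e)"
      using e by (intro cng_mult_right) auto
    then show ?thesis by (auto split: if_splits)
  qed
  have "cng J (Rz Z (vx u * vx u)) (\<Sum>e\<in>Z. if tail G e = u then ed e * gh e else 0)"
    unfolding Rz_def by (intro cng_sum step)
  also have "(\<Sum>e\<in>Z. if tail G e = u then ed e * gh e else 0) = ?s"
    using Z(1) by (simp add: sum.inter_filter)
  finally have "cng J (Lz Z (Rz Z (vx u * vx u))) (Lz Z ?s)" using Z(2) by (intro Lz_cng)
  also have "Lz Z ?s = (\<Sum>e\<in>{e\<in>Z. tail G e = u}. Lz Z (ed e * gh e))"
    unfolding Lz_def sum_distrib_left by (rule sum.swap)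
  also have "cng J \<dots> ?s"
  proof (rule cng_sum)
    fix e assume e: "e \<in> {e \<in> Z. tail G e = u}"
    then have w: "awalk u [e] (head G e)" using Z by (auto simp: awalk_simps)
    have "pw u [e] = (ed e :: ('a, 'b, 'k) lpoly)" "gw u [e] = (gh e :: ('a, 'b, 'k) lpoly)"
      by (simp_all add: pw_def gw_def path_word_def ghost_word_def)
    then show "cng J (Lz Z (ed e * gh e)) (ed e * gh e)"
      using Lz_mon[OF w w Z(1) _ Z(2)] e by simp
  qed
  finally have "cng J (tz Z u + Lz Z (Rz Z (vx u * vx u))) (tz Z u + ?s)" by (intro cng_add cng_refl)
  then have "cng J (tz Z u + Lz Z (Rz Z (vx u * vx u))) (vx u)" by (simp add: tz_def)
  from cng_trans[OF cng_idem[OF u] cng_sym[OF this]] show ?thesis .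
qed

lemma hspan_zero_decomp:
  assumes "x \<in> hspan G 0 N"
  shows "\<exists>Z0 U k. finite Z0 \<and> Z0 \<subseteq> arcs G \<and> finite U \<and> U \<subseteq> verts G \<and> (\<forall>u. u \<notin> U \<longrightarrow> k u = 0) \<and>
    (N = 0 \<longrightarrow> Z0 = {}) \<and>
    (\<forall>Z. finite Z \<and> Z0 \<subseteq> Z \<and> Z \<subseteq> arcs G \<longrightarrow>
       cng J x ((\<Sum>u\<in>U. scal (k u) * tz Z u) + Lz Z (Rz Z x)))"
  using assms
proof (induction rule: hspan.induct)
  case zero
  show ?case by (intro exI[of _ "{}"] exI[of _ "\<lambda>_. 0"]) (simp add: Lz_def Rz_def)
next
  case (add x u p w u' q c)
  obtain Z0 U k where IH: "finite Z0" "Z0 \<subseteq> arcs G" "finite U" "U \<subseteq> verts G" "\<forall>u. u \<notin> U \<longrightarrow> k u = 0"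
    "N = 0 \<longrightarrow> Z0 = {}"
    and IH7: "\<forall>Z. finite Z \<and> Z0 \<subseteq> Z \<and> Z \<subseteq> arcs G \<longrightarrow>
       cng J x ((\<Sum>u\<in>U. scal (k u) * tz Z u) + Lz Z (Rz Z x))"
    using add.IH by (elim exE conjE) (rule that)
  let ?m = "pw u p * gw u' q :: ('a, 'b, 'k) lpoly"
  show ?case
  proof (cases p)
    case Nil
    then have q: "q = []" "u' = u" "w = u" and u: "u \<in> verts G"
      using add.hyps by (auto simp: awalk_Nil_iff)
    have m: "?m = vx u * vx u" by (simp add: Nil q)
    define k' where "k' = k(u := k u + c)"
    have "cng J (x + scal c * ?m) ((\<Sum>u\<in>insert u U. scal (k' u) * tz Z u) + Lz Z (Rz Z (x + scal c * ?m)))"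
      if Z: "finite Z" "Z0 \<subseteq> Z" "Z \<subseteq> arcs G" for Z
    proof -
      have "(\<Sum>u\<in>insert u U. scal (k' u) * tz Z u) =
          scal (k' u) * tz Z u + (\<Sum>v\<in>U - {u}. scal (k' v) * tz Z v)"
        using IH(3) by (rule sum.insert_remove)
      also have "(\<Sum>v\<in>U - {u}. scal (k' v) * tz Z v) = (\<Sum>v\<in>U - {u}. scal (k v) * tz Z v)"
        by (intro sum.cong) (auto simp: k'_def)
      also have "scal (k' u) * tz Z u + (\<Sum>v\<in>U - {u}. scal (k v) * tz Z v) =
          scal c * tz Z u + (\<Sum>v\<in>U. scal (k v) * tz Z v)"
      proof (cases "u \<in> U")
        case True
        then show ?thesis using IH(3)
          by (simp add: sum.remove[of U u] k'_def scal_add distrib_right add_ac)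
      next
        case False
        then show ?thesis using IH(5) by (simp add: k'_def)
      qed
      finally have eq: "(\<Sum>u\<in>insert u U. scal (k' u) * tz Z u) + Lz Z (Rz Z (x + scal c * ?m)) =
        ((\<Sum>v\<in>U. scal (k v) * tz Z v) + Lz Z (Rz Z x)) + scal c * (tz Z u + Lz Z (Rz Z ?m))"
        by (simp add: Rz_lin Lz_lin distrib_left add_ac)
      show ?thesis unfolding eq
        using Z tz_Lz_Rz[OF u Z(1,3)] by (intro cng_add cng_scal IH7[rule_format]) (auto simp: m)
    qed
    then show ?thesis using IH u
      by (intro exI[of _ Z0] exI[of _ "insert u U"] exI[of _ k']) (auto simp: k'_def)
  next
    case (Cons f p')
    then obtain g q' where q: "q = g # q'" using add.hyps by (cases q) auto
    have fg: "f \<in> arcs G" "g \<in> arcs G" using add.hyps Cons q by (auto simp: awalk_Cons_iff)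
    have "cng J (x + scal c * ?m) ((\<Sum>u\<in>U. scal (k u) * tz Z u) + Lz Z (Rz Z (x + scal c * ?m)))"
      if Z: "finite Z" "Z0 \<union> {f, g} \<subseteq> Z" "Z \<subseteq> arcs G" for Z
    proof -
      have "cng J (Lz Z (Rz Z ?m)) (Lz Z ?m)"
        using Rz_mon[OF add.hyps(2) add.hyps(3)[unfolded q]] Z q by (intro Lz_cng) auto
      also have "cng J \<dots> ?m"
        using Lz_mon[OF add.hyps(2)[unfolded Cons] add.hyps(3)] Z Cons by auto
      finally have m: "cng J (Lz Z (Rz Z ?m)) ?m" .
      have "cng J (x + scal c * ?m)
         (((\<Sum>u\<in>U. scal (k u) * tz Z u) + Lz Z (Rz Z x)) + scal c * Lz Z (Rz Z ?m))"
        using Z by (intro cng_add cng_scal cng_sym[OF m] IH7[rule_format]) auto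
      then show ?thesis by (simp add: Rz_lin Lz_lin add_ac)
    qed
    then show ?thesis using IH(1-5) fg add.hyps Cons
      by (intro exI[of _ "Z0 \<union> {f, g}"] exI[of _ U] exI[of _ k]) auto
  qed
qed

section \<open>From ideals to closed sets\<close>

lemma cng_vertex_minus:
  assumes "finite X" "X \<subseteq> out_arcs G u" "e \<in> out_arcs G u" "e \<notin> X"
  shows "cng J (gh e * (vx u - (\<Sum>y\<in>X. ed y * gh y)) * ed e) (vx (head G e))"
proof -
  have e: "e \<in> arcs G" "tail G e = u" "u \<in> verts G" using assms(3) by auto
  have "cng J (gh e * (ed y * gh y) * ed e) 0" if "y \<in> X" for y
  proof -
    have y: "y \<in> arcs G" "y \<noteq> e" using that assms by auto
    have "cng J (gh e * ed y * (gh y * ed e)) (0 * (gh y * ed e))"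
      using e y by (intro cng_mult_right cng_CK1_orth unital_mult) auto
    then show ?thesis by (simp add: mult.assoc)
  qed
  then have "cng J (\<Sum>y\<in>X. gh e * (ed y * gh y) * ed e) (\<Sum>y\<in>X. 0)" by (rule cng_sum)
  moreover have "cng J (gh e * vx u * ed e) (vx (head G e))"
  proof -
    have "cng J (gh e * vx u * ed e) (gh e * ed e)"
      using cng_ghost_src[OF e(1)] e by (intro cng_mult_right) auto
    also have "cng J \<dots> (vx (head G e))" by (rule cng_CK1[OF e(1)])
    finally show ?thesis .
  qed
  ultimately have "cng J (gh e * vx u * ed e - (\<Sum>y\<in>X. gh e * (ed y * gh y) * ed e)) (vx (head G e) - (\<Sum>y\<in>X. 0))"
    by (intro cng_diff)
  then show ?thesis by (simp add: algebra_simps sum_distrib_left sum_distrib_right)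
qed

lemma vertex_minus_head:
  assumes "finite X" "X \<subseteq> out_arcs G u" "e \<in> out_arcs G u" "e \<notin> X"
    and in_J: "vx u - (\<Sum>y\<in>X. ed y * gh y) \<in> J"
  shows "vx (head G e) \<in> J"
proof -
  have "gh e * (vx u - (\<Sum>y\<in>X. ed y * gh y)) * ed e \<in> J"
    using in_J assms(3) by (intro lideal_mult[OF J]) auto
  then show ?thesis using cng_in[OF cng_vertex_minus[OF assms(1-4)]] by simp
qed

lemma head_in_edge_ghost:
  assumes "e \<in> arcs G" "vx (head G e) \<in> J"
  shows "ed e * gh e \<in> J"
proof -
  have "ed e * vx (head G e) * gh e \<in> J" using assms by (intro lideal_mult[OF J]) auto
  moreover have "cng J (ed e * vx (head G e) * gh e) (ed e * gh e)"
    using assms by (intro cng_mult_right cng_edge_rng) auto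
  ultimately show ?thesis using cng_in by blast
qed

text \<open>Compressing an element for \<open>v\<close> or \<open>q_X\<close> by \<open>e*\<close>
  on the left and \<open>e\<close> on the right gives \<open>r(e)\<close> for each edge
  \<open>e\<close> not subtracted. Conversely \<open>e e* = e r(e) e*\<close> restores the
  subtracted terms, and (CK2) handles regular vertices.\<close>

lemma closed_set_of_ideal: "closed_set G {g \<in> gvertices G. gelt g \<in> J}" (is "closed_set G ?H")
proof (rule closed_setI)
  fix v assume v: "is_regular G v"
  show "Proper v \<in> ?H \<longleftrightarrow> (\<forall>e\<in>out_arcs G v. Proper (head G e) \<in> ?H)"
  proof
    assume "Proper v \<in> ?H"
    then have "vx (head G e) \<in> J" if "e \<in> out_arcs G v" for e
      using vertex_minus_head[of "{}" v e] that by simp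
    then show "\<forall>e\<in>out_arcs G v. Proper (head G e) \<in> ?H" by auto
  next
    assume "\<forall>e\<in>out_arcs G v. Proper (head G e) \<in> ?H"
    then have "(\<Sum>e\<in>out_arcs G v. ed e * gh e) \<in> J"
      by (intro lideal_sum[OF J] head_in_edge_ghost) auto
    then show "Proper v \<in> ?H" using cng_in[OF cng_CK2[OF v]] v by (simp add: is_regular_def)
  qed
next
  fix v Z assume Z: "is_inf_emitter G v" "finite Z" "Z \<noteq> {}" "Z \<subseteq> out_arcs G v"
  have sum: "(\<Sum>e\<in>Z. ed e * gh e) \<in> J" if "\<forall>e\<in>Z. Proper (head G e) \<in> ?H"
    using that Z by (intro lideal_sum[OF J] head_in_edge_ghost) auto
  show "Proper v \<in> ?H \<longleftrightarrow> Improper v Z \<in> ?H \<and> (\<forall>e\<in>Z. Proper (head G e) \<in> ?H)"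
  proof
    assume v: "Proper v \<in> ?H"
    then have "vx (head G e) \<in> J" if "e \<in> Z" for e
      using vertex_minus_head[of "{}" v e] that Z by auto
    then have heads: "\<forall>e\<in>Z. Proper (head G e) \<in> ?H" using Z by auto
    then show "Improper v Z \<in> ?H \<and> (\<forall>e\<in>Z. Proper (head G e) \<in> ?H)"
      using Z v lideal_diff[OF J _ sum[OF heads], of "vx v"] by simp
  next
    assume H: "Improper v Z \<in> ?H \<and> (\<forall>e\<in>Z. Proper (head G e) \<in> ?H)"
    then show "Proper v \<in> ?H"
      using Z lideal_add[OF J _ sum, of "gelt (Improper v Z)"] by (auto simp: is_inf_emitter_def)
  qed
next
  fix v Z W assume W: "is_inf_emitter G v" "finite W" "Z \<noteq> {}" "Z \<subset> W" "W \<subseteq> out_arcs G v"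
  then have Z: "finite Z" "Z \<subseteq> out_arcs G v" "W \<noteq> {}" using finite_subset[of Z W] by auto
  have sum: "(\<Sum>e\<in>W - Z. ed e * gh e) \<in> J" if "\<forall>e\<in>W - Z. Proper (head G e) \<in> ?H"
    using that W by (intro lideal_sum[OF J] head_in_edge_ghost) auto
  have eq: "gelt (Improper v Z) = gelt (Improper v W) + (\<Sum>e\<in>W - Z. ed e * gh e :: ('a, 'b, 'k) lpoly)"
    using sum.subset_diff[OF psubset_imp_subset[OF W(4)] W(2), of "\<lambda>e. ed e * gh e :: ('a, 'b, 'k) lpoly"]
    by (simp add: algebra_simps)
  show "Improper v Z \<in> ?H \<longleftrightarrow> Improper v W \<in> ?H \<and> (\<forall>e\<in>W - Z. Proper (head G e) \<in> ?H)"
  proof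
    assume q: "Improper v Z \<in> ?H"
    then have "vx (head G e) \<in> J" if "e \<in> W - Z" for e
      using vertex_minus_head[of Z v e] that Z W by auto
    then have heads: "\<forall>e\<in>W - Z. Proper (head G e) \<in> ?H" using W by auto
    then have "gelt (Improper v Z) - (\<Sum>e\<in>W - Z. ed e * gh e) \<in> J"
      using q by (intro lideal_diff[OF J] sum) auto
    then show "Improper v W \<in> ?H \<and> (\<forall>e\<in>W - Z. Proper (head G e) \<in> ?H)"
      using W Z heads unfolding eq by simp
  next
    assume "Improper v W \<in> ?H \<and> (\<forall>e\<in>W - Z. Proper (head G e) \<in> ?H)"
    then have "gelt (Improper v Z) \<in> J" unfolding eq by (intro lideal_add[OF J] sum) auto
    then show "Improper v Z \<in> ?H" using W Z by simp
  qed
qed auto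

text \<open>Depending on \<open>u\<close>, this is a vertex, an element for some \<open>q_Y\<close>,
  or by (CK2) the sum of \<open>e e*\<close> over the edges at \<open>u\<close> outside
  \<open>Z\<close>. In the last case the heads of those edges lie in \<open>J\<close>.\<close>

lemma tz_in_generated:
  fixes J' :: "('a, 'b, 'k) lpoly set"
  assumes u: "u \<in> verts G" and Z: "finite Z" "Z \<subseteq> arcs G" and tz: "tz Z u \<in> J"
    and J': "lideal G J'" "lrels G \<subseteq> J'"
    and gen: "\<And>g. g \<in> gvertices G \<Longrightarrow> gelt g \<in> J \<Longrightarrow> gelt g \<in> J'"
    and edge: "\<And>e. e \<in> arcs G \<Longrightarrow> vx (head G e) \<in> J' \<Longrightarrow> ed e * gh e \<in> J'"
  shows "tz Z u \<in> J'"
proof -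
  define Y where "Y = {e \<in> Z. tail G e = u}"
  have Y: "finite Y" "Y \<subseteq> out_arcs G u" using Z by (auto simp: Y_def)
  have eq: "tz Z u = vx u - (\<Sum>e\<in>Y. ed e * gh e)" by (simp add: tz_def Y_def)
  consider "Y = {}" | "Y \<noteq> {}" "infinite (out_arcs G u)" | "Y \<noteq> {}" "finite (out_arcs G u)" by blast
  then show ?thesis
  proof cases
    case 1
    then show ?thesis using gen[of "Proper u"] tz u by (simp add: eq)
  next
    case 2
    then show ?thesis using gen[of "Improper u Y"] tz u Y by (simp add: eq is_inf_emitter_def)
  next
    case 3
    then have reg: "is_regular G u" using Y u by (auto simp: is_regular_def)
    have "vx u - (\<Sum>e\<in>out_arcs G u. ed e * gh e) \<in> J'"
      using J'(2) lrels.CK2[OF reg] by (auto simp: wd2 simp del: in_out_arcs_conv)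
    moreover have "(\<Sum>e\<in>out_arcs G u - Y. ed e * gh e) \<in> J'"
    proof (intro lideal_sum[OF J'(1)] edge)
      fix e assume e: "e \<in> out_arcs G u - Y"
      then have "vx (head G e) \<in> J" using vertex_minus_head[OF Y, of e] tz by (simp add: eq)
      then show "vx (head G e) \<in> J'" using gen[of "Proper (head G e)"] e by simp
    qed auto
    moreover have "(tz Z u :: ('a, 'b, 'k) lpoly) = (vx u - (\<Sum>e\<in>out_arcs G u. ed e * gh e)) + (\<Sum>e\<in>out_arcs G u - Y. ed e * gh e)"
    proof -
      have diff: "v - y = (v - a) + b" if "a = b + y" for v y a b :: "('a, 'b, 'k) lpoly"
        using that by simp
      show ?thesis unfolding eq by (rule diff[OF sum.subset_diff[OF Y(2) 3(2)]])
    qed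
    ultimately show ?thesis using lideal_add[OF J'(1)] by simp
  qed
qed

end

text \<open>The induction is on the path lengths: an element of degree \<open>n > 0\<close> is \<open>\<Sum>e (e\<^sup>* x)\<close> over finitely
  many edges, where \<open>e\<^sup>* x\<close> has shorter paths, and likewise for \<open>n < 0\<close>. In degree \<open>0\<close> there remains
  a combination of elements \<open>v - \<Sum>e e\<^sup>*\<close>.\<close>

lemma homogeneous_in_generated:
  fixes J J' :: "('a, 'b, 'k::field) lpoly set"
  assumes J: "lideal G J" "lrels G \<subseteq> J" and J': "lideal G J'" "lrels G \<subseteq> J'"
    and sub: "J' \<subseteq> J" and gen: "\<And>g. g \<in> gvertices G \<Longrightarrow> gelt g \<in> J \<Longrightarrow> gelt g \<in> J'"
  shows "x \<in> hspan G n N \<Longrightarrow> x \<in> J \<Longrightarrow> x \<in> J'"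
proof (induction N arbitrary: x n rule: less_induct)
  case (less N)
  note cong = cng_in[OF J']
  have IH: "z \<in> J'" if z: "z \<in> J" and y: "y \<in> hspan G m (N - 1)" "cng J' z y" and N: "N > 0" for z y m
  proof -
    have "z - y \<in> J" using y(2) sub by (auto simp: cng_def)
    from lideal_diff[OF J(1) z this] have "y \<in> J" by simp
    with less.IH[of "N - 1" y m] y N have "y \<in> J'" by simp
    then show ?thesis using cong[OF y(2)] by simp
  qed
  consider "n > 0" | "n < 0" | "n = 0" by linarith
  then show ?case
  proof cases
    case 1
    show ?thesis
    proof (cases "N = 0")
      case True
      \<comment> \<open>A pair of empty paths has degree 0, so no monomial of degree
        \<open>n\<close> is available.\<close>
      have "x = 0" if "x \<in> hspan G n 0"
        using that by (induction rule: hspan.induct) (use 1 in auto)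
      then show ?thesis using less.prems True lideal_0[OF J'(1)] by simp
    next
      case False
      obtain Z where Z: "finite Z" "Z \<subseteq> arcs G" "cng J' x (Lz Z x)"
        using hspan_pos_decomp[OF J' less.prems(1) 1] by blast
      have "ed e * (gh e * x) \<in> J'" if "e \<in> Z" for e
      proof -
        have e: "e \<in> arcs G" using that Z by auto
        obtain y where "y \<in> hspan G (n - 1) (N - 1)" "cng J' (gh e * x) y"
          using hspan_pos_shrink[OF J' less.prems(1) 1 e] by blast
        moreover have "gh e * x \<in> J" using e less.prems(2) by (intro lideal_mult[OF J(1)]) auto
        ultimately have "gh e * x \<in> J'" using IH False by blast
        then show ?thesis using e lideal_mult(2)[OF J'(1), of "gh e * x" "ed e"] by simp
      qed
      then have "Lz Z x \<in> J'" unfolding Lz_def by (intro lideal_sum[OF J'(1)])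
      then show ?thesis using cong[OF Z(3)] by simp
    qed
  next
    case 2
    show ?thesis
    proof (cases "N = 0")
      case True
      have "x = 0" if "x \<in> hspan G n 0"
        using that by (induction rule: hspan.induct) (use 2 in auto)
      then show ?thesis using less.prems True lideal_0[OF J'(1)] by simp
    next
      case False
      obtain Z where Z: "finite Z" "Z \<subseteq> arcs G" "cng J' x (Rz Z x)"
        using hspan_neg_decomp[OF J' less.prems(1) 2] by blast
      have "x * ed e * gh e \<in> J'" if "e \<in> Z" for e
      proof -
        have e: "e \<in> arcs G" using that Z by auto
        obtain y where "y \<in> hspan G (n + 1) (N - 1)" "cng J' (x * ed e) y"
          using hspan_neg_shrink[OF J' less.prems(1) 2 e] by blast
        moreover have "x * ed e \<in> J" using e less.prems(2) by (intro lideal_mult[OF J(1)]) auto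
        ultimately have "x * ed e \<in> J'" using IH False by blast
        then show ?thesis using e lideal_mult(1)[OF J'(1), of "x * ed e" "gh e"] by simp
      qed
      then have "Rz Z x \<in> J'" unfolding Rz_def by (intro lideal_sum[OF J'(1)])
      then show ?thesis using cong[OF Z(3)] by simp
    qed
  next
    case 3
    then have x: "x \<in> hspan G 0 N" using less.prems(1) by simp
    obtain Z U k where Z: "finite Z" "Z \<subseteq> arcs G" and U: "finite U" "U \<subseteq> verts G"
      and k: "\<forall>u. u \<notin> U \<longrightarrow> k u = 0" and N0: "N = 0 \<longrightarrow> Z = {}"
      and dec: "\<forall>Z'. finite Z' \<and> Z \<subseteq> Z' \<and> Z' \<subseteq> arcs G \<longrightarrow>
         cng J' x ((\<Sum>u\<in>U. scal (k u) * tz Z' u) + Lz Z' (Rz Z' x))"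
      using hspan_zero_decomp[OF J' x] by (elim exE conjE) (rule that)
    have exf: "gh e * x * ed f \<in> J'" if "e \<in> Z" "f \<in> Z" for e f
    proof -
      have ef: "e \<in> arcs G" "f \<in> arcs G" using that Z by auto
      have "N > 0" using N0 that by auto
      moreover obtain y where "y \<in> hspan G 0 (N - 1)" "cng J' (gh e * x * ed f) y"
        using hspan_zero_shrink[OF J' x ef] by blast
      moreover have "gh e * x * ed f \<in> J" using ef less.prems(2) by (intro lideal_mult[OF J(1)]) auto
      ultimately show ?thesis using IH by blast
    qed
    have "ed e * (gh e * x * ed f) * gh f \<in> J'" if "e \<in> Z" "f \<in> Z" for e f
    proof -
      have "gh e * x * ed f \<in> J'" "ed e \<in> unital_lalg G" "gh f \<in> unital_lalg G"
        using that Z exf by auto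
      then show ?thesis
        by (rule lideal_mult(1)[OF J'(1) lideal_mult(2)[OF J'(1)]])
    qed
    then have "(\<Sum>e\<in>Z. \<Sum>f\<in>Z. ed e * (gh e * x * ed f) * gh f) \<in> J'"
      by (intro lideal_sum[OF J'(1)])
    then have Q: "Lz Z (Rz Z x) \<in> J'"
      by (simp add: Lz_def Rz_def sum_distrib_left mult.assoc)
    define y where "y = (\<Sum>u\<in>U. scal (k u) * tz Z u)"
    have xy: "cng J' x (y + Lz Z (Rz Z x))" using dec Z by (simp add: y_def)
    have "x - (y + Lz Z (Rz Z x)) \<in> J" using xy sub by (auto simp: cng_def)
    moreover have diff: "a - (a - b) = b" "a + b - b = a" for a b :: "('a, 'b, 'k) lpoly" by simp_all
    ultimately have "y + Lz Z (Rz Z x) \<in> J" using lideal_diff[OF J(1) less.prems(2)] by metis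
    from lideal_diff[OF J(1) this subsetD[OF sub Q]] have yJ: "y \<in> J" unfolding diff(2) .
    have "scal (k w) * tz Z w \<in> J'" if w: "w \<in> U" for w
    proof (cases "k w = 0")
      case True
      then show ?thesis using lideal_0[OF J'(1)] by simp
    next
      case False
      \<comment> \<open>Modulo \<open>J\<close>, multiplying \<open>y\<close> by the vertex
        \<open>w\<close> isolates the summand at \<open>w\<close>, whose nonzero coefficient can be
        inverted.\<close>
      have tzv: "cng J (vx w * tz Z u) (if u = w then tz Z w else 0)" if u: "u \<in> U" for u
      proof -
        have uw: "u \<in> verts G" "w \<in> verts G" using U u w by auto
        have "cng J (vx w * vx u) (if u = w then vx w else 0)"
          using uw by (auto intro: cng_idem[OF J] cng_orth[OF J])
        moreover have "cng J (vx w * (\<Sum>e\<in>{e \<in> Z. tail G e = u}. ed e * gh e))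
            (\<Sum>e\<in>{e \<in> Z. tail G e = u}. (if u = w then ed e else 0) * gh e)"
          unfolding sum_distrib_left mult.assoc[symmetric]
        proof (intro cng_sum[OF J] cng_mult_right[OF J])
          fix e assume e: "e \<in> {e \<in> Z. tail G e = u}"
          then show "cng J (vx w * ed e) (if u = w then ed e else 0)"
            using cng_src_edge[OF J, of e] cng_vertex_edge_ne[OF J uw(2), of e] Z by auto
        qed (use Z in auto)
        ultimately have "cng J (vx w * vx u - vx w * (\<Sum>e\<in>{e \<in> Z. tail G e = u}. ed e * gh e))
          ((if u = w then vx w else 0) -
            (\<Sum>e\<in>{e \<in> Z. tail G e = u}. (if u = w then ed e else 0) * gh e))"
          by (rule cng_diff[OF J])
        moreover have "(vx w * tz Z u :: ('a, 'b, 'k) lpoly) = vx w * vx u - vx w * (\<Sum>e\<in>{e \<in> Z. tail G e = u}. ed e * gh e)"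
          by (simp add: tz_def algebra_simps)
        moreover have "((if u = w then vx w else 0) -
            (\<Sum>e\<in>{e \<in> Z. tail G e = u}. (if u = w then ed e else 0) * gh e) :: ('a, 'b, 'k) lpoly) =
            (if u = w then tz Z w else 0)"
          by (simp add: tz_def)
        ultimately show ?thesis by (simp only:)
      qed
      have "cng J (\<Sum>u\<in>U. scal (k u) * (vx w * tz Z u)) (\<Sum>u\<in>U. scal (k u) * (if u = w then tz Z w else 0))"
        by (intro cng_sum[OF J] cng_scal[OF J] tzv)
      moreover have "(\<Sum>u\<in>U. scal (k u) * (vx w * tz Z u)) = vx w * y"
        by (simp add: y_def sum_distrib_left scal_left_commute)
      moreover have "(\<Sum>u\<in>U. scal (k u) * (if u = w then tz Z w else 0)) = scal (k w) * tz Z w"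
        using U(1) w by (simp add: if_distrib[of "\<lambda>x. _ * x"] sum.delta cong: if_cong)
      moreover have "vx w * y \<in> J" using yJ U w by (intro lideal_mult[OF J(1)]) auto
      ultimately have "scal (k w) * tz Z w \<in> J" using cng_in[OF J] by metis
      from lideal_scal[OF J(1) this, of "inverse (k w)"] have "tz Z w \<in> J"
        using False by (simp add: mult.assoc[symmetric] scal_mult[symmetric])
      then have "tz Z w \<in> J'"
        using U w Z by (intro tz_in_generated[OF J _ _ _ _ J' gen head_in_edge_ghost[OF J']]) auto
      then show ?thesis by (rule lideal_scal[OF J'(1)])
    qed
    then have "y \<in> J'" unfolding y_def by (rule lideal_sum[OF J'(1)])
    then have "y + Lz Z (Rz Z x) \<in> J'" using Q by (rule lideal_add[OF J'(1)])
    then show ?thesis using cong[OF xy] by simp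
  qed
qed

lemma gelt_set_lcarrier: "gelt ` {g \<in> gvertices G. gelt g \<in> J} \<subseteq> lcarrier G"
  using gelt_lcarrier by auto

lemma graded_ideal_generated:
  fixes S :: "('a, 'b, 'k::field) lpoly set"
  assumes S: "S \<subseteq> (\<Union>n N. hspan G n N)"
  defines "J \<equiv> lgenideal G S"
  shows "J = lgenideal G (gelt ` {g \<in> gvertices G. gelt g \<in> J})"
    and "closed_set G {g \<in> gvertices G. gelt g \<in> J}"
proof -
  let ?J' = "lgenideal G (gelt ` {g \<in> gvertices G. gelt g \<in> J}) :: ('a, 'b, 'k) lpoly set"
  have "S \<subseteq> lcarrier G" using S hspan_lcarrier by auto
  then have J: "lideal G J" unfolding J_def by (rule lgenideal_ideal)
  have JR: "lrels G \<subseteq> J" and SJ: "S \<subseteq> J" unfolding J_def using lgenideal_incl[of G S] by auto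
  show "closed_set G {g \<in> gvertices G. gelt g \<in> J}" by (rule closed_set_of_ideal[OF J JR])
  have J': "lideal G ?J'" by (rule lgenideal_ideal[OF gelt_set_lcarrier])
  have J'R: "lrels G \<union> gelt ` {g \<in> gvertices G. gelt g \<in> J} \<subseteq> ?J'" by (rule lgenideal_incl)
  have sub: "?J' \<subseteq> J" using JR by (intro lgenideal_least[OF J]) auto
  have "S \<subseteq> ?J'"
  proof
    fix x assume "x \<in> S"
    then obtain n N where "x \<in> hspan G n N" "x \<in> J" using S SJ by blast
    moreover have "lrels G \<subseteq> ?J'" using J'R by (rule le_supE)
    moreover have "gelt g \<in> ?J'" if "g \<in> gvertices G" "gelt g \<in> J" for g
      using J'R that by (intro subsetD[OF J'R] UnI2 imageI CollectI conjI)
    ultimately show "x \<in> ?J'" using homogeneous_in_generated[OF J JR J' _ sub] by blast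
  qed
  then have "J \<subseteq> ?J'" using J'R unfolding J_def by (intro lgenideal_least[OF J'[unfolded J_def]]) auto
  with sub show "J = ?J'" by auto
qed

end

section \<open>The representation on boundary paths\<close>

text \<open>A boundary path outside \<open>H\<close> is either an infinite path or a finite path to a terminal vertex \<open>w\<close>,
  encoded as the sequence of its edges followed by the constant \<open>Inl w\<close>.\<close>

primrec src :: "('v, 'e) pre_digraph \<Rightarrow> 'v + 'e \<Rightarrow> 'v" where
  "src E (Inl w) = w"
| "src E (Inr e) = tail E e"

definition bpath :: "('v, 'e) pre_digraph \<Rightarrow> ('v, 'e) gvertex set \<Rightarrow> (nat \<Rightarrow> 'v + 'e) \<Rightarrow> bool" where
  "bpath E H p \<longleftrightarrow> (\<forall>i. case p i of Inl w \<Rightarrow> terminal E H w \<and> p (Suc i) = Inl w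
     | Inr e \<Rightarrow> e \<in> arcs E \<and> Proper (head E e) \<notin> H \<and> src E (p (Suc i)) = head E e)"

text \<open>The generators act on functions of boundary paths from the right.\<close>

fun lop :: "('v, 'e) pre_digraph \<Rightarrow> ('v, 'e) gvertex set \<Rightarrow> ('v, 'e) lgen \<Rightarrow>
    ((nat \<Rightarrow> 'v + 'e) \<Rightarrow> 'k::field) \<Rightarrow> (nat \<Rightarrow> 'v + 'e) \<Rightarrow> 'k" where
  "lop E H (Vertex v) \<phi> p = (if bpath E H p \<and> src E (p 0) = v then \<phi> p else 0)"
| "lop E H (Edge e) \<phi> p =
     (if bpath E H p \<and> src E (p 0) = head E e \<and> e \<in> arcs E then \<phi> (case_nat (Inr e) p) else 0)"
| "lop E H (Ghost e) \<phi> p = (if bpath E H p \<and> p 0 = Inr e then \<phi> (p \<circ> Suc) else 0)"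

text \<open>\<open>fold\<close> lets the first letter act first, as befits a right action.\<close>

definition lops :: "('v, 'e) pre_digraph \<Rightarrow> ('v, 'e) gvertex set \<Rightarrow> ('v, 'e) lgen list \<Rightarrow>
    ((nat \<Rightarrow> 'v + 'e) \<Rightarrow> 'k::field) \<Rightarrow> (nat \<Rightarrow> 'v + 'e) \<Rightarrow> 'k" where
  "lops E H xs \<phi> = fold (lop E H) xs \<phi>"

definition lrep :: "('v, 'e) pre_digraph \<Rightarrow> ('v, 'e) gvertex set \<Rightarrow>
    ((nat \<Rightarrow> 'v + 'e) \<Rightarrow> 'k::field) \<Rightarrow> ('v, 'e, 'k) lpoly \<Rightarrow> (nat \<Rightarrow> 'v + 'e) \<Rightarrow> 'k" where
  "lrep E H \<phi> f p = (\<Sum>w\<in>Poly_Mapping.keys f. Poly_Mapping.lookup f w * lops E H (letters w) \<phi> p)"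

section \<open>Linearity and multiplicativity of the action\<close>

lemma lop_lin: "lop E H x (\<lambda>p. a p + k * b p) = (\<lambda>p. lop E H x a p + k * lop E H x b p)"
  by (cases x) (auto simp: fun_eq_iff)

lemma lop_0: "lop E H x (\<lambda>p. 0) = (\<lambda>p. 0)"
  by (cases x) (auto simp: fun_eq_iff)

lemma lops_lin: "lops E H xs (\<lambda>p. a p + k * b p) = (\<lambda>p. lops E H xs a p + k * lops E H xs b p)"
  by (induction xs arbitrary: a b) (simp_all add: lops_def lop_lin)

lemma lops_0: "lops E H xs (\<lambda>p. 0) = (\<lambda>p. 0)"
  by (induction xs) (simp_all add: lops_def lop_0)

lemma lops_append: "lops E H (xs @ ys) \<phi> = lops E H ys (lops E H xs \<phi>)"
  by (simp add: lops_def)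

lemma lrep_superset:
  assumes "finite A" "Poly_Mapping.keys f \<subseteq> A"
  shows "lrep E H \<phi> f p = (\<Sum>w\<in>A. Poly_Mapping.lookup f w * lops E H (letters w) \<phi> p)"
  unfolding lrep_def using assms by (intro sum.mono_neutral_left) (auto simp: in_keys_iff)

lemma lrep_0 [simp]: "lrep E H \<phi> 0 p = 0"
  by (simp add: lrep_def)

lemma lrep_add: "lrep E H \<phi> (f + g) p = lrep E H \<phi> f p + lrep E H \<phi> g p"
proof -
  let ?A = "Poly_Mapping.keys f \<union> Poly_Mapping.keys g"
  have "finite ?A" "Poly_Mapping.keys (f + g) \<subseteq> ?A" by (auto dest: subsetD[OF keys_add])
  then show ?thesis
    by (simp add: lrep_superset[of ?A] lookup_add distrib_right sum.distrib)
qed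

lemma lrep_single: "lrep E H \<phi> (scal k * wd xs) p = k * lops E H xs \<phi> p"
proof -
  have "scal k * wd xs = Poly_Mapping.single (Word xs) k"
    by (simp add: scal_def wd_def mult_single)
  then show ?thesis by (simp add: lrep_superset[of "{Word xs}"])
qed

lemma lrep_wd: "lrep E H \<phi> (wd xs) p = lops E H xs \<phi> p"
  using lrep_single[of E H \<phi> 1 xs p] by simp

lemma lrep_scal: "lrep E H \<phi> (scal k * f) p = k * lrep E H \<phi> f p"
proof (induction f rule: lpoly_induct)
  case (add f c xs)
  then show ?case
    by (simp only: distrib_left lrep_add mult.assoc[symmetric] scal_mult[symmetric] lrep_single)
qed simp

lemma lrep_diff: "lrep E H \<phi> (f - g) p = lrep E H \<phi> f p - lrep E H \<phi> g p"
  using lrep_add[of E H \<phi> f "scal (- 1) * g" p] unfolding lrep_scal by (simp add: scal_minus_1)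

lemma lrep_sum: "lrep E H \<phi> (sum f A) p = (\<Sum>x\<in>A. lrep E H \<phi> (f x) p)"
  by (induction A rule: infinite_finite_induct) (auto simp: lrep_add)

lemma lrep_mult_wd: "lrep E H \<phi> (f * wd ys) p = lops E H ys (lrep E H \<phi> f) p"
proof (induction f rule: lpoly_induct)
  case zero
  have "lrep E H \<phi> 0 = (\<lambda>p. 0)" by (simp add: fun_eq_iff)
  then show ?case by (simp add: lops_0)
next
  case (add f k xs)
  have "lrep E H \<phi> (f + scal k * wd xs) = (\<lambda>p. lrep E H \<phi> f p + k * lops E H xs \<phi> p)"
    by (simp add: fun_eq_iff lrep_add lrep_single)
  then have "lops E H ys (lrep E H \<phi> (f + scal k * wd xs)) p =
      lops E H ys (lrep E H \<phi> f) p + k * lops E H ys (lops E H xs \<phi>) p"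
    by (simp add: lops_lin)
  moreover have "(f + scal k * wd xs) * wd ys = f * wd ys + scal k * wd (xs @ ys)"
    by (simp add: wd_append distrib_right mult.assoc)
  then have "lrep E H \<phi> ((f + scal k * wd xs) * wd ys) p =
      lops E H ys (lrep E H \<phi> f) p + k * lops E H ys (lops E H xs \<phi>) p"
    by (simp only: lrep_add lrep_single lops_append add)
  ultimately show ?case by (simp only:)
qed

lemma lrep_mult: "lrep E H \<phi> (f * g) p = lrep E H (lrep E H \<phi> f) g p"
proof (induction g rule: lpoly_induct)
  case (add g k ys)
  have "f * (g + scal k * wd ys) = f * g + scal k * (f * wd ys)"
    by (simp add: distrib_left scal_left_commute)
  then have "lrep E H \<phi> (f * (g + scal k * wd ys)) p =
      lrep E H \<phi> (f * g) p + k * lops E H ys (lrep E H \<phi> f) p"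
    by (simp only: lrep_add lrep_scal lrep_mult_wd)
  moreover have "lrep E H (lrep E H \<phi> f) (g + scal k * wd ys) p =
      lrep E H (lrep E H \<phi> f) g p + k * lops E H ys (lrep E H \<phi> f) p"
    by (simp only: lrep_add lrep_single)
  ultimately show ?case by (simp only: add)
qed simp

lemma lrep_zero_fun: "lrep E H (\<lambda>p. 0) f p = 0"
  by (simp add: lrep_def lops_0)

definition lkernel :: "('v, 'e) pre_digraph \<Rightarrow> ('v, 'e) gvertex set \<Rightarrow> ('v, 'e, 'k::field) lpoly set" where
  "lkernel E H = {f \<in> lcarrier E. \<forall>\<phi> p. lrep E H \<phi> f p = 0}"

text \<open>Quantifying over all functions makes the kernel two-sided: a factor acting before
  \<open>f\<close> only replaces one function by another.\<close>

lemma lkernel_ideal: "lideal E (lkernel E H)"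
proof -
  have zero: "lrep E H \<phi> f = (\<lambda>p. 0)" if "f \<in> lkernel E H" for \<phi> :: "(nat \<Rightarrow> 'a + 'b) \<Rightarrow> 'c" and f
    using that by (simp add: lkernel_def fun_eq_iff)
  show ?thesis
    unfolding lideal_iff
  proof (intro conjI ballI allI)
    show "lkernel E H \<subseteq> lcarrier E" by (auto simp: lkernel_def)
    show "0 \<in> lkernel E H" by (simp add: lkernel_def)
    show "f + g \<in> lkernel E H" if "f \<in> lkernel E H" "g \<in> lkernel E H" for f g :: "('a, 'b, 'c) lpoly"
      using that by (simp add: lkernel_def lrep_add lcarrier_add)
    show "scal k * f \<in> lkernel E H" if "f \<in> lkernel E H" for k and f :: "('a, 'b, 'c) lpoly"
      using that by (simp add: lkernel_def lrep_scal lcarrier_scal)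
    show "f * g \<in> lkernel E H" "g * f \<in> lkernel E H" if "f \<in> lkernel E H" "g \<in> lcarrier E"
      for f g :: "('a, 'b, 'c) lpoly"
    proof -
      have f: "f \<in> lcarrier E" using that by (simp add: lkernel_def)
      then have "f * g \<in> lcarrier E" "g * f \<in> lcarrier E"
        using that(2) by (simp_all add: lcarrier_mult_unital lcarrier_unital)
      moreover have "lrep E H \<phi> (f * g) p = 0" "lrep E H \<phi> (g * f) p = 0" for \<phi> p
        using zero[OF that(1)] by (simp_all add: lrep_mult lrep_zero_fun)
      ultimately show "f * g \<in> lkernel E H" "g * f \<in> lkernel E H" by (simp_all add: lkernel_def)
    qed
  qed
qed

section \<open>The kernel of the representation outside a closed set\<close>

context wf_digraph
begin

context
  fixes H :: "('a, 'b) gvertex set"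
  assumes H: "closed_set G H"
begin

lemma bpath_Inl: "bpath G H p \<Longrightarrow> p i = Inl w \<Longrightarrow> terminal G H w \<and> p (Suc i) = Inl w"
  unfolding bpath_def by (drule spec[of _ i]) simp

lemma bpath_Inr:
  "bpath G H p \<Longrightarrow> p i = Inr e \<Longrightarrow>
     e \<in> arcs G \<and> Proper (head G e) \<notin> H \<and> src G (p (Suc i)) = head G e"
  unfolding bpath_def by (drule spec[of _ i]) simp

lemma bpath_Suc: "bpath G H p \<Longrightarrow> bpath G H (p \<circ> Suc)"
  unfolding bpath_def comp_def by blast

lemma bpath_src:
  assumes "bpath G H p"
  shows "src G (p 0) \<in> verts G" "Proper (src G (p 0)) \<notin> H"
proof -
  have "src G (p 0) \<in> verts G \<and> Proper (src G (p 0)) \<notin> H"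
  proof (cases "p 0")
    case (Inl w)
    then show ?thesis using bpath_Inl[OF assms Inl] by (simp add: terminal_def)
  next
    case (Inr e)
    then show ?thesis using bpath_Inr[OF assms Inr] closed_set_tail[OF H] by auto
  qed
  then show "src G (p 0) \<in> verts G" "Proper (src G (p 0)) \<notin> H" by auto
qed

lemma bpath_Cons:
  assumes "bpath G H p" "src G (p 0) = head G e" "e \<in> arcs G"
  shows "bpath G H (case_nat (Inr e) p)"
  unfolding bpath_def
proof
  fix i
  show "case (case i of 0 \<Rightarrow> Inr e | Suc j \<Rightarrow> p j) of
      Inl w \<Rightarrow> terminal G H w \<and> (case Suc i of 0 \<Rightarrow> Inr e | Suc j \<Rightarrow> p j) = Inl w
    | Inr ea \<Rightarrow> ea \<in> arcs G \<and> Proper (head G ea) \<notin> H \<and>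
        src G (case Suc i of 0 \<Rightarrow> Inr e | Suc j \<Rightarrow> p j) = head G ea"
  proof (cases i)
    case 0
    then show ?thesis using assms bpath_src[OF assms(1)] by simp
  next
    case (Suc j)
    then show ?thesis using bpath_Inl[OF assms(1), of j] bpath_Inr[OF assms(1), of j]
      by (cases "p j") auto
  qed
qed

lemma case_nat_tl: "p 0 = x \<Longrightarrow> case_nat x (p \<circ> Suc) = p"
  by (auto simp: fun_eq_iff split: nat.splits)

lemma lops_edge_ghost:
  "lops G H [Edge e, Ghost e] \<phi> p = (if bpath G H p \<and> p 0 = Inr e then \<phi> p else 0)"
  using bpath_Suc[of p] bpath_Inr[of p 0 e] by (auto simp: lops_def case_nat_tl)

lemma lops_ghost_edge:
  "e \<in> arcs G \<Longrightarrow> lops G H [Ghost f, Edge e] \<phi> p =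
     (if bpath G H p \<and> src G (p 0) = head G e \<and> e = f then \<phi> p else 0)"
  using bpath_Cons[of p e] by (auto simp: lops_def comp_def)

lemma lrels_lkernel: "lrels G \<subseteq> lkernel G H"
proof
  fix f :: "('a, 'b, 'c::field) lpoly" assume f: "f \<in> lrels G"
  have "lrep G H \<phi> f p = 0" for \<phi> p
    using f
  proof (cases rule: lrels.cases)
    case (orth v w)
    then show ?thesis by (auto simp: lrep_wd lops_def)
  next
    case (idem v)
    then show ?thesis by (auto simp: lrep_wd lrep_diff lops_def)
  next
    case (src_edge e)
    then show ?thesis using bpath_Cons[of p e] by (auto simp: lrep_wd lrep_diff lops_def)
  next
    case (edge_rng e)
    then show ?thesis by (auto simp: lrep_wd lrep_diff lops_def)
  next
    case (rng_ghost e)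
    then show ?thesis using bpath_Suc[of p] bpath_Inr[of p 0 e]
      by (auto simp: lrep_wd lrep_diff lops_def)
  next
    case (ghost_src e)
    then show ?thesis by (auto simp: lrep_wd lrep_diff lops_def)
  next
    case (CK1_orth e f)
    then show ?thesis by (simp add: lrep_wd lops_ghost_edge)
  next
    case (CK1 e)
    then show ?thesis by (simp add: lrep_wd lrep_diff lops_ghost_edge) (simp add: lops_def)
  next
    case (CK2 v)
    have "lrep G H \<phi> (\<Sum>e\<in>out_arcs G v. wd [Edge e, Ghost e]) p =
       (\<Sum>e\<in>out_arcs G v. if bpath G H p \<and> p 0 = Inr e then \<phi> p else 0)"
      by (simp only: lrep_sum lrep_wd lops_edge_ghost)
    also have "\<dots> = (if bpath G H p \<and> src G (p 0) = v then \<phi> p else 0)"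
    proof (cases "bpath G H p \<and> src G (p 0) = v")
      case True
      \<comment> \<open>A boundary path cannot stop at a regular vertex, so exactly one summand of
        (CK2) sees it.\<close>
      then obtain e where e: "p 0 = Inr e" "e \<in> out_arcs G v"
        using bpath_Inl[of p 0] bpath_Inr[of p 0] CK2(2) by (cases "p 0") (auto simp: terminal_def)
      have "finite (out_arcs G v)" using CK2(2) by (simp add: is_regular_def)
      moreover have "(\<Sum>e'\<in>out_arcs G v. if bpath G H p \<and> p 0 = Inr e' then \<phi> p else 0) =
          (\<Sum>e'\<in>out_arcs G v. if e' = e then \<phi> p else 0)"
        using True e by (intro sum.cong) auto
      ultimately show ?thesis using True e(2) by (simp del: in_out_arcs_conv)
    next
      case False
      have "(\<Sum>e\<in>out_arcs G v. if bpath G H p \<and> p 0 = Inr e then \<phi> p else 0) = 0"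
        by (intro sum.neutral) (use False in auto)
      then show ?thesis unfolding if_not_P[OF False] .
    qed
    finally show ?thesis using CK2(1) by (simp add: lrep_diff lrep_wd lops_def)
  qed
  then show "f \<in> lkernel G H" using f lrels_lcarrier by (auto simp: lkernel_def)
qed

text \<open>Since \<open>e e*\<close> projects to the boundary paths that begin with
  \<open>e\<close>, \<open>q_Z\<close> projects to those from \<open>v\<close> that do not begin in
  \<open>Z\<close>.\<close>

lemma lrep_gelt_Improper:
  fixes \<phi> :: "(nat \<Rightarrow> 'a + 'b) \<Rightarrow> 'k::field"
  assumes "finite Z" "Z \<subseteq> out_arcs G v"
  shows "lrep G H \<phi> (gelt (Improper v Z)) p =
    (if bpath G H p \<and> src G (p 0) = v \<and> p 0 \<notin> Inr ` Z then \<phi> p else 0)"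
proof -
  have eg: "(ed e * gh e :: ('a, 'b, 'k) lpoly) = wd [Edge e, Ghost e]" for e
    by (simp flip: wd_append)
  have "lrep G H \<phi> (\<Sum>e\<in>Z. ed e * gh e) p = (\<Sum>e\<in>Z. if bpath G H p \<and> p 0 = Inr e then \<phi> p else 0)"
    by (simp only: eg lrep_sum lrep_wd lops_edge_ghost)
  also have "\<dots> = (if bpath G H p \<and> p 0 \<in> Inr ` Z then \<phi> p else 0)"
  proof (cases "bpath G H p \<and> p 0 \<in> Inr ` Z")
    case True
    then obtain e where e: "p 0 = Inr e" "e \<in> Z" by auto
    have "(\<Sum>e'\<in>Z. if bpath G H p \<and> p 0 = Inr e' then \<phi> p else 0) = (\<Sum>e'\<in>Z. if e' = e then \<phi> p else 0)"
      using True e by (intro sum.cong) auto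
    then show ?thesis using True e(2) assms(1) by simp
  next
    case False
    then have "(\<Sum>e\<in>Z. if bpath G H p \<and> p 0 = Inr e then \<phi> p else 0) = 0"
      by (intro sum.neutral) auto
    then show ?thesis unfolding if_not_P[OF False] .
  qed
  finally have "lrep G H \<phi> (gelt (Improper v Z)) p =
     (if bpath G H p \<and> src G (p 0) = v then \<phi> p else 0) - (if bpath G H p \<and> p 0 \<in> Inr ` Z then \<phi> p else 0)"
    by (simp add: lrep_diff lrep_wd lops_def)
  then show ?thesis using assms(2) by (auto split: if_splits)
qed

text \<open>Boundary paths never visit a vertex in \<open>H\<close>. If \<open>q_Z\<close> is in
  \<open>H\<close>, then \<open>v\<close> is not terminal and every edge outside \<open>Z\<close>
  leads into \<open>H\<close>, so nothing is left for the projection.\<close>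

lemma gelt_lkernel:
  assumes g: "g \<in> H"
  shows "(gelt g :: ('a, 'b, 'k::field) lpoly) \<in> lkernel G H"
proof -
  have gv: "g \<in> gvertices G" using g closed_set_subset[OF H] by auto
  have "lrep G H \<phi> (gelt g) p = 0" for \<phi> :: "(nat \<Rightarrow> 'a + 'b) \<Rightarrow> 'k" and p
  proof (cases g)
    case (Proper v)
    then show ?thesis using bpath_src[of p] g by (auto simp: lrep_wd lops_def)
  next
    case (Improper v Z)
    have Z: "is_inf_emitter G v" "finite Z" "Z \<noteq> {}" "Z \<subseteq> out_arcs G v" using gv Improper by auto
    have "p 0 \<in> Inr ` Z" if p: "bpath G H p" "src G (p 0) = v"
    proof (cases "p 0")
      case (Inl w)
      then have "terminal G H v" using bpath_Inl[OF p(1) Inl] p by simp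
      then show ?thesis using g Improper by (simp add: terminal_def)
    next
      case (Inr e)
      then have "e \<in> out_arcs G v" "Proper (head G e) \<notin> H" using bpath_Inr[OF p(1) Inr] p by auto
      then have "e \<in> Z" using out_mod_notin[OF H gv, of e] g Improper by auto
      then show ?thesis using Inr by simp
    qed
    then show ?thesis unfolding Improper lrep_gelt_Improper[OF Z(2,4)] by auto
  qed
  then show ?thesis using gelt_lcarrier[OF gv] by (simp add: lkernel_def)
qed

text \<open>Edges outside \<open>H\<close> are followed until a terminal vertex, if any, is met. The
  last clause yields a path at a terminal \<open>v\<close> that avoids every
  \<open>Z\<close>.\<close>

lemma bpath_exists:
  assumes v: "v \<in> verts G" "Proper v \<notin> H"
  obtains p where "bpath G H p" "src G (p 0) = v" "terminal G H v \<Longrightarrow> p 0 = Inl v"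
proof -
  define e where "e w = (SOME e. e \<in> out_mod G H (Proper w))" for w
  have e: "e w \<in> out_mod G H (Proper w)" if "w \<in> verts G" "Proper w \<notin> H" "\<not> terminal G H w" for w
  proof -
    have "out_mod G H (Proper w) \<noteq> {}"
      using out_mod_nonterminal(2)[OF H, of "Proper w"] that by (simp del: out_mod.simps)
    then show ?thesis unfolding e_def by (simp add: some_in_eq del: out_mod.simps)
  qed
  define st where "st i = ((\<lambda>w. if terminal G H w then w else head G (e w)) ^^ i) v" for i
  have st: "st i \<in> verts G \<and> Proper (st i) \<notin> H" for i
  proof (induction i)
    case 0
    then show ?case using v by (simp add: st_def)
  next
    case (Suc i)
    have "st (Suc i) = (if terminal G H (st i) then st i else head G (e (st i)))" by (simp add: st_def)
    then show ?case using Suc e[of "st i"] by auto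
  qed
  define p where "p i = (if terminal G H (st i) then Inl (st i) else Inr (e (st i)))" for i
  have src: "src G (p i) = st i" for i using e[of "st i"] st[of i] by (simp add: p_def)
  have "bpath G H p"
    unfolding bpath_def
  proof
    fix i
    have "st (Suc i) = (if terminal G H (st i) then st i else head G (e (st i)))" by (simp add: st_def)
    then show "case p i of Inl w \<Rightarrow> terminal G H w \<and> p (Suc i) = Inl w
     | Inr e \<Rightarrow> e \<in> arcs G \<and> Proper (head G e) \<notin> H \<and> src G (p (Suc i)) = head G e"
      using e[of "st i"] st[of i] src[of "Suc i"] by (cases "terminal G H (st i)") (auto simp: p_def)
  qed
  then show thesis using src[of 0] that by (auto simp: p_def st_def)
qed

text \<open>The constant function 1 is not annihilated: some boundary path from \<open>v\<close>
  survives, and for \<open>q_Z\<close> it can be chosen to stop at once or to begin with an edge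
  outside \<open>Z\<close>.\<close>

lemma gelt_notin_lkernel:
  assumes g: "g \<in> gvertices G" "g \<notin> H"
  shows "(gelt g :: ('a, 'b, 'k::field) lpoly) \<notin> lkernel G H"
proof -
  have "\<exists>p. lrep G H (\<lambda>_. 1 :: 'k) (gelt g) p \<noteq> 0"
  proof (cases g)
    case (Proper v)
    then obtain p where "bpath G H p" "src G (p 0) = v" using bpath_exists[of v] g by auto
    then show ?thesis using Proper by (intro exI[of _ p]) (simp add: lrep_wd lops_def)
  next
    case (Improper v Z)
    have Z: "finite Z" "Z \<subseteq> out_arcs G v" using g(1) Improper by auto
    have v: "v \<in> verts G" "Proper v \<notin> H"
      using gbase_notin[OF H g] gbase_in_verts[OF g(1)] Improper by auto
    obtain p where "bpath G H p" "src G (p 0) = v" "p 0 \<notin> Inr ` Z"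
    proof (cases "terminal G H v")
      case True
      then show ?thesis using that bpath_exists[OF v] by (metis Inl_Inr_False image_iff)
    next
      case False
      then obtain e where e: "e \<in> out_mod G H g" using out_mod_nonterminal(2)[OF H g] Improper by auto
      then have e': "e \<in> arcs G" "tail G e = v" "e \<notin> Z" using Improper by auto
      obtain p where p: "bpath G H p" "src G (p 0) = head G e"
        using bpath_exists[of "head G e"] out_mod_head[OF e] by auto
      show ?thesis using that[of "case_nat (Inr e) p"] bpath_Cons[OF p e'(1)] e' by auto
    qed
    then show ?thesis unfolding Improper lrep_gelt_Improper[OF Z] by auto
  qed
  then show ?thesis unfolding lkernel_def by blast
qed

text \<open>The kernel contains the generated ideal but none of the generators outside
  \<open>H\<close>. This is what makes \<open>H\<close> recoverable from its ideal.\<close>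

lemma gelt_lgenideal_iff:
  assumes "g \<in> gvertices G"
  shows "(gelt g :: ('a, 'b, 'k::field) lpoly) \<in> lgenideal G (gelt ` H) \<longleftrightarrow> g \<in> H"
proof
  have "lgenideal G (gelt ` H) \<subseteq> (lkernel G H :: ('a, 'b, 'k) lpoly set)"
    using lrels_lkernel gelt_lkernel by (intro lgenideal_least lkernel_ideal) auto
  then show "g \<in> H" if "(gelt g :: ('a, 'b, 'k) lpoly) \<in> lgenideal G (gelt ` H)"
    using gelt_notin_lkernel[OF assms] that by blast
next
  show "(gelt g :: ('a, 'b, 'k) lpoly) \<in> lgenideal G (gelt ` H)" if "g \<in> H"
    using that lgenideal_incl[of G "gelt ` H"] by auto
qed

end
end

section \<open>The lattice of graded ideals\<close>

context wf_digraph
begin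

lemma lcomponent_lclass:
  assumes "x \<in> lcomponent K G n"
  shows "\<exists>f\<in>(\<Union>N. hspan G n N). x = lclass f"
proof -
  let ?U = "lclass ` (\<Union>N. hspan G n N)"
  have "alg_subspace (leavitt_algebra K G) ?U"
    unfolding alg_subspace_def carrier_leavitt azero_leavitt
  proof (intro conjI ballI allI)
    show "?U \<subseteq> lclass ` lcarrier G" using hspan_lcarrier by auto
    show "lclass 0 \<in> ?U" using hspan.zero by blast
    show "aadd (leavitt_algebra K G) x y \<in> ?U" if xy: "x \<in> ?U" "y \<in> ?U" for x y
    proof -
      obtain f g N M where f: "x = lclass f" "f \<in> hspan G n N" "y = lclass g" "g \<in> hspan G n M"
        using xy by auto
      then have "f + g \<in> hspan G n (max N M)"
        using hspan_mono[of f G n N "max N M"] hspan_mono[of g G n M "max N M"] by (simp add: hspan_add)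
      then show ?thesis using f by (auto simp: aadd_leavitt hspan_lcarrier)
    qed
    show "asmult (leavitt_algebra K G) k x \<in> ?U" if x: "x \<in> ?U" for k x
    proof -
      obtain f N where f: "x = lclass f" "f \<in> hspan G n N" using x by auto
      then show ?thesis using hspan_scal[OF f(2), of k] by (auto simp: asmult_leavitt hspan_lcarrier)
    qed
  qed
  moreover have "{lcong G `` {wd (path_word u p @ ghost_word u' q)} | u p u' q w.
          awalk u p w \<and> awalk u' q w \<and> int (length p) - int (length q) = n} \<subseteq> ?U"
  proof safe
    fix u p u' q w
    assume *: "awalk u p w" "awalk u' q w" "n = int (length p) - int (length q)"
    then have "pw u p * gw u' q \<in> hspan G n (max (length p) (length q))"
      by (intro hspan_gen) auto
    moreover have "lcong G `` {wd (path_word u p @ ghost_word u' q)} = lclass (pw u p * gw u' q)"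
      by (simp add: lclass_def pw_def gw_def wd_append)
    ultimately show "lcong G `` {wd (path_word u p @ ghost_word u' q)} \<in>
        lclass ` (\<Union>N. hspan G (int (length p) - int (length q)) N)"
      using *(3) by blast
  qed
  ultimately have "lcomponent K G n \<subseteq> ?U"
    unfolding lcomponent_def alg_span_def by (intro Inter_lower) auto
  then show ?thesis using assms by blast
qed

lemma lclass_gelt_lcomponent:
  fixes K :: "'k::field itself"
  assumes g: "g \<in> gvertices G"
  shows "lclass (gelt g :: ('a, 'b, 'k) lpoly) \<in> lcomponent K G 0"
  unfolding lcomponent_def alg_span_def
proof (intro InterI, elim CollectE conjE)
  fix U :: "('a, 'b, 'k) lpoly set set"
  assume U: "alg_subspace (leavitt_algebra K G) U"
    and sub: "{lcong G `` {wd (path_word u p @ ghost_word u' q)} | u p u' q w.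
          awalk u p w \<and> awalk u' q w \<and> int (length p) - int (length q) = 0} \<subseteq> U"
  have gen: "lclass (pw u p * gw u' q) \<in> U"
    if "awalk u p w" "awalk u' q w" "int (length p) - int (length q) = 0" for u p u' q w
  proof -
    have "lcong G `` {wd (path_word u p @ ghost_word u' q)} \<in> U"
      using that by (intro subsetD[OF sub] CollectI exI conjI) (rule HOL.refl | assumption)+
    then show ?thesis by (simp add: lclass_def pw_def gw_def wd_append)
  qed
  have add: "lclass (f + g) \<in> U" if "f \<in> lcarrier G" "g \<in> lcarrier G" "lclass f \<in> U" "lclass g \<in> U" for f g
  proof -
    have "aadd (leavitt_algebra K G) (lclass f) (lclass g) \<in> U"
      using U that(3,4) by (simp add: alg_subspace_def)
    then show ?thesis using that(1,2) by (simp add: aadd_leavitt)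
  qed
  have scal: "lclass (scal k * f) \<in> U" if "f \<in> lcarrier G" "lclass f \<in> U" for f k
  proof -
    have "asmult (leavitt_algebra K G) k (lclass f) \<in> U"
      using U that(2) by (simp add: alg_subspace_def)
    then show ?thesis using that(1) by (simp add: asmult_leavitt)
  qed
  \<comment> \<open>Two empty paths at \<open>v\<close> give the word \<open>v v\<close>, which
    equals \<open>v\<close> only modulo the relations.\<close>
  have vertex: "lclass (vx v) \<in> U" if v: "v \<in> verts G" for v
  proof -
    have "cng lrel_ideal (vx v * vx v :: ('a, 'b, 'k) lpoly) (vx v)"
      using v lgenideal_incl[of G "{}"] by (intro cng_idem[OF lrel_ideal]) auto
    then have "lclass (vx v * vx v :: ('a, 'b, 'k) lpoly) = lclass (vx v)"
      using v by (subst lclass_eq_iff) (auto simp: cng_def intro!: lcarrier_mult_unital)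
    moreover have "lclass (vx v * vx v) \<in> U"
      using gen[of v "[]" v v "[]"] v by (simp add: awalk_Nil_iff)
    ultimately show ?thesis by simp
  qed
  have edge: "lclass (ed e * gh e) \<in> U" if e: "e \<in> arcs G" for e
    using gen[of "tail G e" "[e]" "head G e" "tail G e" "[e]"] arc_implies_awalk[OF e]
    by (simp add: pw_def gw_def path_word_def ghost_word_def)
  show "lclass (gelt g :: ('a, 'b, 'k) lpoly) \<in> U"
  proof (cases g)
    case (Proper v)
    then show ?thesis using g vertex by simp
  next
    case (Improper v Z)
    have car: "(ed e * gh e :: ('a, 'b, 'k) lpoly) \<in> lcarrier G" if "e \<in> arcs G" for e
      using that by (intro lcarrier_mult_unital) auto
    have "lclass (\<Sum>e\<in>Z. ed e * gh e) \<in> U \<and> (\<Sum>e\<in>Z. ed e * gh e :: ('a, 'b, 'k) lpoly) \<in> lcarrier G"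
      if "finite Z" "Z \<subseteq> arcs G"
      using that
    proof (induction Z rule: finite_induct)
      case empty
      then show ?case using U by (simp add: alg_subspace_def azero_leavitt)
    next
      case (insert e Z)
      then show ?case using add[of "ed e * gh e" "\<Sum>e\<in>Z. ed e * gh e"] edge car
        by (auto intro!: lcarrier_add)
    qed
    moreover have "finite Z" "Z \<subseteq> arcs G" and v: "v \<in> verts G"
      using g Improper by (auto simp: is_inf_emitter_def)
    ultimately have s: "lclass (\<Sum>e\<in>Z. ed e * gh e) \<in> U" "(\<Sum>e\<in>Z. ed e * gh e :: ('a, 'b, 'k) lpoly) \<in> lcarrier G"
      by blast+
    have "lclass (vx v + scal (- 1) * (\<Sum>e\<in>Z. ed e * gh e)) \<in> U"
      using v by (intro add scal s vertex lcarrier_scal) auto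
    then show ?thesis using Improper by (simp add: scal_minus_1)
  qed
qed

definition graded_ideal_of :: "'k::field itself \<Rightarrow> ('a, 'b) gvertex set \<Rightarrow> ('a, 'b, 'k) lpoly set set" where
  "graded_ideal_of K H = lclass ` lgenideal G (gelt ` H)"

lemma graded_ideal_of_mono_iff:
  assumes H: "closed_set G H" "closed_set G H'"
  shows "graded_ideal_of K H \<subseteq> graded_ideal_of K H' \<longleftrightarrow> H \<subseteq> H'"
proof
  have J: "lideal G (lgenideal G (gelt ` H') :: ('a, 'b, 'c) lpoly set)"
    using closed_set_subset[OF H(2)] gelt_lcarrier by (intro lgenideal_ideal) auto
  have RJ: "lrel_ideal \<subseteq> (lgenideal G (gelt ` H') :: ('a, 'b, 'c) lpoly set)"
    using lgenideal_incl[of G "gelt ` H'"] by (intro lrel_ideal_least[OF J]) auto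
  assume sub: "graded_ideal_of K H \<subseteq> graded_ideal_of K H'"
  show "H \<subseteq> H'"
  proof
    fix g assume g: "g \<in> H"
    then have gv: "g \<in> gvertices G" using closed_set_subset[OF H(1)] by auto
    have "lclass (gelt g :: ('a, 'b, 'c) lpoly) \<in> graded_ideal_of K H"
      using g gelt_lgenideal_iff[OF H(1) gv] unfolding graded_ideal_of_def by blast
    then have "(gelt g :: ('a, 'b, 'c) lpoly) \<in> lgenideal G (gelt ` H')"
      using sub leavitt_ideal_image(2)[OF J RJ gelt_lcarrier[OF gv]] unfolding graded_ideal_of_def by blast
    then show "g \<in> H'" using gelt_lgenideal_iff[OF H(2) gv] by blast
  qed
next
  assume "H \<subseteq> H'"
  then show "graded_ideal_of K H \<subseteq> graded_ideal_of K H'"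
    unfolding graded_ideal_of_def lgenideal_def alg_genideal_def by (intro image_mono Inter_anti_mono) blast
qed

lemma graded_ideal_of_graded:
  assumes H: "closed_set G H"
  shows "graded_ideal_of K H \<in> graded_ideals K G"
proof -
  have gv: "H \<subseteq> gvertices G" using closed_set_subset[OF H] .
  have "lclass ` gelt ` H \<subseteq> (\<Union>n. lcomponent K G n)"
    using lclass_gelt_lcomponent[where K = K] gv by blast
  moreover have "graded_ideal_of K H = alg_genideal (leavitt_algebra K G) (lclass ` gelt ` H)"
    unfolding graded_ideal_of_def using gv gelt_lcarrier by (subst lgenideal_lclass) auto
  ultimately show ?thesis unfolding graded_ideals_def by blast
qed

text \<open>Homogeneous generators are lifted to homogeneous elements of the free algebra, where
  \<open>graded_ideal_generated\<close> applies.\<close>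

lemma graded_ideal_eq_graded_ideal_of:
  fixes K :: "'k::field itself"
  assumes "I \<in> graded_ideals K G"
  shows "\<exists>H. closed_set G H \<and> I = graded_ideal_of K H"
proof -
  obtain X where X: "X \<subseteq> (\<Union>n. lcomponent K G n)" "I = alg_genideal (leavitt_algebra K G) X"
    using assms by (auto simp: graded_ideals_def)
  define S :: "('a, 'b, 'k) lpoly set" where "S = {f \<in> (\<Union>n N. hspan G n N). lclass f \<in> X}"
  have S: "S \<subseteq> (\<Union>n N. hspan G n N)" by (auto simp: S_def)
  then have "S \<subseteq> lcarrier G" using hspan_lcarrier by auto
  moreover have "X = lclass ` S"
  proof
    show "X \<subseteq> lclass ` S"
    proof
      fix x assume x: "x \<in> X"
      then obtain n where "x \<in> lcomponent K G n" using X(1) by auto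
      then obtain f where "f \<in> (\<Union>N. hspan G n N)" "x = lclass f" using lcomponent_lclass by blast
      then show "x \<in> lclass ` S" using x by (auto simp: S_def)
    qed
  qed (auto simp: S_def)
  ultimately have I: "I = lclass ` lgenideal G S" using X(2) lgenideal_lclass by metis
  let ?H = "{g \<in> gvertices G. gelt g \<in> lgenideal G S}"
  have "I = graded_ideal_of K ?H"
    unfolding I graded_ideal_of_def using graded_ideal_generated(1)[OF S] by simp
  then show ?thesis using graded_ideal_generated(2)[OF S] by blast
qed

end

section \<open>Transfer along isomorphisms\<close>

definition set_gorder :: "'a set set \<Rightarrow> 'a set gorder" where
  "set_gorder C = \<lparr>carrier = C, eq = (=), le = (\<subseteq>)\<rparr>"

lemma set_gorder_simps [simp]:
  "carrier (set_gorder C) = C" "le (set_gorder C) = (\<subseteq>)" "eq (set_gorder C) = (=)"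
  by (simp_all add: set_gorder_def)

lemma set_gorder_partial_order: "partial_order (set_gorder C)"
  by unfold_locales auto

lemma least_set_gorder:
  assumes "x \<in> C" "y \<in> C"
  shows "least (set_gorder C) s (Upper (set_gorder C) {x, y}) \<longleftrightarrow>
     s \<in> C \<and> x \<subseteq> s \<and> y \<subseteq> s \<and> (\<forall>z\<in>C. x \<subseteq> z \<longrightarrow> y \<subseteq> z \<longrightarrow> s \<subseteq> z)"
proof -
  have "Upper (set_gorder C) {x, y} = {z \<in> C. x \<subseteq> z \<and> y \<subseteq> z}"
    using assms by (auto simp: Upper_def)
  then show ?thesis by (simp add: least_def) blast
qed

lemma greatest_set_gorder:
  assumes "x \<in> C" "y \<in> C"
  shows "greatest (set_gorder C) s (Lower (set_gorder C) {x, y}) \<longleftrightarrow>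
     s \<in> C \<and> s \<subseteq> x \<and> s \<subseteq> y \<and> (\<forall>z\<in>C. z \<subseteq> x \<longrightarrow> z \<subseteq> y \<longrightarrow> z \<subseteq> s)"
proof -
  have "Lower (set_gorder C) {x, y} = {z \<in> C. z \<subseteq> x \<and> z \<subseteq> y}"
    using assms by (auto simp: Lower_def)
  then show ?thesis by (simp add: greatest_def) blast
qed

lemma set_gorder_lattice_Inter:
  assumes Inter: "\<And>D. D \<subseteq> C \<Longrightarrow> D \<noteq> {} \<Longrightarrow> \<Inter>D \<in> C" and top: "T \<in> C" "\<And>x. x \<in> C \<Longrightarrow> x \<subseteq> T"
  shows "Lattice.lattice (set_gorder C)"
proof -
  interpret partial_order "set_gorder C" by (rule set_gorder_partial_order)
  show ?thesis
  proof
    fix x y assume "x \<in> carrier (set_gorder C)" "y \<in> carrier (set_gorder C)"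
    then have xy: "x \<in> C" "y \<in> C" by simp_all
    let ?D = "{z \<in> C. x \<subseteq> z \<and> y \<subseteq> z}"
    have "T \<in> ?D" using top xy by auto
    then have "\<Inter>?D \<in> C" by (intro Inter) auto
    then show "\<exists>s. least (set_gorder C) s (Upper (set_gorder C) {x, y})"
      unfolding least_set_gorder[OF xy] using xy by (intro exI[of _ "\<Inter>?D"]) auto
    have "\<Inter>{x, y} \<in> C" using xy by (intro Inter) auto
    then show "\<exists>s. greatest (set_gorder C) s (Lower (set_gorder C) {x, y})"
      unfolding greatest_set_gorder[OF xy] using xy by (intro exI[of _ "x \<inter> y"]) auto
  qed
qed

section \<open>Order isomorphisms between families of sets\<close>

definition order_iso :: "'a set set \<Rightarrow> 'b set set \<Rightarrow> ('a set \<Rightarrow> 'b set) \<Rightarrow> bool" where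
  "order_iso C D f \<longleftrightarrow> bij_betw f C D \<and> (\<forall>x\<in>C. \<forall>y\<in>C. f x \<subseteq> f y \<longleftrightarrow> x \<subseteq> y)"

lemma order_isoI:
  assumes "\<And>x. x \<in> C \<Longrightarrow> f x \<in> D" "\<And>y. y \<in> D \<Longrightarrow> \<exists>x\<in>C. f x = y"
    and mono: "\<And>x y. x \<in> C \<Longrightarrow> y \<in> C \<Longrightarrow> f x \<subseteq> f y \<longleftrightarrow> x \<subseteq> y"
  shows "order_iso C D f"
proof -
  have "inj_on f C" using mono by (intro inj_onI) (metis order_antisym_conv order_refl)
  moreover have "f ` C = D" using assms(1,2) by blast
  ultimately show ?thesis using mono by (simp add: order_iso_def bij_betw_def)
qed

lemma order_iso_inv:
  assumes "order_iso C D f"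
  shows "order_iso D C (inv_into C f)"
proof -
  have f: "bij_betw f C D" and mono: "\<And>x y. x \<in> C \<Longrightarrow> y \<in> C \<Longrightarrow> f x \<subseteq> f y \<longleftrightarrow> x \<subseteq> y"
    using assms by (auto simp: order_iso_def)
  have "inv_into C f x \<subseteq> inv_into C f y \<longleftrightarrow> x \<subseteq> y" if "x \<in> D" "y \<in> D" for x y
    using mono[of "inv_into C f x" "inv_into C f y"] that f
    by (simp add: bij_betw_def f_inv_into_f inv_into_into)
  then show ?thesis using bij_betw_inv_into[OF f] by (simp add: order_iso_def)
qed

lemma order_iso_comp:
  assumes f: "order_iso C D f" and g: "order_iso D B g"
  shows "order_iso C B (g \<circ> f)"
proof -
  have "f x \<in> D" if "x \<in> C" for x using f that by (auto simp: order_iso_def bij_betw_def)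
  then show ?thesis using assms bij_betw_trans by (fastforce simp: order_iso_def)
qed

text \<open>Least upper and greatest lower bounds are determined by the order, so the isomorphism
  carries over both their existence and their values.\<close>

lemma order_iso_lattice:
  assumes f: "order_iso C D f" and lat: "Lattice.lattice (set_gorder C)"
  shows "lattice_isomorphic (set_gorder C) (set_gorder D)"
proof -
  interpret C: Lattice.lattice "set_gorder C" by (rule lat)
  interpret D: partial_order "set_gorder D" by (rule set_gorder_partial_order)
  have bij: "bij_betw f C D" and mono: "\<And>x y. x \<in> C \<Longrightarrow> y \<in> C \<Longrightarrow> f x \<subseteq> f y \<longleftrightarrow> x \<subseteq> y"
    using f by (auto simp: order_iso_def)
  have fC: "f x \<in> D" if "x \<in> C" for x using bij that by (auto simp: bij_betw_def)
  have surj: "\<exists>x\<in>C. y = f x" if "y \<in> D" for y using bij that by (auto simp: bij_betw_def)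
  have least: "least (set_gorder D) (f s) (Upper (set_gorder D) {f x, f y})"
    if s: "least (set_gorder C) s (Upper (set_gorder C) {x, y})" and xy: "x \<in> C" "y \<in> C" for s x y
    unfolding least_set_gorder[OF fC[OF xy(1)] fC[OF xy(2)]]
  proof (intro conjI ballI impI)
    note s' = s[unfolded least_set_gorder[OF xy]]
    show "f s \<in> D" "f x \<subseteq> f s" "f y \<subseteq> f s" using s' xy fC mono by auto
    fix z assume z: "z \<in> D" "f x \<subseteq> z" "f y \<subseteq> z"
    obtain w where w: "w \<in> C" "z = f w" using surj[OF z(1)] by blast
    then have "x \<subseteq> w" "y \<subseteq> w" using z xy fC mono by auto
    then show "f s \<subseteq> z" using s' w mono by auto
  qed
  have greatest: "greatest (set_gorder D) (f s) (Lower (set_gorder D) {f x, f y})"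
    if s: "greatest (set_gorder C) s (Lower (set_gorder C) {x, y})" and xy: "x \<in> C" "y \<in> C" for s x y
    unfolding greatest_set_gorder[OF fC[OF xy(1)] fC[OF xy(2)]]
  proof (intro conjI ballI impI)
    note s' = s[unfolded greatest_set_gorder[OF xy]]
    show "f s \<in> D" "f s \<subseteq> f x" "f s \<subseteq> f y" using s' xy fC mono by auto
    fix z assume z: "z \<in> D" "z \<subseteq> f x" "z \<subseteq> f y"
    obtain w where w: "w \<in> C" "z = f w" using surj[OF z(1)] by blast
    then have "w \<subseteq> x" "w \<subseteq> y" using z xy fC mono by auto
    then show "z \<subseteq> f s" using s' w mono by auto
  qed
  have "Lattice.lattice (set_gorder D)"
  proof
    fix x' y' assume "x' \<in> carrier (set_gorder D)" "y' \<in> carrier (set_gorder D)"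
    then obtain x y where xy: "x' = f x" "y' = f y" "x \<in> C" "y \<in> C"
      by (simp only: set_gorder_simps) (blast dest: surj)
    show "\<exists>s. least (set_gorder D) s (Upper (set_gorder D) {x', y'})"
      using C.sup_of_two_exists[of x y] least xy by auto
    show "\<exists>s. greatest (set_gorder D) s (Lower (set_gorder D) {x', y'})"
      using C.inf_of_two_exists[of x y] greatest xy by auto
  qed
  then interpret D: Lattice.lattice "set_gorder D" .
  have "f (x \<sqinter>\<^bsub>set_gorder C\<^esub> y) = f x \<sqinter>\<^bsub>set_gorder D\<^esub> f y \<and>
      f (x \<squnion>\<^bsub>set_gorder C\<^esub> y) = f x \<squnion>\<^bsub>set_gorder D\<^esub> f y" if xy: "x \<in> C" "y \<in> C" for x y
  proof
    have "greatest (set_gorder C) (x \<sqinter>\<^bsub>set_gorder C\<^esub> y) (Lower (set_gorder C) {x, y})"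
      by (rule C.meetI) (simp_all only: set_gorder_simps xy)
    then have "greatest (set_gorder D) (f (x \<sqinter>\<^bsub>set_gorder C\<^esub> y)) (Lower (set_gorder D) {f x, f y})"
      using greatest xy by blast
    moreover have "greatest (set_gorder D) (f x \<sqinter>\<^bsub>set_gorder D\<^esub> f y) (Lower (set_gorder D) {f x, f y})"
      by (rule D.meetI) (simp_all only: set_gorder_simps fC xy)
    ultimately show "f (x \<sqinter>\<^bsub>set_gorder C\<^esub> y) = f x \<sqinter>\<^bsub>set_gorder D\<^esub> f y"
      by (rule D.greatest_unique)
    have "least (set_gorder C) (x \<squnion>\<^bsub>set_gorder C\<^esub> y) (Upper (set_gorder C) {x, y})"
      by (rule C.joinI) (simp_all only: set_gorder_simps xy)
    then have "least (set_gorder D) (f (x \<squnion>\<^bsub>set_gorder C\<^esub> y)) (Upper (set_gorder D) {f x, f y})"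
      using least xy by blast
    moreover have "least (set_gorder D) (f x \<squnion>\<^bsub>set_gorder D\<^esub> f y) (Upper (set_gorder D) {f x, f y})"
      by (rule D.joinI) (simp_all only: set_gorder_simps fC xy)
    ultimately show "f (x \<squnion>\<^bsub>set_gorder C\<^esub> y) = f x \<squnion>\<^bsub>set_gorder D\<^esub> f y"
      by (rule D.least_unique)
  qed
  with bij lat D.lattice_axioms show ?thesis by (auto simp: lattice_isomorphic_def)
qed

lemma gamma_order_ideal_subset: "gamma_order_ideal M act I \<Longrightarrow> I \<subseteq> carrier M"
  unfolding gamma_order_ideal_def by (elim conjE)

text \<open>Closure is assumed for \<open>M\<close> only and derived for \<open>N\<close>. As the
  inverse satisfies the same assumptions, each equivalence needs one implication.\<close>

locale gamma_iso =
  fixes M :: "('m, 'x) monoid_scheme" and act :: "int \<Rightarrow> 'm \<Rightarrow> 'm"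
    and N :: "('n, 'y) monoid_scheme" and act' :: "int \<Rightarrow> 'n \<Rightarrow> 'n"
    and h :: "'m \<Rightarrow> 'n"
  assumes bij: "bij_betw h (carrier M) (carrier N)"
    and hom: "\<And>x y. x \<in> carrier M \<Longrightarrow> y \<in> carrier M \<Longrightarrow> h (x \<otimes>\<^bsub>M\<^esub> y) = h x \<otimes>\<^bsub>N\<^esub> h y"
    and one: "h \<one>\<^bsub>M\<^esub> = \<one>\<^bsub>N\<^esub>"
    and equivariant: "\<And>n x. x \<in> carrier M \<Longrightarrow> h (act n x) = act' n (h x)"
    and one_closed: "\<one>\<^bsub>M\<^esub> \<in> carrier M"
    and mult_closed: "\<And>x y. x \<in> carrier M \<Longrightarrow> y \<in> carrier M \<Longrightarrow> x \<otimes>\<^bsub>M\<^esub> y \<in> carrier M"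
    and act_closed: "\<And>n x. x \<in> carrier M \<Longrightarrow> act n x \<in> carrier M"
begin

lemma closed: "x \<in> carrier M \<Longrightarrow> h x \<in> carrier N"
  using bij by (auto simp: bij_betw_def)

lemma surjE:
  assumes "y \<in> carrier N" obtains x where "x \<in> carrier M" "y = h x"
  using assms bij by (auto simp: bij_betw_def)

lemma eq_iff: "x \<in> carrier M \<Longrightarrow> y \<in> carrier M \<Longrightarrow> h x = h y \<longleftrightarrow> x = y"
  using bij by (auto simp: bij_betw_def inj_on_def)

lemma eq_one_iff: "x \<in> carrier M \<Longrightarrow> h x = \<one>\<^bsub>N\<^esub> \<longleftrightarrow> x = \<one>\<^bsub>M\<^esub>"
  using eq_iff[OF _ one_closed] one by simp

lemma inverse: "gamma_iso N act' M act (inv_into (carrier M) h)"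
proof
  let ?k = "inv_into (carrier M) h"
  have k: "?k (h x) = x" if "x \<in> carrier M" for x
    using bij that by (simp add: bij_betw_def)
  show "bij_betw ?k (carrier N) (carrier M)" using bij by (rule bij_betw_inv_into)
  show "?k \<one>\<^bsub>N\<^esub> = \<one>\<^bsub>M\<^esub>" using k[OF one_closed] one by simp
  show "\<one>\<^bsub>N\<^esub> \<in> carrier N" using closed[OF one_closed] one by simp
  show "?k (x \<otimes>\<^bsub>N\<^esub> y) = ?k x \<otimes>\<^bsub>M\<^esub> ?k y" "x \<otimes>\<^bsub>N\<^esub> y \<in> carrier N"
    if xy: "x \<in> carrier N" "y \<in> carrier N" for x y
  proof -
    obtain a b where ab: "a \<in> carrier M" "b \<in> carrier M" "x = h a" "y = h b"
      using xy by (metis surjE)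
    then show "?k (x \<otimes>\<^bsub>N\<^esub> y) = ?k x \<otimes>\<^bsub>M\<^esub> ?k y"
      using hom[of a b] k[of "a \<otimes>\<^bsub>M\<^esub> b"] mult_closed k by simp
    show "x \<otimes>\<^bsub>N\<^esub> y \<in> carrier N" using hom[of a b] closed[of "a \<otimes>\<^bsub>M\<^esub> b"] mult_closed ab by simp
  qed
  show "?k (act' n x) = act n (?k x)" "act' n x \<in> carrier N" if x: "x \<in> carrier N" for n x
  proof -
    obtain a where a: "a \<in> carrier M" "x = h a" using x by (metis surjE)
    then show "?k (act' n x) = act n (?k x)"
      using equivariant[of a n] k[of "act n a"] act_closed k by simp
    show "act' n x \<in> carrier N" using equivariant[of a n] closed[of "act n a"] act_closed a by simp
  qed
qed

lemma order_ideal_image: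
  assumes I: "gamma_order_ideal M act I"
  shows "gamma_order_ideal N act' (h ` I)"
  unfolding gamma_order_ideal_def
proof (intro conjI ballI allI impI)
  have sub: "I \<subseteq> carrier M" and one': "\<one>\<^bsub>M\<^esub> \<in> I"
    and mult: "\<And>x y. x \<in> I \<Longrightarrow> y \<in> I \<Longrightarrow> x \<otimes>\<^bsub>M\<^esub> y \<in> I" and act: "\<And>n x. x \<in> I \<Longrightarrow> act n x \<in> I"
    and down: "\<And>x y. x \<in> carrier M \<Longrightarrow> y \<in> carrier M \<Longrightarrow> x \<otimes>\<^bsub>M\<^esub> y \<in> I \<Longrightarrow> x \<in> I \<and> y \<in> I"
    using I unfolding gamma_order_ideal_def by blast+
  show "h ` I \<subseteq> carrier N" using sub closed by auto
  show "\<one>\<^bsub>N\<^esub> \<in> h ` I" using one' one by (metis imageI)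
  show "x \<otimes>\<^bsub>N\<^esub> y \<in> h ` I" if xy: "x \<in> h ` I" "y \<in> h ` I" for x y
  proof -
    obtain a b where ab: "a \<in> I" "b \<in> I" "x = h a" "y = h b" using xy by auto
    then have "x \<otimes>\<^bsub>N\<^esub> y = h (a \<otimes>\<^bsub>M\<^esub> b)"
      using hom[OF subsetD[OF sub ab(1)] subsetD[OF sub ab(2)]] by simp
    then show ?thesis using mult[OF ab(1,2)] by simp
  qed
  show "act' n x \<in> h ` I" if x: "x \<in> h ` I" for n x
  proof -
    obtain a where a: "a \<in> I" "x = h a" using x by auto
    then have "act' n x = h (act n a)" using equivariant[OF subsetD[OF sub a(1)]] by simp
    then show ?thesis using act[OF a(1)] by simp
  qed
  show "x \<in> h ` I" "y \<in> h ` I"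
    if xy: "x \<in> carrier N" "y \<in> carrier N" "x \<otimes>\<^bsub>N\<^esub> y \<in> h ` I" for x y
  proof -
    obtain a b where ab: "a \<in> carrier M" "b \<in> carrier M" "x = h a" "y = h b"
      using xy by (metis surjE)
    obtain c where c: "c \<in> I" "x \<otimes>\<^bsub>N\<^esub> y = h c" using xy(3) by auto
    then have "h (a \<otimes>\<^bsub>M\<^esub> b) = h c" using hom ab by simp
    then have "a \<otimes>\<^bsub>M\<^esub> b = c" using eq_iff[of "a \<otimes>\<^bsub>M\<^esub> b" c] mult_closed ab c sub by auto
    then have "a \<in> I" "b \<in> I" using down[of a b] ab c by auto
    then show "x \<in> h ` I" "y \<in> h ` I" using ab by auto
  qed
qed

lemma order_iso_order_ideals:
  "order_iso {I. gamma_order_ideal M act I} {I. gamma_order_ideal N act' I} (image h)"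
proof (rule order_isoI)
  show "h ` I \<in> {I. gamma_order_ideal N act' I}" if "I \<in> {I. gamma_order_ideal M act I}" for I
    using order_ideal_image that by simp
  show "\<exists>J\<in>{I. gamma_order_ideal M act I}. h ` J = I" if I: "I \<in> {I. gamma_order_ideal N act' I}" for I
  proof -
    interpret inv: gamma_iso N act' M act "inv_into (carrier M) h" by (rule inverse)
    have "I \<subseteq> h ` carrier M" using I bij gamma_order_ideal_subset[of N act' I] by (simp add: bij_betw_def)
    then have "h ` inv_into (carrier M) h ` I = I" by (rule image_inv_into_cancel[OF HOL.refl])
    moreover have "gamma_order_ideal M act (inv_into (carrier M) h ` I)"
      using I by (intro inv.order_ideal_image) simp
    ultimately show ?thesis by blast
  qed
  show "h ` I \<subseteq> h ` J \<longleftrightarrow> I \<subseteq> J"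
    if "I \<in> {I. gamma_order_ideal M act I}" "J \<in> {I. gamma_order_ideal M act I}" for I J
  proof
    assume IJ: "h ` I \<subseteq> h ` J"
    show "I \<subseteq> J"
    proof
      fix x assume x: "x \<in> I"
      then obtain y where y: "y \<in> J" "h x = h y" using IJ by blast
      have "x \<in> carrier M" "y \<in> carrier M" using x y that gamma_order_ideal_subset by blast+
      then show "x \<in> J" using y eq_iff by simp
    qed
  qed (rule image_mono)
qed

end

section \<open>Properties of elements that isomorphisms preserve\<close>

definition has_periodic :: "('a, 'b) monoid_scheme \<Rightarrow> (int \<Rightarrow> 'a \<Rightarrow> 'a) \<Rightarrow> bool" where
  "has_periodic M act \<longleftrightarrow> (\<exists>x\<in>carrier M. \<exists>n>0. x \<noteq> \<one>\<^bsub>M\<^esub> \<and> act n x = x)"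

definition all_periodic :: "('a, 'b) monoid_scheme \<Rightarrow> (int \<Rightarrow> 'a \<Rightarrow> 'a) \<Rightarrow> bool" where
  "all_periodic M act \<longleftrightarrow> (\<forall>x\<in>carrier M. \<exists>n>0. act n x = x)"

definition has_decreasing :: "('a, 'b) monoid_scheme \<Rightarrow> (int \<Rightarrow> 'a \<Rightarrow> 'a) \<Rightarrow> bool" where
  "has_decreasing M act \<longleftrightarrow>
     (\<exists>x\<in>carrier M. \<exists>y\<in>carrier M. \<exists>n>0. y \<noteq> \<one>\<^bsub>M\<^esub> \<and> x = act n x \<otimes>\<^bsub>M\<^esub> y)"

text \<open>A one-sided form of periodicity in the quotient by \<open>I\<close>; requiring
  \<open>x \<notin> I\<close> excludes the trivial class.\<close>

definition has_periodic_mod :: "('a, 'b) monoid_scheme \<Rightarrow> (int \<Rightarrow> 'a \<Rightarrow> 'a) \<Rightarrow> bool" where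
  "has_periodic_mod M act \<longleftrightarrow>
     (\<exists>I. gamma_order_ideal M act I \<and>
       (\<exists>x\<in>carrier M. \<exists>y\<in>I. \<exists>n>0. x \<notin> I \<and> x = act n x \<otimes>\<^bsub>M\<^esub> y))"

lemma (in gamma_iso) invariants_imp:
  "has_periodic M act \<Longrightarrow> has_periodic N act'"
  "all_periodic M act \<Longrightarrow> all_periodic N act'"
  "has_decreasing M act \<Longrightarrow> has_decreasing N act'"
  "has_periodic_mod M act \<Longrightarrow> has_periodic_mod N act'"
proof -
  show "has_periodic N act'" if "has_periodic M act"
    using that closed eq_one_iff equivariant unfolding has_periodic_def by metis
  show "all_periodic N act'" if "all_periodic M act"
    using that equivariant unfolding all_periodic_def by (metis surjE)
  show "has_decreasing N act'" if "has_decreasing M act"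
    using that closed eq_one_iff equivariant hom act_closed unfolding has_decreasing_def by metis
  show "has_periodic_mod N act'" if mod: "has_periodic_mod M act"
  proof -
    obtain I x y n where I: "gamma_order_ideal M act I" and x: "x \<in> carrier M" "y \<in> I" "n > 0"
      "x \<notin> I" "x = act n x \<otimes>\<^bsub>M\<^esub> y"
      using mod unfolding has_periodic_mod_def by blast
    have sub: "I \<subseteq> carrier M" using I by (rule gamma_order_ideal_subset)
    then have "h x \<notin> h ` I" using x eq_iff by auto
    moreover have "h x = act' n (h x) \<otimes>\<^bsub>N\<^esub> h y"
      using x sub hom[of "act n x" y] equivariant[of x n] act_closed by auto
    ultimately show ?thesis
      unfolding has_periodic_mod_def using order_ideal_image[OF I] closed[OF x(1)] x(2,3) by blast
  qed
qed

lemma (in gamma_iso) invariants: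
  "has_periodic M act \<longleftrightarrow> has_periodic N act'"
  "all_periodic M act \<longleftrightarrow> all_periodic N act'"
  "has_decreasing M act \<longleftrightarrow> has_decreasing N act'"
  "has_periodic_mod M act \<longleftrightarrow> has_periodic_mod N act'"
  using invariants_imp gamma_iso.invariants_imp[OF inverse] by blast+

section \<open>The invariants in terms of the graph\<close>

context wf_digraph
begin

lemma gclass_act_eq_iff:
  assumes "a \<in> free_gmonoid G"
  shows "gact G n (gclass G a) = gclass G a \<longleftrightarrow> gcong G a (shift n a)"
  using assms gclass_eq_iff[of a G "shift n a"] by (auto simp: gact_gclass)

lemma gclass_act_mult_eq_iff:
  assumes "a \<in> free_gmonoid G" "b \<in> free_gmonoid G"
  shows "gclass G a = gact G n (gclass G a) \<otimes>\<^bsub>graph_monoid G\<^esub> gclass G b \<longleftrightarrow>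
    gcong G a (shift n a + b)"
  using assms by (simp add: gact_gclass mult_graph_monoid gclass_eq_iff)

lemma has_periodic_iff:
  "has_periodic (graph_monoid G) (gact G) \<longleftrightarrow> (\<exists>c. is_cycle G c \<and> \<not> has_exit G c)"
proof -
  have "has_periodic (graph_monoid G) (gact G) \<longleftrightarrow>
      (\<exists>a\<in>free_gmonoid G. \<exists>n>0. a \<noteq> {#} \<and> gcong G a (shift n a))"
    by (simp add: has_periodic_def carrier_graph_monoid gclass_act_eq_iff gclass_eq_one_iff)
  then show ?thesis unfolding no_exit_cycle_iff using gcong_free by blast
qed

lemma has_decreasing_iff:
  "has_decreasing (graph_monoid G) (gact G) \<longleftrightarrow> (\<exists>c. is_cycle G c \<and> has_exit G c)"
proof -
  have "has_decreasing (graph_monoid G) (gact G) \<longleftrightarrow>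
      (\<exists>a\<in>free_gmonoid G. \<exists>b\<in>free_gmonoid G. \<exists>n>0. b \<noteq> {#} \<and> gcong G a (shift n a + b))"
    by (simp add: has_decreasing_def carrier_graph_monoid gclass_act_mult_eq_iff gclass_eq_one_iff)
  then show ?thesis unfolding exit_cycle_iff using gcong_free by (metis free_add)
qed

lemma has_periodic_mod_iff: "has_periodic_mod (graph_monoid G) (gact G) \<longleftrightarrow> \<not> condition_K G"
proof -
  have "has_periodic_mod (graph_monoid G) (gact G) \<longleftrightarrow>
      (\<exists>a b n H. n > 0 \<and> closed_set G H \<and> snd ` set_mset b \<subseteq> H \<and>
        \<not> snd ` set_mset a \<subseteq> H \<and> gcong G a (shift n a + b))" (is "?L \<longleftrightarrow> ?R")
  proof
    assume ?L
    then obtain I x y n where I: "gamma_order_ideal (graph_monoid G) (gact G) I" and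
      xy: "x \<in> carrier (graph_monoid G)" "y \<in> I" "n > 0" "x \<notin> I"
         "x = gact G n x \<otimes>\<^bsub>graph_monoid G\<^esub> y"
      unfolding has_periodic_mod_def by blast
    have "y \<in> carrier (graph_monoid G)" using gamma_order_ideal_subset[OF I] xy(2) by blast
    then obtain a b where ab: "a \<in> free_gmonoid G" "b \<in> free_gmonoid G" "x = gclass G a" "y = gclass G b"
      using xy(1) by (auto simp: carrier_graph_monoid)
    then have "gcong G a (shift n a + b)" using xy(5) gclass_act_mult_eq_iff by metis
    moreover have "\<not> snd ` set_mset a \<subseteq> closed_set_of G I" "snd ` set_mset b \<subseteq> closed_set_of G I"
      using xy ab gclass_in_order_ideal_iff[OF I] by auto
    ultimately show ?R using xy(3) closed_set_of_closed[OF I] by blast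
  next
    assume ?R
    then obtain a b n H where *: "n > 0" "closed_set G H" "snd ` set_mset b \<subseteq> H"
        "\<not> snd ` set_mset a \<subseteq> H" "gcong G a (shift n a + b)" by blast
    have free: "a \<in> free_gmonoid G" "b \<in> free_gmonoid G" using gcong_free[OF *(5)] by auto
    have eq: "gclass G a = gact G n (gclass G a) \<otimes>\<^bsub>graph_monoid G\<^esub> gclass G b"
      using *(5) gclass_act_mult_eq_iff[OF free] by simp
    have "gclass G a \<in> carrier (graph_monoid G)" using free by (simp add: carrier_graph_monoid)
    moreover have "gclass G a \<notin> order_ideal_of G H" "gclass G b \<in> order_ideal_of G H"
      using gclass_in_order_ideal_of[OF *(2)] free *(3,4) by auto
    ultimately show ?L
      unfolding has_periodic_mod_def using order_ideal_of_ideal[OF *(2)] eq *(1) by blast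
  qed
  then show ?thesis using condition_K_iff by blast
qed

lemma all_periodic_iff:
  "all_periodic (graph_monoid G) (gact G) \<longleftrightarrow> (\<forall>a\<in>free_gmonoid G. \<exists>n>0. gcong G a (shift n a))"
  by (simp add: all_periodic_def carrier_graph_monoid gclass_act_eq_iff)

lemma all_periodic_no_exit_iff:
  "\<not> has_decreasing (graph_monoid G) (gact G) \<and> all_periodic (graph_monoid G) (gact G) \<longleftrightarrow>
     row_finite G \<and> no_exit_graph G \<and> (\<forall>v. \<not> is_sink G v) \<and>
        (\<forall>p. infinite_path G p \<longrightarrow> ends_in_cycle G p)"
proof -
  have "\<not> has_decreasing (graph_monoid G) (gact G) \<longleftrightarrow> no_exit_graph G"
    unfolding has_decreasing_iff no_exit_graph_def by blast
  then show ?thesis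
    unfolding all_periodic_iff
    using row_finite_no_exit_periodic periodic_row_finite by blast
qed

lemma order_iso_order_ideal_of:
  "order_iso {H. closed_set G H} {I. gamma_order_ideal (graph_monoid G) (gact G) I} (order_ideal_of G)"
proof (rule order_isoI)
  show "order_ideal_of G H \<in> {I. gamma_order_ideal (graph_monoid G) (gact G) I}"
    if "H \<in> {H. closed_set G H}" for H using that order_ideal_of_ideal by simp
  show "\<exists>H\<in>{H. closed_set G H}. order_ideal_of G H = I"
    if "I \<in> {I. gamma_order_ideal (graph_monoid G) (gact G) I}" for I
    using that closed_set_of_closed order_ideal_of_closed_set_of by auto
  show "order_ideal_of G H \<subseteq> order_ideal_of G H' \<longleftrightarrow> H \<subseteq> H'"
    if "H \<in> {H. closed_set G H}" "H' \<in> {H. closed_set G H}" for H H'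
    using that order_ideal_of_mono[of H H'] closed_set_of_mono[of "order_ideal_of G H" "order_ideal_of G H'"]
    by (auto simp: closed_set_of_order_ideal_of)
qed

lemma order_iso_graded_ideal_of:
  "order_iso {H. closed_set G H} (graded_ideals K G) (graded_ideal_of K)"
proof (rule order_isoI)
  show "graded_ideal_of K H \<in> graded_ideals K G" if "H \<in> {H. closed_set G H}" for H
    using that graded_ideal_of_graded by simp
  show "\<exists>H\<in>{H. closed_set G H}. graded_ideal_of K H = I" if "I \<in> graded_ideals K G" for I
    using graded_ideal_eq_graded_ideal_of[OF that] by blast
  show "graded_ideal_of K H \<subseteq> graded_ideal_of K H' \<longleftrightarrow> H \<subseteq> H'"
    if "H \<in> {H. closed_set G H}" "H' \<in> {H. closed_set G H}" for H H'
    using that by (intro graded_ideal_of_mono_iff) simp_all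
qed

lemma closed_set_lattice: "Lattice.lattice (set_gorder {H. closed_set G H})"
proof (rule set_gorder_lattice_Inter[of _ "gvertices G"])
  show "\<Inter>D \<in> {H. closed_set G H}" if "D \<subseteq> {H. closed_set G H}" "D \<noteq> {}" for D
    using that closed_set_Inter[of D G] by auto
qed (auto simp: closed_set_gvertices dest: closed_set_subset)

lemma gamma_isoI:
  assumes F: "wf_digraph F" and h: "gamma_monoid_iso G F h"
  shows "gamma_iso (graph_monoid G) (gact G) (graph_monoid F) (gact F) h"
proof
  show "bij_betw h (carrier (graph_monoid G)) (carrier (graph_monoid F))"
    using h by (simp add: gamma_monoid_iso_def iso_def)
  show "h (x \<otimes>\<^bsub>graph_monoid G\<^esub> y) = h x \<otimes>\<^bsub>graph_monoid F\<^esub> h y"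
    if "x \<in> carrier (graph_monoid G)" "y \<in> carrier (graph_monoid G)" for x y
    using h that by (simp add: gamma_monoid_iso_def iso_def hom_def)
  show "h \<one>\<^bsub>graph_monoid G\<^esub> = \<one>\<^bsub>graph_monoid F\<^esub>" using h by (simp add: gamma_monoid_iso_def)
  show "h (gact G n x) = gact F n (h x)" if "x \<in> carrier (graph_monoid G)" for n x
    using h that by (simp add: gamma_monoid_iso_def)
  show "\<one>\<^bsub>graph_monoid G\<^esub> \<in> carrier (graph_monoid G)"
    by (simp add: one_graph_monoid carrier_graph_monoid)
  show "x \<otimes>\<^bsub>graph_monoid G\<^esub> y \<in> carrier (graph_monoid G)"
    if "x \<in> carrier (graph_monoid G)" "y \<in> carrier (graph_monoid G)" for x y
    using that by (auto simp: carrier_graph_monoid mult_graph_monoid)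
  show "gact G n x \<in> carrier (graph_monoid G)" if "x \<in> carrier (graph_monoid G)" for n x
    using that by (auto simp: carrier_graph_monoid gact_gclass)
qed

end

theorem corollary5p11:
  fixes E :: "('v, 'e) pre_digraph"
    and F :: "('w, 'f) pre_digraph"
    and K :: "'k::field itself"
  assumes "wf_digraph E"
    and "wf_digraph F"
    and "\<exists>h. gamma_monoid_iso E F h"
  shows "(condition_L E \<longleftrightarrow> condition_L F) \<and>
    (condition_K E \<longleftrightarrow> condition_K F) \<and>
    lattice_isomorphic (graded_ideal_lattice K E) (graded_ideal_lattice K F) \<and>
    (acyclic_graph E \<longleftrightarrow> acyclic_graph F) \<and>
    ((\<exists>c. is_cycle E c \<and> \<not> has_exit E c) \<longleftrightarrow> (\<exists>c. is_cycle F c \<and> \<not> has_exit F c)) \<and>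
    ((\<exists>c. is_cycle E c \<and> has_exit E c) \<longleftrightarrow> (\<exists>c. is_cycle F c \<and> has_exit F c)) \<and>
    (no_exit_graph E \<longleftrightarrow> no_exit_graph F) \<and>
    ((row_finite E \<and> no_exit_graph E \<and> (\<forall>v. \<not> is_sink E v) \<and>
        (\<forall>p. infinite_path E p \<longrightarrow> ends_in_cycle E p)) \<longleftrightarrow>
     (row_finite F \<and> no_exit_graph F \<and> (\<forall>v. \<not> is_sink F v) \<and>
        (\<forall>p. infinite_path F p \<longrightarrow> ends_in_cycle F p)))"
proof -
  interpret E: wf_digraph E by (rule assms(1))
  interpret F: wf_digraph F by (rule assms(2))
  obtain h where "gamma_monoid_iso E F h" using assms(3) by blast
  then interpret iso: gamma_iso "graph_monoid E" "gact E" "graph_monoid F" "gact F" h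
    by (rule E.gamma_isoI[OF assms(2)])
  note periodic = iso.invariants(1)[unfolded E.has_periodic_iff F.has_periodic_iff]
  note decreasing = iso.invariants(3)[unfolded E.has_decreasing_iff F.has_decreasing_iff]
  have K: "condition_K E \<longleftrightarrow> condition_K F"
    using iso.invariants(4) by (simp add: E.has_periodic_mod_iff F.has_periodic_mod_iff)
  note condition_8 = iso.invariants(2,3) E.all_periodic_no_exit_iff F.all_periodic_no_exit_iff
  have C: "order_iso {H. closed_set E H} (graded_ideals K E) (E.graded_ideal_of K)"
    by (rule E.order_iso_graded_ideal_of)
  \<comment> \<open>That graded ideals form a lattice is inherited from the closed sets.\<close>
  have "lattice_isomorphic (set_gorder {H. closed_set E H}) (set_gorder (graded_ideals K E))"
    by (rule order_iso_lattice[OF C E.closed_set_lattice])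
  then have lat: "Lattice.lattice (set_gorder (graded_ideals K E))"
    by (simp add: lattice_isomorphic_def)
  \<comment> \<open>The isomorphism leads from graded ideals of \<open>E\<close> through closed sets
    to order-ideals, across by \<open>h\<close>, and back down on the side of
    \<open>F\<close>.\<close>
  note iso_F = order_iso_comp[OF order_iso_inv[OF F.order_iso_order_ideal_of] F.order_iso_graded_ideal_of[of K]]
  note iso_E = order_iso_comp[OF order_iso_inv[OF C] E.order_iso_order_ideal_of]
  have "lattice_isomorphic (set_gorder (graded_ideals K E)) (set_gorder (graded_ideals K F))"
    by (rule order_iso_lattice[OF order_iso_comp[OF order_iso_comp[OF iso_E iso.order_iso_order_ideals] iso_F] lat])
  then have "lattice_isomorphic (graded_ideal_lattice K E) (graded_ideal_lattice K F)"
    by (simp add: graded_ideal_lattice_def set_gorder_def)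
  moreover have "condition_L E \<longleftrightarrow> condition_L F"
    using periodic unfolding condition_L_def by blast
  \<comment> \<open>Every cycle either has an exit or has none, and both kinds are already
    transferred.\<close>
  moreover have "acyclic_graph E \<longleftrightarrow> acyclic_graph F"
    using periodic decreasing unfolding acyclic_graph_def by blast
  moreover have "no_exit_graph E \<longleftrightarrow> no_exit_graph F"
    using decreasing unfolding no_exit_graph_def by blast
  ultimately show ?thesis
    using periodic decreasing K condition_8 by argo
qed

end
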